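(* Let $\mathcal C=\mathbb R^3\times\mathbb S^2$ with points $(\vec r,\vec n)$, let $\omega^0=\vec n\cdot\mathrm d\vec r$, $\mathcal D=\ker\omega^0$ and $g=(\mathrm d\vec r\cdot\mathrm d\vec n)|_{\mathcal D}$. Then the Legendrean contact structure $(\mathcal C,[\omega^0],[g])$ is the flat 5-dimensional Legendrean contact structure (up to local equivalence). As such, its Lie algebra of infinitesimal symmetries is $\mathfrak{sl}(4,\mathbb R)$.
   Context: $\mathcal C$ is the configuration space of a "flying saucer" (disc with centre $\vec r$ and unit normal $\vec n$), and $(\mathcal C,[\omega^0],[g])$ is the structure determined by its attacking mode man\oe uvres, which are the curves with $\vec n\cdot\dot{\vec r}=0$ and $\dot{\vec r}\cdot\dot{\vec n}=0$. A Legendrean contact structure on a $(2n+1)$-manifold $M$ is a contact distribution $\mathcal D=\ker\omega^0$ with a splitting $\mathcal D=\mathcal D^+\oplus\mathcal D^-$ into rank $n$ subbundles on which $\Omega=(\mathrm d\omega^0)|_{\mathcal D}$ vanishes. Here it arises from a conformal class $[g]$ of split signature metrics on $\mathcal D$: after suitable rescaling of $g$ and $\Omega$, the endomorphism $K^i{}_j=g^{ik}\Omega_{kj}$ of $\mathcal D$ satisfies $K^2=\mathrm{Id}$, and $\mathcal D^\pm$ are its $\pm1$ eigenspaces; the structure is then denoted $(M,[\omega^0],[g])$. On the open set $\{\vec n\cdot\vec e_z>0\}$, with coordinates $(x,y,z,a,b)$ given by $\vec r=(x,y,z)$ and $\vec n=(-a,-b,1)/\sqrt{1+a^2+b^2}$,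 one may take $\omega^0=\mathrm dz-a\,\mathrm dx-b\,\mathrm dy$ and $g=2(\mathrm dx\,\mathrm da+\mathrm dy\,\mathrm db)$. Two such structures $(M,[\omega^0],[g])$, $(\bar M,[\bar\omega^0],[\bar g])$ are locally equivalent if there is a local diffeomorphism $\phi:M\to\bar M$ with $\phi^*\bar\omega^0=f\omega^0$ and $\phi^*\bar g=hg+\tau\omega^0$ for nonvanishing functions $f,h$ and a 1-form $\tau$. An infinitesimal symmetry is a vector field $X$ with $\mathcal L_X\omega^0=p\,\omega^0$ and $\mathcal L_Xg=q\,g+\mu\,\omega^0$ for some functions $p,q$ and 1-form $\mu$ ($g$ being extended to a symmetric tensor on $M$ in any way, products being symmetric). Among all Legendrean contact structures of a given dimension there is, modulo local equivalence, a unique one whose Lie algebra of local infinitesimal symmetries has the highest dimension; this one is called the flat structure. In dimension 5 the maximal symmetry algebra is 15-dimensional. *)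

theory Defs
  imports "HOL-Analysis.Analysis" "HOL-Library.Extended_Nat"
begin

section \<open>Smooth maps and embedded submanifolds\<close>

text \<open>
  Manifolds are smooth embedded submanifolds \<open>M\<close> of an arbitrary Euclidean space
  (no loss of generality, by Whitney's theorem). An open subset of a submanifold is again
  one, so local notions are obtained by replacing \<open>M\<close> with \<open>M \<inter> U\<close>, \<open>U\<close> open.
\<close>

text \<open>Meant for open \<open>U\<close> and finite-dimensional domains.\<close>
primrec Ck_on :: "nat \<Rightarrow> 'a::real_normed_vector set \<Rightarrow> ('a \<Rightarrow> 'b::real_normed_vector) \<Rightarrow> bool" where
  "Ck_on 0 U f \<longleftrightarrow> continuous_on U f"
| "Ck_on (Suc k) U f \<longleftrightarrow>
     f differentiable_on U \<and> (\<forall>v. Ck_on k U (\<lambda>x. frechet_derivative f (at x) v))"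

definition smooth_on :: "'a::real_normed_vector set \<Rightarrow> ('a \<Rightarrow> 'b::real_normed_vector) \<Rightarrow> bool" where
  "smooth_on U f \<longleftrightarrow> (\<forall>k. Ck_on k U f)"

definition smooth_map_on :: "'a::real_normed_vector set \<Rightarrow> ('a \<Rightarrow> 'b::real_normed_vector) \<Rightarrow> bool" where
  "smooth_map_on M f \<longleftrightarrow>
     (\<forall>p\<in>M. \<exists>U F. open U \<and> p \<in> U \<and> smooth_on U F \<and> (\<forall>x\<in>U \<inter> M. F x = f x))"

definition submanifold :: "nat \<Rightarrow> 'a::euclidean_space set \<Rightarrow> bool" where
  "submanifold k M \<longleftrightarrow>
     (\<forall>p\<in>M. \<exists>U V (\<Phi> :: 'a \<Rightarrow> 'a) (\<Psi> :: 'a \<Rightarrow> 'a) S.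
        open U \<and> p \<in> U \<and> open V \<and> smooth_on U \<Phi> \<and> smooth_on V \<Psi> \<and>
        \<Phi> ` U = V \<and> (\<forall>x\<in>U. \<Psi> (\<Phi> x) = x) \<and>
        subspace S \<and> dim S = k \<and> \<Phi> ` (U \<inter> M) = V \<inter> S)"

definition tangent_space :: "'a::euclidean_space set \<Rightarrow> 'a \<Rightarrow> 'a set" where
  "tangent_space M p =
     {v. \<exists>(\<gamma> :: real \<Rightarrow> 'a) e. e > 0 \<and> (\<forall>t\<in>{-e<..<e}. \<gamma> t \<in> M) \<and> \<gamma> 0 = p \<and>
           (\<gamma> has_vector_derivative v) (at 0)}"

text \<open>
  Derivative along \<open>M\<close>. The Frechet derivative within \<open>M\<close> is only determined on tangent
  vectors of \<open>M\<close>, and it is only ever applied to those.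
\<close>
definition mderiv :: "'a::euclidean_space set \<Rightarrow> ('a \<Rightarrow> 'b::real_normed_vector) \<Rightarrow> 'a \<Rightarrow> 'a \<Rightarrow> 'b" where
  "mderiv M f p v = frechet_derivative f (at p within M) v"

text \<open>
  Vector fields are set to \<open>0\<close> off \<open>M\<close>, so that equality of functions is equality of
  vector fields on \<open>M\<close>.
\<close>
definition vector_field :: "'a::euclidean_space set \<Rightarrow> ('a \<Rightarrow> 'a) \<Rightarrow> bool" where
  "vector_field M X \<longleftrightarrow>
     smooth_map_on M X \<and> (\<forall>p\<in>M. X p \<in> tangent_space M p) \<and> (\<forall>p. p \<notin> M \<longrightarrow> X p = 0)"

definition lie_bracket :: "'a::euclidean_space set \<Rightarrow> ('a \<Rightarrow> 'a) \<Rightarrow> ('a \<Rightarrow> 'a) \<Rightarrow> 'a \<Rightarrow> 'a" where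
  "lie_bracket M X Y p = (if p \<in> M then mderiv M Y p (X p) - mderiv M X p (Y p) else 0)"

text \<open>
  Covariant tensor fields are given by their values on ambient vectors, but only the
  restriction to the tangent spaces of \<open>M\<close> carries meaning. The exterior and Lie derivatives
  below are the ambient coordinate formulas with constant arguments \<open>u\<close>, \<open>v\<close>; on tangent
  vectors they do not depend on the ambient extension, since both operations commute with
  the pull-back to \<open>M\<close>.
\<close>
definition one_form :: "'a::euclidean_space set \<Rightarrow> ('a \<Rightarrow> 'a \<Rightarrow> real) \<Rightarrow> bool" where
  "one_form M \<omega> \<longleftrightarrow> (\<forall>p\<in>M. linear (\<omega> p)) \<and> (\<forall>v. smooth_map_on M (\<lambda>p. \<omega> p v))"

definition sym_tensor :: "'a::euclidean_space set \<Rightarrow> ('a \<Rightarrow> 'a \<Rightarrow> 'a \<Rightarrow> real) \<Rightarrow> bool" where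
  "sym_tensor M g \<longleftrightarrow>
     (\<forall>p\<in>M. bilinear (g p) \<and> (\<forall>u v. g p u v = g p v u)) \<and>
     (\<forall>u v. smooth_map_on M (\<lambda>p. g p u v))"

definition ext_deriv :: "'a::euclidean_space set \<Rightarrow> ('a \<Rightarrow> 'a \<Rightarrow> real) \<Rightarrow> 'a \<Rightarrow> 'a \<Rightarrow> 'a \<Rightarrow> real" where
  "ext_deriv M \<omega> p u v = mderiv M (\<lambda>x. \<omega> x v) p u - mderiv M (\<lambda>x. \<omega> x u) p v"

definition lie_deriv_form ::
  "'a::euclidean_space set \<Rightarrow> ('a \<Rightarrow> 'a) \<Rightarrow> ('a \<Rightarrow> 'a \<Rightarrow> real) \<Rightarrow> 'a \<Rightarrow> 'a \<Rightarrow> real" where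
  "lie_deriv_form M X \<omega> p u = mderiv M (\<lambda>x. \<omega> x u) p (X p) + \<omega> p (mderiv M X p u)"

definition lie_deriv_tensor ::
  "'a::euclidean_space set \<Rightarrow> ('a \<Rightarrow> 'a) \<Rightarrow> ('a \<Rightarrow> 'a \<Rightarrow> 'a \<Rightarrow> real) \<Rightarrow> 'a \<Rightarrow> 'a \<Rightarrow> 'a \<Rightarrow> real" where
  "lie_deriv_tensor M X g p u v =
     mderiv M (\<lambda>x. g x u v) p (X p) + g p (mderiv M X p u) v + g p u (mderiv M X p v)"

section \<open>Legendrean contact structures\<close>

definition distr :: "'a::euclidean_space set \<Rightarrow> ('a \<Rightarrow> 'a \<Rightarrow> real) \<Rightarrow> 'a \<Rightarrow> 'a set" where
  "distr M \<omega> p = {v \<in> tangent_space M p. \<omega> p v = 0}"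

definition contact_form :: "nat \<Rightarrow> 'a::euclidean_space set \<Rightarrow> ('a \<Rightarrow> 'a \<Rightarrow> real) \<Rightarrow> bool" where
  "contact_form n M \<omega> \<longleftrightarrow>
     submanifold (2 * n + 1) M \<and> one_form M \<omega> \<and>
     (\<forall>p\<in>M. (\<exists>v\<in>tangent_space M p. \<omega> p v \<noteq> 0) \<and>
        (\<forall>u\<in>distr M \<omega> p. (\<forall>v\<in>distr M \<omega> p. ext_deriv M \<omega> p u v = 0) \<longrightarrow> u = 0))"

text \<open>The bilinear form \<open>B\<close> has signature \<open>(n, n)\<close> on \<open>V\<close>.\<close>
definition split_signature :: "nat \<Rightarrow> 'a::euclidean_space set \<Rightarrow> ('a \<Rightarrow> 'a \<Rightarrow> real) \<Rightarrow> bool" where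
  "split_signature n V B \<longleftrightarrow>
     subspace V \<and> dim V = 2 * n \<and>
     (\<exists>P N. subspace P \<and> subspace N \<and> P \<subseteq> V \<and> N \<subseteq> V \<and> dim P = n \<and> dim N = n \<and>
        (\<forall>v\<in>P. v \<noteq> 0 \<longrightarrow> B v v > 0) \<and> (\<forall>v\<in>N. v \<noteq> 0 \<longrightarrow> B v v < 0))"

definition subbundle :: "nat \<Rightarrow> 'a::euclidean_space set \<Rightarrow> ('a \<Rightarrow> 'a set) \<Rightarrow> bool" where
  "subbundle n M D \<longleftrightarrow>
     (\<forall>p\<in>M. subspace (D p) \<and> dim (D p) = n \<and> D p \<subseteq> tangent_space M p) \<and>
     (\<forall>p\<in>M. \<exists>U (e :: nat \<Rightarrow> 'a \<Rightarrow> 'a). open U \<and> p \<in> U \<and>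
        (\<forall>i<n. smooth_map_on (M \<inter> U) (e i)) \<and>
        (\<forall>q\<in>M \<inter> U. D q = span ((\<lambda>i. e i q) ` {..<n})))"

text \<open>A splitting of the contact distribution into rank \<open>n\<close> subbundles on which
  \<open>d\<omega>\<close> vanishes.\<close>
definition legendrean_splitting ::
  "nat \<Rightarrow> 'a::euclidean_space set \<Rightarrow> ('a \<Rightarrow> 'a \<Rightarrow> real) \<Rightarrow> ('a \<Rightarrow> 'a set) \<Rightarrow> ('a \<Rightarrow> 'a set) \<Rightarrow> bool" where
  "legendrean_splitting n M \<omega> D1 D2 \<longleftrightarrow>
     subbundle n M D1 \<and> subbundle n M D2 \<and>
     (\<forall>p\<in>M. D1 p \<inter> D2 p = {0} \<and> {u + v |u v. u \<in> D1 p \<and> v \<in> D2 p} = distr M \<omega> p \<and>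
        (\<forall>u\<in>D1 p. \<forall>v\<in>D1 p. ext_deriv M \<omega> p u v = 0) \<and>
        (\<forall>u\<in>D2 p. \<forall>v\<in>D2 p. ext_deriv M \<omega> p u v = 0))"

text \<open>
  The endomorphism \<open>K\<close> of the contact distribution with \<open>g(u, K v) = d\<omega>(u, v)\<close>, that is,
  \<open>K\<^sup>i\<^sub>j = g\<^sup>i\<^sup>k \<Omega>\<^sub>k\<^sub>j\<close>. It is well defined when \<open>g\<close> is nondegenerate there.
\<close>
definition K_endo ::
  "'a::euclidean_space set \<Rightarrow> ('a \<Rightarrow> 'a \<Rightarrow> real) \<Rightarrow> ('a \<Rightarrow> 'a \<Rightarrow> 'a \<Rightarrow> real) \<Rightarrow> 'a \<Rightarrow> 'a \<Rightarrow> 'a" where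
  "K_endo M \<omega> g p v =
     (THE w. w \<in> distr M \<omega> p \<and> (\<forall>u\<in>distr M \<omega> p. g p u w = ext_deriv M \<omega> p u v))"

definition K_eigen ::
  "'a::euclidean_space set \<Rightarrow> ('a \<Rightarrow> 'a \<Rightarrow> real) \<Rightarrow> ('a \<Rightarrow> 'a \<Rightarrow> 'a \<Rightarrow> real) \<Rightarrow> ('a \<Rightarrow> real) \<Rightarrow> real \<Rightarrow> 'a \<Rightarrow> 'a set" where
  "K_eigen M \<omega> g c s p = {v \<in> distr M \<omega> p. c p *\<^sub>R K_endo M \<omega> g p v = s *\<^sub>R v}"

text \<open>
  The structure \<open>(M, [\<omega>], [g])\<close> in dimension \<open>2n + 1\<close>, through representatives \<open>\<omega>\<close> and \<open>g\<close>;
  \<open>g\<close> is given as a symmetric tensor on \<open>M\<close> extending the metric on the contact distribution.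
  Rescaling \<open>g\<close> and \<open>d\<omega>\<close> by nonvanishing functions multiplies \<open>K\<close> by a nonvanishing
  function \<open>c\<close>.
\<close>
definition legendrean_contact ::
  "nat \<Rightarrow> 'a::euclidean_space set \<Rightarrow> ('a \<Rightarrow> 'a \<Rightarrow> real) \<Rightarrow> ('a \<Rightarrow> 'a \<Rightarrow> 'a \<Rightarrow> real) \<Rightarrow> bool" where
  "legendrean_contact n M \<omega> g \<longleftrightarrow>
     contact_form n M \<omega> \<and> sym_tensor M g \<and>
     (\<forall>p\<in>M. split_signature n (distr M \<omega> p) (g p)) \<and>
     (\<exists>c. smooth_map_on M c \<and> (\<forall>p\<in>M. c p \<noteq> 0) \<and>
        (\<forall>p\<in>M. \<forall>v\<in>distr M \<omega> p.
           c p *\<^sub>R K_endo M \<omega> g p (c p *\<^sub>R K_endo M \<omega> g p v) = v) \<and>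
        legendrean_splitting n M \<omega> (K_eigen M \<omega> g c 1) (K_eigen M \<omega> g c (-1)))"

section \<open>Infinitesimal symmetries and flatness\<close>

text \<open>The product of the one-forms \<open>\<mu>\<close> and \<open>\<omega>\<close> is the symmetric product, with factor \<open>1/2\<close>.\<close>
definition symmetries ::
  "'a::euclidean_space set \<Rightarrow> ('a \<Rightarrow> 'a \<Rightarrow> real) \<Rightarrow> ('a \<Rightarrow> 'a \<Rightarrow> 'a \<Rightarrow> real) \<Rightarrow> ('a \<Rightarrow> 'a) set" where
  "symmetries M \<omega> g =
     {X. vector_field M X \<and>
        (\<exists>r. smooth_map_on M r \<and>
           (\<forall>p\<in>M. \<forall>u\<in>tangent_space M p. lie_deriv_form M X \<omega> p u = r p * \<omega> p u)) \<and>
        (\<exists>q \<mu>. smooth_map_on M q \<and> one_form M \<mu> \<and>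
           (\<forall>p\<in>M. \<forall>u\<in>tangent_space M p. \<forall>v\<in>tangent_space M p.
              lie_deriv_tensor M X g p u v =
                q p * g p u v + (\<mu> p u * \<omega> p v + \<omega> p u * \<mu> p v) / 2))}"

text \<open>
  Dimension of the Lie algebra of germs at \<open>p\<close> of infinitesimal symmetries: the supremum of
  the numbers \<open>m\<close> of symmetries near \<open>p\<close> whose germs at \<open>p\<close> are linearly independent.
\<close>
definition local_symmetry_dim ::
  "'a::euclidean_space set \<Rightarrow> ('a \<Rightarrow> 'a \<Rightarrow> real) \<Rightarrow> ('a \<Rightarrow> 'a \<Rightarrow> 'a \<Rightarrow> real) \<Rightarrow> 'a \<Rightarrow> enat" where
  "local_symmetry_dim M \<omega> g p =
     Sup {enat m |m. \<exists>U (X :: nat \<Rightarrow> 'a \<Rightarrow> 'a). open U \<and> p \<in> U \<and>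
        (\<forall>i<m. X i \<in> symmetries (M \<inter> U) \<omega> g) \<and>
        (\<forall>(c :: nat \<Rightarrow> real) W. open W \<and> p \<in> W \<and> W \<subseteq> U \<and>
           (\<forall>x\<in>M \<inter> W. (\<Sum>i<m. c i *\<^sub>R X i x) = 0) \<longrightarrow> (\<forall>i<m. c i = 0))}"

text \<open>
  Being flat: at each point the dimension of the algebra of local symmetries is the highest
  one among all Legendrean contact structures of dimension \<open>2n + 1\<close>. HOL cannot quantify over
  types inside a formula, so the ambient Euclidean space \<open>'b\<close> of the competitors is a
  type parameter, meant to be left arbitrary.
\<close>
definition flat_legendrean ::
  "'b::euclidean_space itself \<Rightarrow> nat \<Rightarrow> 'a::euclidean_space set \<Rightarrow>
   ('a \<Rightarrow> 'a \<Rightarrow> real) \<Rightarrow> ('a \<Rightarrow> 'a \<Rightarrow> 'a \<Rightarrow> real) \<Rightarrow> bool" where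
  "flat_legendrean TYPE('b) n M \<omega> g \<longleftrightarrow>
     legendrean_contact n M \<omega> g \<and>
     (\<forall>(M' :: 'b set) \<omega>' g'. legendrean_contact n M' \<omega>' g' \<longrightarrow>
        (\<forall>p\<in>M. \<forall>p'\<in>M'. local_symmetry_dim M' \<omega>' g' p' \<le> local_symmetry_dim M \<omega> g p))"

text \<open>The set \<open>V\<close> of vector fields on \<open>M\<close> is a Lie algebra isomorphic to the Lie algebra
  \<open>L\<close> with bracket \<open>br\<close>.\<close>
definition lie_isomorphic ::
  "'l::real_vector set \<Rightarrow> ('l \<Rightarrow> 'l \<Rightarrow> 'l) \<Rightarrow> 'a::euclidean_space set \<Rightarrow> ('a \<Rightarrow> 'a) set \<Rightarrow> bool" where
  "lie_isomorphic L br M V \<longleftrightarrow>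
     (\<exists>\<phi>. bij_betw \<phi> L V \<and>
        (\<forall>A\<in>L. \<forall>B\<in>L. \<phi> (A + B) = (\<lambda>p. \<phi> A p + \<phi> B p)) \<and>
        (\<forall>c. \<forall>A\<in>L. \<phi> (c *\<^sub>R A) = (\<lambda>p. c *\<^sub>R \<phi> A p)) \<and>
        (\<forall>A\<in>L. \<forall>B\<in>L. \<phi> (br A B) = lie_bracket M (\<phi> A) (\<phi> B)))"

definition sl_mat :: "(real^'n^'n) set" where
  "sl_mat = {A. trace A = 0}"

definition commutator :: "real^'n^'n \<Rightarrow> real^'n^'n \<Rightarrow> real^'n^'n" where
  "commutator A B = A ** B - B ** A"

section \<open>The configuration space of a flying saucer\<close>

definition saucer_space :: "((real^3) \<times> (real^3)) set" where
  "saucer_space = UNIV \<times> sphere 0 1"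

definition saucer_form :: "(real^3) \<times> (real^3) \<Rightarrow> (real^3) \<times> (real^3) \<Rightarrow> real" where
  "saucer_form p v = snd p \<bullet> fst v"

text \<open>\<open>dr \<cdot> dn\<close> as a symmetric product.\<close>
definition saucer_metric ::
  "(real^3) \<times> (real^3) \<Rightarrow> (real^3) \<times> (real^3) \<Rightarrow> (real^3) \<times> (real^3) \<Rightarrow> real" where
  "saucer_metric p u v = (fst u \<bullet> snd v + fst v \<bullet> snd u) / 2"

end

theory Submission
  imports Defs "HOL-Library.Function_Algebras"
begin

text \<open>
  Upper bound. Near a point of a Legendrean contact structure of dimension 5 choose frames \<open>e i\<close>, \<open>f i\<close> of the two
  subbundles with \<open>d\<omega> (e i) (f j) = \<delta>\<^sub>i\<^sub>j\<close>, and put \<open>T = [e i, f i]\<close> for one \<open>i\<close>. A symmetry \<open>X\<close> is determined by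
  \<open>u = \<omega> X\<close> and its first derivatives, and since \<open>X\<close> preserves the subbundles, \<open>e i (e j u)\<close> and \<open>f i (f j u)\<close> are of
  first order in \<open>u\<close>. Giving \<open>e i\<close>, \<open>f i\<close> weight 1 and \<open>T\<close> weight 2, commuting derivatives shows that modulo lower
  weight everything is expressed by the 15 functions \<open>u; e i u, f i u; e i (f j u), T u; e i (T u), f i (T u); T (T u)\<close>.
  So they satisfy a closed linear first order system, and a symmetry whose 15 functions vanish at a point vanishes nearby.

  Lower bound. \<open>sl(4)\<close> acts on incident pairs of a point and a plane in projective three-space. On affine points with
  normalised conormals this gives a 15-dimensional algebra of symmetries, and by the dimension count every symmetry is
  locally, hence on connected sets globally, one of them.
\<close>

section \<open>Smooth maps\<close>

text \<open>The competitors are arbitrary smooth structures, so the upper bound cannot start from a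
  normal form; it uses frames and commutators only and becomes module algebra over the smooth
  functions. The fifteen functions come in groups of 1, 4, 5, 4, 1, the dimensions of the contact
  grading of \<open>sl(4)\<close>; \<open>f i (e j u)\<close> is absent because a commutator
  expresses it through \<open>e j (f i u)\<close> and \<open>T u\<close>. The obstacle lies in the
  top weights, where counting alone leaves \<open>f i (e i (T u))\<close> and the derivatives of
  \<open>T (T u)\<close> free. Comparing two orders of differentiation gives
  \<open>2 f i (e i (T u)) + T (T u) = 0\<close> modulo weight 3, and one more derivative of this
  relation yields three times a derivative of \<open>T (T u)\<close>; hence the divisions by 2 and
  3. The closed system serves for uniqueness only: existence of solutions comes from the explicit
  \<open>sl(4)\<close> fields, which already have dimension 15. So the injective jet map is onto,
  and one dimension count gives both maximality and the algebra.\<close>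

lemma differentiable_on_openD:
  assumes "f differentiable_on U" "open U" "x \<in> U"
  shows "(f has_derivative frechet_derivative f (at x)) (at x)"
  using assms by (metis differentiable_on_def at_within_open frechet_derivative_works)

text \<open>\<open>frechet_derivative\<close> at a point sees nearby values only, so on an open set
  the agreement of \<open>f\<close> and \<open>g\<close> passes to all iterated derivatives.\<close>

lemma Ck_on_cong:
  fixes f g :: "'a::real_normed_vector \<Rightarrow> 'b::real_normed_vector"
  assumes "open U" "Ck_on k U f" "\<And>x. x \<in> U \<Longrightarrow> f x = g x"
  shows "Ck_on k U g"
  using assms(2,3)
proof (induction k arbitrary: f g)
  case 0
  then show ?case by (simp cong: continuous_on_cong)
next
  case (Suc k)
  have d: "(g has_derivative frechet_derivative f (at x)) (at x)" if "x \<in> U" for x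
    by (rule has_derivative_transform_within_open[OF differentiable_on_openD[OF _ assms(1) that] assms(1) that])
      (use Suc.prems in auto)
  have "g differentiable_on U"
    unfolding differentiable_on_def using d by (meson differentiable_def has_derivative_at_withinI)
  moreover have "Ck_on k U (\<lambda>x. frechet_derivative g (at x) v)" for v
    by (rule Suc.IH[of "\<lambda>x. frechet_derivative f (at x) v"])
      (use Suc.prems frechet_derivative_at[OF d] in auto)
  ultimately show ?case by simp
qed

text \<open>Lets an explicit formula stand in for the chosen \<open>frechet_derivative\<close>; the
  closure lemmas below then follow from the usual differentiation rules by induction on the
  order.\<close>

lemma Ck_onI:
  fixes f :: "'a::real_normed_vector \<Rightarrow> 'b::real_normed_vector"
  assumes "open U" and d: "\<And>x. x \<in> U \<Longrightarrow> (f has_derivative f' x) (at x)"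
    and c: "\<And>v. Ck_on k U (\<lambda>x. f' x v)"
  shows "Ck_on (Suc k) U f"
proof -
  have "f differentiable_on U"
    unfolding differentiable_on_def using d by (meson differentiable_def has_derivative_at_withinI)
  moreover have "Ck_on k U (\<lambda>x. frechet_derivative f (at x) v)" for v
    by (rule Ck_on_cong[OF assms(1) c[of v]]) (use frechet_derivative_at[OF d] in auto)
  ultimately show ?thesis by simp
qed

lemma Ck_on_SucD:
  assumes "Ck_on (Suc k) U f" "open U"
  shows "\<And>x. x \<in> U \<Longrightarrow> (f has_derivative frechet_derivative f (at x)) (at x)"
    and "\<And>v. Ck_on k U (\<lambda>x. frechet_derivative f (at x) v)"
  using assms differentiable_on_openD by auto

lemma Ck_on_Suc_imp: "Ck_on (Suc k) U f \<Longrightarrow> Ck_on k U f"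
proof (induction k arbitrary: f)
  case 0
  then show ?case by (simp add: differentiable_imp_continuous_on)
qed auto

lemma Ck_on_subset: "Ck_on k U f \<Longrightarrow> V \<subseteq> U \<Longrightarrow> Ck_on k V f"
  by (induction k arbitrary: f)
    (auto intro: continuous_on_subset differentiable_on_subset)

lemma Ck_on_const: "open U \<Longrightarrow> Ck_on k U (\<lambda>x. c)"
proof (induction k arbitrary: c)
  case (Suc k)
  then show ?case by (intro Ck_onI[where f'="\<lambda>x v. 0"]) auto
qed simp

lemma Ck_on_ident: "open U \<Longrightarrow> Ck_on k U (\<lambda>x. x)"
proof (induction k)
  case (Suc k)
  then show ?case by (intro Ck_onI[where f'="\<lambda>x v. v"]) (auto intro: Ck_on_const)
qed simp

lemma Ck_on_linear:
  assumes L: "bounded_linear L" and U: "open U"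
  shows "Ck_on k U f \<Longrightarrow> Ck_on k U (\<lambda>x. L (f x))"
proof (induction k arbitrary: f)
  case 0
  then show ?case
    by (simp add: bounded_linear.continuous_on[OF L])
next
  case (Suc k)
  show ?case
    by (rule Ck_onI[OF U bounded_linear.has_derivative[OF L Ck_on_SucD(1)[OF Suc.prems U]]])
      (use Suc Ck_on_SucD(2)[OF Suc.prems U] in auto)
qed

lemma Ck_on_add:
  assumes U: "open U"
  shows "Ck_on k U f \<Longrightarrow> Ck_on k U g \<Longrightarrow> Ck_on k U (\<lambda>x. f x + g x)"
proof (induction k arbitrary: f g)
  case 0
  then show ?case by (simp add: continuous_on_add)
next
  case (Suc k)
  show ?case
    by (rule Ck_onI[OF U has_derivative_add[OF Ck_on_SucD(1)[OF Suc.prems(1) U] Ck_on_SucD(1)[OF Suc.prems(2) U]]])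
      (use Suc Ck_on_SucD(2)[OF Suc.prems(1) U] Ck_on_SucD(2)[OF Suc.prems(2) U] in auto)
qed

lemma Ck_on_bilinear:
  assumes B: "bounded_bilinear B" and U: "open U"
  shows "Ck_on k U f \<Longrightarrow> Ck_on k U g \<Longrightarrow> Ck_on k U (\<lambda>x. B (f x) (g x))"
proof (induction k arbitrary: f g)
  case 0
  then show ?case by (simp add: bounded_bilinear.continuous_on[OF B])
next
  case (Suc k)
  show ?case
    by (rule Ck_onI[OF U bounded_bilinear.FDERIV[OF B Ck_on_SucD(1)[OF Suc.prems(1) U] Ck_on_SucD(1)[OF Suc.prems(2) U]]])
      (assumption, assumption, intro Ck_on_add[OF U] Suc.IH Ck_on_SucD(2)[OF Suc.prems(1) U] Ck_on_SucD(2)[OF Suc.prems(2) U]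
        Ck_on_Suc_imp[OF Suc.prems(1)] Ck_on_Suc_imp[OF Suc.prems(2)])
qed

lemma Ck_on_sum:
  assumes U: "open U" and "\<And>i. i \<in> I \<Longrightarrow> Ck_on k U (f i)"
  shows "Ck_on k U (\<lambda>x. \<Sum>i\<in>I. f i x)"
  using assms(2)
  by (induction I rule: infinite_finite_induct) (auto intro: Ck_on_const[OF U] Ck_on_add[OF U])

lemma frechet_derivative_basis:
  fixes f :: "'a::euclidean_space \<Rightarrow> 'b::real_normed_vector"
  assumes "(f has_derivative f') F"
  shows "f' v = (\<Sum>b\<in>Basis. (v \<bullet> b) *\<^sub>R f' b)"
proof -
  have "linear f'" using assms has_derivative_linear by blast
  then have "f' (\<Sum>b\<in>Basis. (v \<bullet> b) *\<^sub>R b) = (\<Sum>b\<in>Basis. (v \<bullet> b) *\<^sub>R f' b)"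
    by (simp add: linear_sum linear_scale)
  then show ?thesis by (simp add: euclidean_representation)
qed

text \<open>\<open>Ck_on\<close> controls derivatives in fixed directions, while the chain rule
  applies the derivative of \<open>f\<close> to the moving vector \<open>Dg v\<close>. Expansion in
  \<open>Basis\<close> turns this into sums of products of fixed-direction derivatives.\<close>

lemma Ck_on_compose:
  fixes g :: "'a::real_normed_vector \<Rightarrow> 'b::euclidean_space" and f :: "'b \<Rightarrow> 'c::real_normed_vector"
  assumes U: "open U" and V: "open V" and gV: "\<And>x. x \<in> U \<Longrightarrow> g x \<in> V"
  shows "Ck_on k V f \<Longrightarrow> Ck_on k U g \<Longrightarrow> Ck_on k U (\<lambda>x. f (g x))"
proof (induction k arbitrary: f)
  case 0
  then show ?case using gV by (auto intro: continuous_on_compose2)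
next
  case (Suc k)
  note f = Ck_on_SucD[OF Suc.prems(1) V] and g = Ck_on_SucD[OF Suc.prems(2) U]
  have d: "((\<lambda>x. f (g x)) has_derivative
      (\<lambda>v. \<Sum>b\<in>Basis. (frechet_derivative g (at x) v \<bullet> b) *\<^sub>R frechet_derivative f (at (g x)) b)) (at x)"
    if "x \<in> U" for x
    using diff_chain_at[OF g(1)[OF that] f(1)[OF gV[OF that]]]
    by (subst frechet_derivative_basis[OF f(1)[OF gV[OF that]], symmetric]) (simp add: o_def)
  show ?case
    by (rule Ck_onI[OF U d])
      (auto intro!: Ck_on_sum[OF U] Ck_on_bilinear[OF bounded_bilinear_scaleR U]
        Ck_on_linear[OF bounded_linear_inner_left U] g(2) Suc.IH f(2) Ck_on_Suc_imp[OF Suc.prems(2)])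
qed

lemma Ck_on_inverse:
  fixes f :: "'a::real_normed_vector \<Rightarrow> real"
  assumes U: "open U" and nz: "\<And>x. x \<in> U \<Longrightarrow> f x \<noteq> 0"
  shows "Ck_on k U f \<Longrightarrow> Ck_on k U (\<lambda>x. inverse (f x))"
proof (induction k)
  case 0
  then show ?case using nz by (auto intro: continuous_on_inverse)
next
  case (Suc k)
  note f = Ck_on_SucD[OF Suc.prems U]
  have i: "Ck_on k U (\<lambda>x. inverse (f x))" by (rule Suc.IH[OF Ck_on_Suc_imp[OF Suc.prems]])
  show ?case
    by (rule Ck_onI[OF U Deriv.has_derivative_inverse[OF _ f(1)]])
      (auto intro!: nz Ck_on_bilinear[OF bounded_bilinear_mult U] Ck_on_linear[OF bounded_linear_minus[OF bounded_linear_ident] U] i f(2))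
qed

lemma smooth_on_cong:
  assumes "open U" "smooth_on U f" "\<And>x. x \<in> U \<Longrightarrow> f x = g x"
  shows "smooth_on U g"
  using assms Ck_on_cong unfolding smooth_on_def by blast

lemma smooth_on_subset: "smooth_on U f \<Longrightarrow> V \<subseteq> U \<Longrightarrow> smooth_on V f"
  unfolding smooth_on_def using Ck_on_subset by blast

lemma smooth_on_const: "open U \<Longrightarrow> smooth_on U (\<lambda>x. c)"
  by (simp add: smooth_on_def Ck_on_const)

lemma smooth_on_ident: "open U \<Longrightarrow> smooth_on U (\<lambda>x. x)"
  by (simp add: smooth_on_def Ck_on_ident)

lemma smooth_on_linear: "bounded_linear L \<Longrightarrow> open U \<Longrightarrow> smooth_on U f \<Longrightarrow> smooth_on U (\<lambda>x. L (f x))"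
  by (simp add: smooth_on_def Ck_on_linear)

lemma smooth_on_add: "open U \<Longrightarrow> smooth_on U f \<Longrightarrow> smooth_on U g \<Longrightarrow> smooth_on U (\<lambda>x. f x + g x)"
  by (simp add: smooth_on_def Ck_on_add)

lemma smooth_on_bilinear:
  "bounded_bilinear B \<Longrightarrow> open U \<Longrightarrow> smooth_on U f \<Longrightarrow> smooth_on U g \<Longrightarrow> smooth_on U (\<lambda>x. B (f x) (g x))"
  by (simp add: smooth_on_def Ck_on_bilinear)

lemma smooth_on_sum:
  "open U \<Longrightarrow> (\<And>i. i \<in> I \<Longrightarrow> smooth_on U (f i)) \<Longrightarrow> smooth_on U (\<lambda>x. \<Sum>i\<in>I. f i x)"
  by (simp add: smooth_on_def Ck_on_sum)

lemma smooth_on_compose: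
  fixes g :: "'a::real_normed_vector \<Rightarrow> 'b::euclidean_space"
  shows "open U \<Longrightarrow> open V \<Longrightarrow> (\<And>x. x \<in> U \<Longrightarrow> g x \<in> V) \<Longrightarrow> smooth_on V f \<Longrightarrow> smooth_on U g \<Longrightarrow>
    smooth_on U (\<lambda>x. f (g x))"
  by (simp add: smooth_on_def Ck_on_compose)

lemma smooth_on_inverse:
  fixes f :: "'a::real_normed_vector \<Rightarrow> real"
  shows "open U \<Longrightarrow> (\<And>x. x \<in> U \<Longrightarrow> f x \<noteq> 0) \<Longrightarrow> smooth_on U f \<Longrightarrow> smooth_on U (\<lambda>x. inverse (f x))"
  by (simp add: smooth_on_def Ck_on_inverse)

lemma smooth_on_has_derivative:
  "smooth_on U f \<Longrightarrow> open U \<Longrightarrow> x \<in> U \<Longrightarrow> (f has_derivative frechet_derivative f (at x)) (at x)"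
  unfolding smooth_on_def using Ck_on_SucD(1) by blast

lemma smooth_on_continuous_on: "smooth_on U f \<Longrightarrow> continuous_on U f"
  unfolding smooth_on_def by (metis Ck_on.simps(1))

lemma smooth_on_derivative:
  "smooth_on U f \<Longrightarrow> smooth_on U (\<lambda>x. frechet_derivative f (at x) v)"
  unfolding smooth_on_def by (metis Ck_on.simps(2))

lemma smooth_on_derivative_field:
  fixes f :: "'a::euclidean_space \<Rightarrow> 'b::real_normed_vector"
  assumes "smooth_on U f" "open U" "smooth_on U V"
  shows "smooth_on U (\<lambda>x. frechet_derivative f (at x) (V x))"
proof (rule smooth_on_cong[OF \<open>open U\<close>])
  show "smooth_on U (\<lambda>x. \<Sum>b\<in>Basis. (V x \<bullet> b) *\<^sub>R frechet_derivative f (at x) b)"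
    by (intro smooth_on_sum smooth_on_bilinear[OF bounded_bilinear_scaleR] smooth_on_derivative
        smooth_on_linear[OF bounded_linear_inner_left] assms)
qed (use frechet_derivative_basis[OF smooth_on_has_derivative[OF assms(1,2)]] in auto)

section \<open>Symmetry of mixed second derivatives\<close>

lemma second_difference:
  fixes f :: "'a::real_normed_vector \<Rightarrow> real"
  assumes U: "open U" and f: "Ck_on 2 U f" and h: "h > 0"
    and box: "\<And>s t. 0 \<le> s \<Longrightarrow> s \<le> h \<Longrightarrow> 0 \<le> t \<Longrightarrow> t \<le> h \<Longrightarrow> p + s *\<^sub>R v + t *\<^sub>R w \<in> U"
  shows "\<exists>s t. 0 < s \<and> s < h \<and> 0 < t \<and> t < h \<and>
    f (p + h *\<^sub>R v + h *\<^sub>R w) - f (p + h *\<^sub>R v) - f (p + h *\<^sub>R w) + f p =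
    h * h * frechet_derivative (\<lambda>x. frechet_derivative f (at x) v) (at (p + s *\<^sub>R v + t *\<^sub>R w)) w"
proof -
  let ?fv = "\<lambda>x. frechet_derivative f (at x) v"
  have f2: "Ck_on (Suc (Suc 0)) U f" using f by (simp add: numeral_2_eq_2)
  note d1 = Ck_on_SucD[OF f2 U] and d2 = Ck_on_SucD(1)[OF Ck_on_SucD(2)[OF f2 U] U]
  have lin: "((\<lambda>s. f (a + s *\<^sub>R v)) has_real_derivative ?fv (a + s *\<^sub>R v)) (at s)"
    if "a + s *\<^sub>R v \<in> U" for a s
  proof -
    have "((\<lambda>s. a + s *\<^sub>R v) has_derivative (\<lambda>r. 0 + r *\<^sub>R v)) (at s)"
      by (intro has_derivative_add has_derivative_const has_derivative_scaleR_left has_derivative_ident)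
    from diff_chain_at[OF this d1(1)[OF that]]
    have "((\<lambda>s. f (a + s *\<^sub>R v)) has_derivative (\<lambda>r. frechet_derivative f (at (a + s *\<^sub>R v)) (r *\<^sub>R v))) (at s)"
      by (simp add: o_def)
    moreover have "(\<lambda>r. frechet_derivative f (at (a + s *\<^sub>R v)) (r *\<^sub>R v)) = (*) (frechet_derivative f (at (a + s *\<^sub>R v)) v)"
      using linear_scale[OF has_derivative_linear[OF d1(1)[OF that]]] by (auto simp: mult.commute)
    ultimately show ?thesis by (simp only: has_field_derivative_def)
  qed
  have lin2: "((\<lambda>t. ?fv (a + t *\<^sub>R w)) has_real_derivative frechet_derivative ?fv (at (a + t *\<^sub>R w)) w) (at t)"
    if "a + t *\<^sub>R w \<in> U" for a t
  proof -
    have "((\<lambda>s. a + s *\<^sub>R w) has_derivative (\<lambda>r. 0 + r *\<^sub>R w)) (at t)"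
      by (intro has_derivative_add has_derivative_const has_derivative_scaleR_left has_derivative_ident)
    from diff_chain_at[OF this d2[OF that]]
    have "((\<lambda>s. ?fv (a + s *\<^sub>R w)) has_derivative (\<lambda>r. frechet_derivative ?fv (at (a + t *\<^sub>R w)) (r *\<^sub>R w))) (at t)"
      by (simp add: o_def)
    moreover have "(\<lambda>r. frechet_derivative ?fv (at (a + t *\<^sub>R w)) (r *\<^sub>R w)) = (*) (frechet_derivative ?fv (at (a + t *\<^sub>R w)) w)"
      using linear_scale[OF has_derivative_linear[OF d2[OF that]]] by (auto simp: mult.commute)
    ultimately show ?thesis by (simp only: has_field_derivative_def)
  qed
  \<comment> \<open>The difference in direction \<open>w\<close>, as a function of the parameter
    along \<open>v\<close>: one mean value step in \<open>s\<close> and one in \<open>t\<close> turn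
    the second difference into a mixed derivative inside the parallelogram.\<close>
  define G where "G s = f ((p + h *\<^sub>R w) + s *\<^sub>R v) - f (p + s *\<^sub>R v)" for s
  have "DERIV G s :> ?fv ((p + h *\<^sub>R w) + s *\<^sub>R v) - ?fv (p + s *\<^sub>R v)" if "0 \<le> s" "s \<le> h" for s
    unfolding G_def using box[of s h] box[of s 0] that h
    by (intro DERIV_diff lin) (auto simp: algebra_simps)
  from MVT2[OF h this] obtain s where s: "0 < s" "s < h"
    "G h - G 0 = h * (?fv ((p + h *\<^sub>R w) + s *\<^sub>R v) - ?fv (p + s *\<^sub>R v))" by auto
  have "DERIV (\<lambda>t. ?fv ((p + s *\<^sub>R v) + t *\<^sub>R w)) t :>
      frechet_derivative ?fv (at ((p + s *\<^sub>R v) + t *\<^sub>R w)) w" if "0 \<le> t" "t \<le> h" for t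
    using box[of s t] that s by (intro lin2) auto
  from MVT2[OF h this] obtain t where t: "0 < t" "t < h"
    "?fv ((p + s *\<^sub>R v) + h *\<^sub>R w) - ?fv (p + s *\<^sub>R v) = h * frechet_derivative ?fv (at ((p + s *\<^sub>R v) + t *\<^sub>R w)) w"
    by auto
  have "G h - G 0 = h * (h * frechet_derivative ?fv (at ((p + s *\<^sub>R v) + t *\<^sub>R w)) w)"
    using s(3) t(3) by (simp add: algebra_simps)
  then show ?thesis using s t unfolding G_def by (intro exI[of _ s] exI[of _ t]) (simp add: algebra_simps)
qed

text \<open>The second difference over a small parallelogram is symmetric in \<open>v\<close> and
  \<open>w\<close> and equals \<open>h * h\<close> times a value of either mixed derivative; by
  continuity both values are close to those at \<open>p\<close>.\<close>

lemma symmetric_second_derivative: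
  fixes f :: "'a::real_normed_vector \<Rightarrow> real"
  assumes U: "open U" and f: "Ck_on 2 U f" and p: "p \<in> U"
  shows "frechet_derivative (\<lambda>x. frechet_derivative f (at x) v) (at p) w =
         frechet_derivative (\<lambda>x. frechet_derivative f (at x) w) (at p) v" (is "?A p = ?B p")
proof (rule ccontr)
  assume ne: "?A p \<noteq> ?B p"
  have f2: "Ck_on (Suc (Suc 0)) U f" using f by (simp add: numeral_2_eq_2)
  define \<epsilon> where "\<epsilon> = \<bar>?A p - ?B p\<bar> / 2"
  have \<epsilon>: "\<epsilon> > 0" using ne by (simp add: \<epsilon>_def)
  have "continuous_on U ?A" "continuous_on U ?B" using f2 by auto
  then have cA: "isCont ?A p" and cB: "isCont ?B p"
    using continuous_on_eq_continuous_at[OF U] p by blast+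
  obtain d1 where d1: "d1 > 0" "\<And>x. dist x p < d1 \<Longrightarrow> dist (?A x) (?A p) < \<epsilon>"
    using cA \<epsilon> unfolding continuous_at_eps_delta by blast
  obtain d2 where d2: "d2 > 0" "\<And>x. dist x p < d2 \<Longrightarrow> dist (?B x) (?B p) < \<epsilon>"
    using cB \<epsilon> unfolding continuous_at_eps_delta by blast
  note d = d1(1) d2(1) d1(2) d2(2)
  obtain d3 where d3: "d3 > 0" "ball p d3 \<subseteq> U" using U p openE by blast
  define d where "d = min d1 (min d2 d3)"
  have d0: "d > 0" using d d3 by (simp add: d_def)
  \<comment> \<open>Keeps the whole parallelogram within \<open>d / 2\<close> of \<open>p\<close>;
    the summand 1 covers \<open>v = w = 0\<close>.\<close>
  define h where "h = d / (2 * (norm v + norm w + 1))"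
  have nz: "norm v + norm w + 1 > 0" by (simp add: add_nonneg_pos)
  have h: "h > 0" using d0 nz by (simp add: h_def)
  have near: "dist (p + s *\<^sub>R v + t *\<^sub>R w) p < d" if "0 \<le> s" "s \<le> h" "0 \<le> t" "t \<le> h" for s t
  proof -
    have "dist (p + s *\<^sub>R v + t *\<^sub>R w) p \<le> norm (s *\<^sub>R v) + norm (t *\<^sub>R w)"
      using norm_triangle_ineq[of "s *\<^sub>R v" "t *\<^sub>R w"] by (simp add: dist_norm add.assoc)
    also have "\<dots> \<le> h * norm v + h * norm w" using that by (intro add_mono) (auto intro: mult_right_mono)
    also have "\<dots> \<le> h * (norm v + norm w + 1)" using h by (simp add: algebra_simps)
    also have "\<dots> = d / 2" using nz unfolding h_def by (metis (no_types, lifting) less_irrefl mult.commute nonzero_mult_divide_mult_cancel_right times_divide_eq_right)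
    also have "\<dots> < d" using d0 by simp
    finally show ?thesis .
  qed
  have box: "p + s *\<^sub>R v + t *\<^sub>R w \<in> U" if "0 \<le> s" "s \<le> h" "0 \<le> t" "t \<le> h" for s t
    using near[OF that] d3 by (auto simp: d_def dist_commute subset_eq)
  have box': "p + s *\<^sub>R w + t *\<^sub>R v \<in> U" if "0 \<le> s" "s \<le> h" "0 \<le> t" "t \<le> h" for s t
    using box[of t s] that by (simp add: algebra_simps)
  obtain s t where st: "0 < s" "s < h" "0 < t" "t < h"
    "f (p + h *\<^sub>R v + h *\<^sub>R w) - f (p + h *\<^sub>R v) - f (p + h *\<^sub>R w) + f p = h * h * ?A (p + s *\<^sub>R v + t *\<^sub>R w)"
    using second_difference[OF U f h box] by blast
  obtain s' t' where st': "0 < s'" "s' < h" "0 < t'" "t' < h"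
    "f (p + h *\<^sub>R w + h *\<^sub>R v) - f (p + h *\<^sub>R w) - f (p + h *\<^sub>R v) + f p = h * h * ?B (p + s' *\<^sub>R w + t' *\<^sub>R v)"
    using second_difference[OF U f h box'] by blast
  have "h * h * ?A (p + s *\<^sub>R v + t *\<^sub>R w) = h * h * ?B (p + s' *\<^sub>R w + t' *\<^sub>R v)"
    using st(5) st'(5) by (simp add: algebra_simps)
  then have eq: "?A (p + s *\<^sub>R v + t *\<^sub>R w) = ?B (p + t' *\<^sub>R v + s' *\<^sub>R w)" using h by (simp add: algebra_simps)
  have "dist (?A (p + s *\<^sub>R v + t *\<^sub>R w)) (?A p) < \<epsilon>"
    using near[of s t] st by (intro d(3)) (auto simp: d_def)
  moreover have "dist (?B (p + t' *\<^sub>R v + s' *\<^sub>R w)) (?B p) < \<epsilon>"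
    using near[of t' s'] st' by (intro d(4)) (auto simp: d_def)
  ultimately have "\<bar>?A p - ?B p\<bar> < 2 * \<epsilon>" using eq by (simp add: dist_real_def)
  then show False by (simp add: \<epsilon>_def)
qed

section \<open>Calculus on submanifolds\<close>

lemma smooth_map_onE:
  assumes "smooth_map_on M f" "p \<in> M"
  obtains U F where "open U" "p \<in> U" "smooth_on U F" "\<And>x. x \<in> U \<Longrightarrow> x \<in> M \<Longrightarrow> F x = f x"
proof -
  from bspec[OF assms(1)[unfolded smooth_map_on_def] assms(2)]
  obtain U F where "open U" "p \<in> U" "smooth_on U F" "\<forall>x\<in>U \<inter> M. F x = f x"
    by (elim exE conjE) (rule that)
  then show ?thesis by (intro that[of U F]) auto
qed

lemma smooth_map_onI:
  assumes "\<And>p. p \<in> M \<Longrightarrow> \<exists>U F. open U \<and> p \<in> U \<and> smooth_on U F \<and> (\<forall>x\<in>U \<inter> M. F x = f x)"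
  shows "smooth_map_on M f"
  using assms unfolding smooth_map_on_def by blast

lemma smooth_map_onE2:
  assumes "smooth_map_on M f" "smooth_map_on M g" "p \<in> M"
  obtains U F G where "open U" "p \<in> U" "smooth_on U F" "smooth_on U G"
    "\<And>x. x \<in> U \<Longrightarrow> x \<in> M \<Longrightarrow> F x = f x" "\<And>x. x \<in> U \<Longrightarrow> x \<in> M \<Longrightarrow> G x = g x"
proof -
  obtain U F where 1: "open U" "p \<in> U" "smooth_on U F" "\<And>x. x \<in> U \<Longrightarrow> x \<in> M \<Longrightarrow> F x = f x"
    using smooth_map_onE[OF assms(1,3)] by blast
  obtain V G where 2: "open V" "p \<in> V" "smooth_on V G" "\<And>x. x \<in> V \<Longrightarrow> x \<in> M \<Longrightarrow> G x = g x"
    using smooth_map_onE[OF assms(2,3)] by blast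
  show ?thesis
    using 1 2 that[of "U \<inter> V" F G] smooth_on_subset[of U F "U \<inter> V"] smooth_on_subset[of V G "U \<inter> V"] by auto
qed

lemma smooth_map_on_subset: "smooth_map_on M f \<Longrightarrow> N \<subseteq> M \<Longrightarrow> smooth_map_on N f"
proof (rule smooth_map_onI)
  fix p assume "smooth_map_on M f" "N \<subseteq> M" "p \<in> N"
  moreover from this obtain U F where "open U" "p \<in> U" "smooth_on U F" "\<And>x. x \<in> U \<Longrightarrow> x \<in> M \<Longrightarrow> F x = f x"
    using smooth_map_onE[of M f p] by auto
  ultimately show "\<exists>U F. open U \<and> p \<in> U \<and> smooth_on U F \<and> (\<forall>x\<in>U \<inter> N. F x = f x)"
    by (intro exI[of _ U] exI[of _ F]) auto
qed

lemma smooth_on_imp_smooth_map_on: "smooth_on U f \<Longrightarrow> open U \<Longrightarrow> M \<subseteq> U \<Longrightarrow> smooth_map_on M f"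
  unfolding smooth_map_on_def by blast

lemma smooth_map_on_cong: "smooth_map_on M f \<Longrightarrow> (\<And>x. x \<in> M \<Longrightarrow> f x = g x) \<Longrightarrow> smooth_map_on M g"
  unfolding smooth_map_on_def by (metis Int_iff)

lemma smooth_map_on_const: "smooth_map_on M (\<lambda>x. c)"
  by (rule smooth_on_imp_smooth_map_on[OF smooth_on_const[OF open_UNIV]]) auto

lemma smooth_map_on_ident: "smooth_map_on M (\<lambda>x. x)"
  by (rule smooth_on_imp_smooth_map_on[OF smooth_on_ident[OF open_UNIV]]) auto

lemma smooth_map_on_linear:
  assumes "bounded_linear L" "smooth_map_on M f"
  shows "smooth_map_on M (\<lambda>x. L (f x))"
proof (rule smooth_map_onI)
  fix p assume "p \<in> M"
  from smooth_map_onE[OF assms(2) this] obtain U F where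
    "open U" "p \<in> U" "smooth_on U F" "\<And>x. x \<in> U \<Longrightarrow> x \<in> M \<Longrightarrow> F x = f x" by blast
  then show "\<exists>U F. open U \<and> p \<in> U \<and> smooth_on U F \<and> (\<forall>x\<in>U \<inter> M. F x = L (f x))"
    by (intro exI[of _ U] exI[of _ "\<lambda>x. L (F x)"] conjI ballI) (simp_all add: smooth_on_linear[OF assms(1)])
qed

lemma smooth_map_on_bilinear:
  assumes "bounded_bilinear B" "smooth_map_on M f" "smooth_map_on M g"
  shows "smooth_map_on M (\<lambda>x. B (f x) (g x))"
proof (rule smooth_map_onI)
  fix p assume "p \<in> M"
  from smooth_map_onE2[OF assms(2,3) this] obtain U F G where
    "open U" "p \<in> U" "smooth_on U F" "smooth_on U G"
    "\<And>x. x \<in> U \<Longrightarrow> x \<in> M \<Longrightarrow> F x = f x" "\<And>x. x \<in> U \<Longrightarrow> x \<in> M \<Longrightarrow> G x = g x" by blast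
  then show "\<exists>U F. open U \<and> p \<in> U \<and> smooth_on U F \<and> (\<forall>x\<in>U \<inter> M. F x = B (f x) (g x))"
    by (intro exI[of _ U] exI[of _ "\<lambda>x. B (F x) (G x)"] conjI ballI) (simp_all add: smooth_on_bilinear[OF assms(1)])
qed

lemma smooth_map_on_add:
  assumes "smooth_map_on M f" "smooth_map_on M g"
  shows "smooth_map_on M (\<lambda>x. f x + g x)"
proof (rule smooth_map_onI)
  fix p assume "p \<in> M"
  from smooth_map_onE2[OF assms this] obtain U F G where
    "open U" "p \<in> U" "smooth_on U F" "smooth_on U G"
    "\<And>x. x \<in> U \<Longrightarrow> x \<in> M \<Longrightarrow> F x = f x" "\<And>x. x \<in> U \<Longrightarrow> x \<in> M \<Longrightarrow> G x = g x" by blast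
  then show "\<exists>U F. open U \<and> p \<in> U \<and> smooth_on U F \<and> (\<forall>x\<in>U \<inter> M. F x = f x + g x)"
    by (intro exI[of _ U] exI[of _ "\<lambda>x. F x + G x"] conjI ballI) (simp_all add: smooth_on_add)
qed

lemma smooth_map_on_minus:
  "smooth_map_on M f \<Longrightarrow> smooth_map_on M (\<lambda>x. - f x)"
  by (rule smooth_map_on_linear[OF bounded_linear_minus[OF bounded_linear_ident]])

lemma smooth_map_on_diff:
  "smooth_map_on M f \<Longrightarrow> smooth_map_on M g \<Longrightarrow> smooth_map_on M (\<lambda>x. f x - g x)"
  using smooth_map_on_add[of M f "\<lambda>x. - g x"] smooth_map_on_minus[of M g] by simp

lemmas smooth_map_on_mult = smooth_map_on_bilinear[OF bounded_bilinear_mult]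
lemmas smooth_map_on_scaleR = smooth_map_on_bilinear[OF bounded_bilinear_scaleR]
lemmas smooth_map_on_inner = smooth_map_on_bilinear[OF bounded_bilinear_inner]

lemma smooth_map_on_sum:
  "(\<And>i. i \<in> I \<Longrightarrow> smooth_map_on M (f i)) \<Longrightarrow> smooth_map_on M (\<lambda>x. \<Sum>i\<in>I. f i x)"
  by (induction I rule: infinite_finite_induct) (auto intro: smooth_map_on_const smooth_map_on_add)

lemma smooth_map_on_inverse:
  fixes f :: "'a::real_normed_vector \<Rightarrow> real"
  assumes "smooth_map_on M f" "\<And>x. x \<in> M \<Longrightarrow> f x \<noteq> 0"
  shows "smooth_map_on M (\<lambda>x. inverse (f x))"
proof (rule smooth_map_onI)
  fix p assume p: "p \<in> M"
  from smooth_map_onE[OF assms(1) this] obtain U F where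
    U: "open U" "p \<in> U" "smooth_on U F" "\<And>x. x \<in> U \<Longrightarrow> x \<in> M \<Longrightarrow> F x = f x" by blast
  let ?V = "U \<inter> F -` (- {0})"
  have "open ?V" by (rule continuous_open_preimage[OF smooth_on_continuous_on[OF U(3)] U(1)]) auto
  moreover have "p \<in> ?V" using U p assms(2) by auto
  moreover have "smooth_on ?V (\<lambda>x. inverse (F x))"
    using \<open>open ?V\<close> by (intro smooth_on_inverse smooth_on_subset[OF U(3)]) auto
  ultimately show "\<exists>U F. open U \<and> p \<in> U \<and> smooth_on U F \<and> (\<forall>x\<in>U \<inter> M. F x = inverse (f x))"
    using U by (intro exI[of _ ?V] exI[of _ "\<lambda>x. inverse (F x)"]) auto
qed

lemma smooth_map_on_continuous_on:
  assumes "smooth_map_on M f" shows "continuous_on M f"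
  unfolding continuous_on_eq_continuous_within
proof
  fix p assume p: "p \<in> M"
  from smooth_map_onE[OF assms this] obtain U F where
    U: "open U" "p \<in> U" "smooth_on U F" "\<And>x. x \<in> U \<Longrightarrow> x \<in> M \<Longrightarrow> F x = f x" by blast
  have "isCont F p" using smooth_on_continuous_on[OF U(3)] U(1,2) continuous_on_eq_continuous_at by blast
  then have "(F \<longlongrightarrow> f p) (at p within M)"
    using continuous_at_imp_continuous_at_within U(2,4) p unfolding continuous_within by metis
  moreover have "\<forall>\<^sub>F x in at p within M. F x = f x"
    unfolding eventually_at_topological using U by blast
  ultimately show "continuous (at p within M) f"
    unfolding continuous_within using tendsto_cong by fast
qed

lemma has_derivative_transform_openin:
  assumes "(f has_derivative f') (at p within M)" "open U" "p \<in> U" "p \<in> M"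
    and "\<And>x. x \<in> U \<Longrightarrow> x \<in> M \<Longrightarrow> f x = g x"
  shows "(g has_derivative f') (at p within M)"
proof -
  obtain d where "d > 0" "ball p d \<subseteq> U" using assms(2,3) openE by blast
  then show ?thesis
    by (intro has_derivative_transform_within[OF assms(1) _ assms(4)]) (auto simp: dist_commute intro!: assms(5))
qed

text \<open>A derivative within \<open>M\<close> is tested on velocities of curves in
  \<open>M\<close>; this rule makes \<open>mderiv\<close> well defined on tangent vectors and
  transports curves through charts.\<close>

lemma curve_has_derivative:
  fixes f :: "'a::euclidean_space \<Rightarrow> 'b::real_normed_vector"
  assumes "(f has_derivative f') (at p within M)" "e > 0" "\<And>t. t \<in> {-e<..<e} \<Longrightarrow> \<gamma> t \<in> M"
    "\<gamma> 0 = p" "(\<gamma> has_vector_derivative v) (at 0)"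
  shows "((\<lambda>t. f (\<gamma> t)) has_vector_derivative f' v) (at 0)"
proof -
  have "(\<gamma> has_derivative (\<lambda>t. t *\<^sub>R v)) (at 0 within {-e<..<e})"
    using assms(5) has_derivative_at_withinI unfolding has_vector_derivative_def by blast
  moreover have "(f has_derivative f') (at (\<gamma> 0) within \<gamma> ` {-e<..<e})"
    using assms by (auto intro: has_derivative_subset)
  ultimately have "((\<lambda>t. f (\<gamma> t)) has_derivative (\<lambda>t. f' (t *\<^sub>R v))) (at 0 within {-e<..<e})"
    using has_derivative_in_compose by blast
  moreover have "at (0::real) within {-e<..<e} = at 0"
    using assms(2) by (intro at_within_open) auto
  moreover have "(\<lambda>t. f' (t *\<^sub>R v)) = (\<lambda>t. t *\<^sub>R f' v)"
    using linear_scale[OF has_derivative_linear[OF assms(1)]] by blast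
  ultimately show ?thesis by (simp add: has_vector_derivative_def)
qed

lemma mderiv_eq:
  fixes f :: "'a::euclidean_space \<Rightarrow> 'b::real_normed_vector"
  assumes "(f has_derivative f') (at p within M)" "v \<in> tangent_space M p"
  shows "mderiv M f p v = f' v"
proof -
  obtain \<gamma> e where g: "e > 0" "\<And>t. t \<in> {-e<..<e} \<Longrightarrow> \<gamma> t \<in> M" "\<gamma> 0 = p" "(\<gamma> has_vector_derivative v) (at 0)"
    using assms(2) unfolding tangent_space_def by blast
  have "(f has_derivative frechet_derivative f (at p within M)) (at p within M)"
    using assms(1) frechet_derivative_works differentiable_def by blast
  from curve_has_derivative[OF this g] curve_has_derivative[OF assms(1) g]
  show ?thesis unfolding mderiv_def by (rule vector_derivative_unique_at)
qed

lemma smooth_map_on_has_derivative: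
  fixes f :: "'a::euclidean_space \<Rightarrow> 'b::real_normed_vector"
  assumes "smooth_map_on M f" "p \<in> M"
  shows "(f has_derivative mderiv M f p) (at p within M)"
proof -
  from smooth_map_onE[OF assms] obtain U F where
    U: "open U" "p \<in> U" "smooth_on U F" "\<And>x. x \<in> U \<Longrightarrow> x \<in> M \<Longrightarrow> F x = f x" by blast
  have "(F has_derivative frechet_derivative F (at p)) (at p within M)"
    by (rule has_derivative_at_withinI[OF smooth_on_has_derivative[OF U(3,1,2)]])
  then have "(f has_derivative frechet_derivative F (at p)) (at p within M)"
    by (rule has_derivative_transform_openin[OF _ U(1,2) assms(2) U(4)])
  then show ?thesis unfolding mderiv_def[abs_def] using frechet_derivative_works differentiable_def by blast
qed

lemma mderiv_extension:
  fixes f :: "'a::euclidean_space \<Rightarrow> 'b::real_normed_vector"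
  assumes "open U" "p \<in> U" "smooth_on U F" "\<And>x. x \<in> U \<Longrightarrow> x \<in> M \<Longrightarrow> F x = f x" "p \<in> M" "v \<in> tangent_space M p"
  shows "mderiv M f p v = frechet_derivative F (at p) v"
proof -
  have "(F has_derivative frechet_derivative F (at p)) (at p within M)"
    by (rule has_derivative_at_withinI[OF smooth_on_has_derivative[OF assms(3,1,2)]])
  then have "(f has_derivative frechet_derivative F (at p)) (at p within M)"
    by (rule has_derivative_transform_openin[OF _ assms(1,2,5,4)])
  then show ?thesis using assms(6) by (rule mderiv_eq)
qed

lemma mderiv_linear:
  fixes f :: "'a::euclidean_space \<Rightarrow> 'b::real_normed_vector"
  assumes "smooth_map_on M f" "p \<in> M"
  shows "linear (mderiv M f p)"
  using smooth_map_on_has_derivative[OF assms] by (rule has_derivative_linear)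

lemma at_within_Int_open: "open U \<Longrightarrow> p \<in> U \<Longrightarrow> at p within (M \<inter> U) = at p within M"
  by (rule at_within_nhd[of p U]) auto

lemma mderiv_Int: "open U \<Longrightarrow> p \<in> U \<Longrightarrow> mderiv (M \<inter> U) f p v = mderiv M f p v"
  unfolding mderiv_def by (simp add: at_within_Int_open)

text \<open>A curve in \<open>M\<close> through a point of the open set \<open>U\<close> stays in
  \<open>U\<close> for short times.\<close>

lemma tangent_space_Int:
  assumes U: "open U" "p \<in> U"
  shows "tangent_space (M \<inter> U) p = tangent_space M p"
proof (intro equalityI subsetI)
  fix v assume "v \<in> tangent_space M p"
  then obtain \<gamma> e where g: "e > 0" "\<And>t. t \<in> {-e<..<e} \<Longrightarrow> \<gamma> t \<in> M" "\<gamma> 0 = p" "(\<gamma> has_vector_derivative v) (at 0)"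
    unfolding tangent_space_def by blast
  have "isCont \<gamma> 0" using g(4) has_vector_derivative_continuous by blast
  then obtain d where d: "d > 0" "\<And>t. dist t 0 < d \<Longrightarrow> \<gamma> t \<in> U"
    using U g(3) by (metis continuous_at_open[of "0::real" \<gamma>] open_dist dist_commute)
  show "v \<in> tangent_space (M \<inter> U) p"
    unfolding tangent_space_def using g d
    by (auto intro!: exI[of _ \<gamma>] exI[of _ "min d e"])
qed (auto simp: tangent_space_def)

lemma submanifold_Int:
  assumes "submanifold k M" "open O'"
  shows "submanifold k (M \<inter> O')"
  unfolding submanifold_def
proof
  fix p assume p: "p \<in> M \<inter> O'"
  then have pM: "p \<in> M" and pO: "p \<in> O'" by auto
  from bspec[OF assms(1)[unfolded submanifold_def] pM]
  obtain U V and \<Phi> \<Psi> :: "'a \<Rightarrow> 'a" and S where c: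
    "open U" "p \<in> U" "open V" "smooth_on U \<Phi>" "smooth_on V \<Psi>" "\<Phi> ` U = V"
    "\<forall>x\<in>U. \<Psi> (\<Phi> x) = x" "subspace S" "dim S = k" "\<Phi> ` (U \<inter> M) = V \<inter> S"
    by (elim exE conjE) (rule that)
  have eq: "\<Phi> ` (U \<inter> O') = V \<inter> \<Psi> -` O'"
  proof (intro equalityI subsetI)
    fix y assume "y \<in> V \<inter> \<Psi> -` O'"
    moreover then obtain x where "x \<in> U" "y = \<Phi> x" using c(6) by blast
    ultimately show "y \<in> \<Phi> ` (U \<inter> O')" using c(7) by force
  next
    fix y assume "y \<in> \<Phi> ` (U \<inter> O')"
    then show "y \<in> V \<inter> \<Psi> -` O'" using c(6,7) by force
  qed
  have op: "open (V \<inter> \<Psi> -` O')"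
    by (rule continuous_open_preimage[OF smooth_on_continuous_on[OF c(5)] c(3) assms(2)])
  have "\<Phi> ` (U \<inter> O' \<inter> (M \<inter> O')) = (V \<inter> \<Psi> -` O') \<inter> S"
  proof (intro equalityI subsetI)
    fix y assume "y \<in> (V \<inter> \<Psi> -` O') \<inter> S"
    moreover then have "y \<in> \<Phi> ` (U \<inter> M)" using c(10) by blast
    then obtain x where "x \<in> U" "x \<in> M" "y = \<Phi> x" by blast
    ultimately show "y \<in> \<Phi> ` (U \<inter> O' \<inter> (M \<inter> O'))" using c(7) by force
  next
    fix y assume "y \<in> \<Phi> ` (U \<inter> O' \<inter> (M \<inter> O'))"
    then obtain x where x: "x \<in> U" "x \<in> O'" "x \<in> M" "y = \<Phi> x" by blast
    then have "y \<in> V \<inter> S" using c(10) by blast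
    then show "y \<in> (V \<inter> \<Psi> -` O') \<inter> S" using c(7) x by force
  qed
  moreover have "smooth_on (U \<inter> O') \<Phi>" "smooth_on (V \<inter> \<Psi> -` O') \<Psi>"
    using c(4,5) by (auto intro: smooth_on_subset)
  moreover have "open (U \<inter> O')" "p \<in> U \<inter> O'" "\<forall>x\<in>U \<inter> O'. \<Psi> (\<Phi> x) = x"
    using c(1,2,7) pO assms(2) by auto
  ultimately show "\<exists>U V (\<Phi>::'a \<Rightarrow> 'a) \<Psi> S. open U \<and> p \<in> U \<and> open V \<and> smooth_on U \<Phi> \<and> smooth_on V \<Psi> \<and>
        \<Phi> ` U = V \<and> (\<forall>x\<in>U. \<Psi> (\<Phi> x) = x) \<and> subspace S \<and> dim S = k \<and> \<Phi> ` (U \<inter> (M \<inter> O')) = V \<inter> S"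
    using c(8,9) eq op
    by (intro exI[of _ "U \<inter> O'"] exI[of _ "V \<inter> \<Psi> -` O'"] exI[of _ \<Phi>] exI[of _ \<Psi>] exI[of _ S] conjI)
qed

text \<open>A straightening of \<open>M\<close> as in \<open>submanifold\<close>, kept as a relation
  between all its data so that it can be used at every point of \<open>U\<close>.\<close>

definition chart :: "'a::euclidean_space set \<Rightarrow> 'a set \<Rightarrow> 'a set \<Rightarrow> ('a \<Rightarrow> 'a) \<Rightarrow> ('a \<Rightarrow> 'a) \<Rightarrow> 'a set \<Rightarrow> bool" where
  "chart M U V \<Phi> \<Psi> S \<longleftrightarrow> open U \<and> open V \<and> smooth_on U \<Phi> \<and> smooth_on V \<Psi> \<and>
     \<Phi> ` U = V \<and> (\<forall>x\<in>U. \<Psi> (\<Phi> x) = x) \<and> subspace S \<and> \<Phi> ` (U \<inter> M) = V \<inter> S"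

lemma submanifold_chart:
  assumes "submanifold k M" "p \<in> M"
  obtains U V \<Phi> \<Psi> S where "chart M U V \<Phi> \<Psi> S" "p \<in> U"
  using bspec[OF assms(1)[unfolded submanifold_def] assms(2)]
  unfolding chart_def by (elim exE conjE) (rule that, auto simp: chart_def)

lemma chart_segment:
  assumes c: "chart M U V \<Phi> \<Psi> S" and "y \<in> V" "y \<in> S"
  shows "\<Psi> y \<in> M" "\<Psi> y \<in> U" "\<Phi> (\<Psi> y) = y"
proof -
  have "y \<in> \<Phi> ` (U \<inter> M)" using assms by (auto simp: chart_def)
  then obtain x where "x \<in> U" "x \<in> M" "y = \<Phi> x" by blast
  then show "\<Psi> y \<in> M" "\<Psi> y \<in> U" "\<Phi> (\<Psi> y) = y" using c by (simp_all add: chart_def)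
qed

text \<open>The curve is the image under \<open>\<Psi>\<close> of the segment from \<open>y\<close>
  in direction \<open>s\<close>, which stays in the flat model \<open>V \<inter> S\<close>.\<close>

lemma chart_tangentI:
  assumes c: "chart M U V \<Phi> \<Psi> S" and y: "y \<in> V" "y \<in> S" and s: "s \<in> S"
  shows "frechet_derivative \<Psi> (at y) s \<in> tangent_space M (\<Psi> y)"
proof -
  have o: "open V" "smooth_on V \<Psi>" "subspace S" using c by (auto simp: chart_def)
  obtain d where d: "d > 0" "ball y d \<subseteq> V" using o y openE by blast
  define e where "e = d / (norm s + 1)"
  have e: "e > 0" using d by (simp add: e_def add_nonneg_pos)
  have "y + t *\<^sub>R s \<in> V" if "t \<in> {-e<..<e}" for t
  proof -
    have "\<bar>t\<bar> * norm s \<le> \<bar>t\<bar> * (norm s + 1)" by (intro mult_left_mono) auto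
    also have "\<dots> < e * (norm s + 1)" using that by (intro mult_strict_right_mono) (auto simp: add_nonneg_pos)
    also have "\<dots> = d" unfolding e_def using add_nonneg_pos[OF norm_ge_zero[of s] zero_less_one] by simp
    finally show ?thesis using d by (auto simp: dist_norm)
  qed
  then have "\<forall>t\<in>{-e<..<e}. \<Psi> (y + t *\<^sub>R s) \<in> M"
    using chart_segment(1)[OF c] y s o(3) by (simp add: subspace_add subspace_scale)
  moreover have "((\<lambda>t. \<Psi> (y + t *\<^sub>R s)) has_vector_derivative frechet_derivative \<Psi> (at y) s) (at 0)"
  proof (rule curve_has_derivative[where e=1 and M=UNIV and p=y and f=\<Psi> and v=s])
    show "(\<Psi> has_derivative frechet_derivative \<Psi> (at y)) (at y)"
      by (rule smooth_on_has_derivative[OF o(2,1) y(1)])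
    show "((\<lambda>t. y + t *\<^sub>R s) has_vector_derivative s) (at 0)"
      by (auto intro!: derivative_eq_intros)
  qed auto
  ultimately show ?thesis
    unfolding tangent_space_def using e by (auto intro!: exI[of _ "\<lambda>t. \<Psi> (y + t *\<^sub>R s)"] exI[of _ e])
qed

lemma chart_inverse_derivative:
  assumes c: "chart M U V \<Phi> \<Psi> S" and q: "q \<in> U"
  shows "frechet_derivative \<Psi> (at (\<Phi> q)) (frechet_derivative \<Phi> (at q) v) = v"
proof -
  have o: "open U" "open V" "smooth_on U \<Phi>" "smooth_on V \<Psi>" "\<Phi> q \<in> V" "\<And>x. x \<in> U \<Longrightarrow> \<Psi> (\<Phi> x) = x"
    using c q by (auto simp: chart_def)
  have "((\<lambda>x. \<Psi> (\<Phi> x)) has_derivative (\<lambda>v. frechet_derivative \<Psi> (at (\<Phi> q)) (frechet_derivative \<Phi> (at q) v))) (at q)"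
    using diff_chain_at[OF smooth_on_has_derivative[OF o(3,1) q] smooth_on_has_derivative[OF o(4,2,5)]]
    by (simp add: o_def)
  moreover have "((\<lambda>x. \<Psi> (\<Phi> x)) has_derivative (\<lambda>v. v)) (at q)"
    by (rule has_derivative_transform_within_open[OF has_derivative_ident o(1) q]) (use o(6) in simp)
  ultimately show ?thesis using has_derivative_unique by metis
qed

text \<open>Turns membership in \<open>S\<close> into scalar equations, so that tangency can be
  tested with the functions \<open>a \<bullet> \<Phi> x\<close>, which vanish on \<open>M\<close>
  when \<open>a\<close> annihilates \<open>S\<close>.\<close>

lemma subspace_orthogonal_iff:
  fixes S :: "'a::euclidean_space set"
  assumes "subspace S"
  shows "x \<in> S \<longleftrightarrow> (\<forall>a. (\<forall>s\<in>S. a \<bullet> s = 0) \<longrightarrow> a \<bullet> x = 0)"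
proof
  assume r: "\<forall>a. (\<forall>s\<in>S. a \<bullet> s = 0) \<longrightarrow> a \<bullet> x = 0"
  obtain y z where yz: "y \<in> span S" "\<And>w. w \<in> span S \<Longrightarrow> orthogonal z w" "x = y + z"
    using orthogonal_subspace_decomp_exists by metis
  have "z \<bullet> x = 0" using r yz(2) span_superset[of S] by (auto simp: orthogonal_def subset_eq)
  moreover have "z \<bullet> y = 0" using yz(1,2) by (simp add: orthogonal_def)
  ultimately have "z = 0" using yz(3) by (simp add: inner_add_right)
  then show "x \<in> S" using yz(1,3) span_eq_iff[THEN iffD2, OF assms] by simp
qed blast

lemma chart_tangentD:
  assumes c: "chart M U V \<Phi> \<Psi> S" and q: "q \<in> U" "q \<in> M" and v: "v \<in> tangent_space M q"
  shows "frechet_derivative \<Phi> (at q) v \<in> S"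
proof -
  have o: "open U" "smooth_on U \<Phi>" "subspace S" "\<Phi> ` (U \<inter> M) = V \<inter> S" using c by (auto simp: chart_def)
  have "v \<in> tangent_space (M \<inter> U) q" using v tangent_space_Int[OF o(1) q(1)] by simp
  then obtain \<gamma> e where g: "e > 0" "\<And>t. t \<in> {-e<..<e} \<Longrightarrow> \<gamma> t \<in> M \<inter> U" "\<gamma> 0 = q" "(\<gamma> has_vector_derivative v) (at 0)"
    unfolding tangent_space_def by blast
  have "(\<Phi> has_derivative frechet_derivative \<Phi> (at q)) (at q within (M \<inter> U))"
    by (rule has_derivative_at_withinI[OF smooth_on_has_derivative[OF o(2,1) q(1)]])
  from curve_has_derivative[OF this g]
  have "((\<lambda>t. \<Phi> (\<gamma> t)) has_vector_derivative frechet_derivative \<Phi> (at q) v) (at 0)" .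
  note d = this
  have "a \<bullet> frechet_derivative \<Phi> (at q) v = 0" if a: "\<And>s. s \<in> S \<Longrightarrow> a \<bullet> s = 0" for a
  proof -
    have "((\<lambda>t. a \<bullet> \<Phi> (\<gamma> t)) has_vector_derivative a \<bullet> frechet_derivative \<Phi> (at q) v) (at 0)"
      using bounded_linear.has_vector_derivative[OF bounded_linear_inner_right d] .
    moreover have "((\<lambda>t. a \<bullet> \<Phi> (\<gamma> t)) has_vector_derivative 0) (at 0)"
    proof (rule has_vector_derivative_transform_within_open[OF has_vector_derivative_const])
      show "open {-e<..<e}" "0 \<in> {-e<..<e}" using g(1) by auto
      fix t assume "t \<in> {-e<..<e}"
      then show "0 = a \<bullet> \<Phi> (\<gamma> t)" using a g(2) o(4) by auto
    qed
    ultimately show ?thesis by (rule vector_derivative_unique_at)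
  qed
  then show ?thesis using subspace_orthogonal_iff[OF o(3)] by blast
qed

lemma chart_tangent_iff:
  assumes c: "chart M U V \<Phi> \<Psi> S" and q: "q \<in> U" "q \<in> M"
  shows "v \<in> tangent_space M q \<longleftrightarrow> frechet_derivative \<Phi> (at q) v \<in> S"
proof
  assume s: "frechet_derivative \<Phi> (at q) v \<in> S"
  have "\<Phi> q \<in> V" "\<Phi> q \<in> S" "\<Psi> (\<Phi> q) = q" using c q by (auto simp: chart_def)
  then show "v \<in> tangent_space M q"
    using chart_tangentI[OF c _ _ s, of "\<Phi> q"] chart_inverse_derivative[OF c q(1)] by simp
qed (rule chart_tangentD[OF assms])

lemma subspace_tangent_space:
  assumes "submanifold k M" "p \<in> M"
  shows "subspace (tangent_space M p)"
proof -
  obtain U V \<Phi> \<Psi> S where c: "chart M U V \<Phi> \<Psi> S" and p: "p \<in> U" using submanifold_chart[OF assms] .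
  have o: "open U" "smooth_on U \<Phi>" "subspace S" using c by (auto simp: chart_def)
  have "tangent_space M p = frechet_derivative \<Phi> (at p) -` S"
    using chart_tangent_iff[OF c p assms(2)] by auto
  moreover have "linear (frechet_derivative \<Phi> (at p))"
    using has_derivative_linear[OF smooth_on_has_derivative[OF o(2,1) p]] .
  ultimately show ?thesis using linear_subspace_vimage[of _ S] o(3) by metis
qed

text \<open>In contrast to \<open>vector_field\<close>, values off \<open>M\<close> are free, so
  that a frame on \<open>M\<close> is also a frame on every open part of \<open>M\<close>.\<close>

definition tangent_field :: "'a::euclidean_space set \<Rightarrow> ('a \<Rightarrow> 'a) \<Rightarrow> bool" where
  "tangent_field M X \<longleftrightarrow> smooth_map_on M X \<and> (\<forall>p\<in>M. X p \<in> tangent_space M p)"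

text \<open>The value 0 off \<open>M\<close> makes identities between derivatives equalities of
  functions, usable in the ring of all functions.\<close>

definition along :: "'a::euclidean_space set \<Rightarrow> ('a \<Rightarrow> 'a) \<Rightarrow> ('a \<Rightarrow> real) \<Rightarrow> 'a \<Rightarrow> real" where
  "along M X h p = (if p \<in> M then mderiv M h p (X p) else 0)"

lemma tangent_fieldD: "tangent_field M X \<Longrightarrow> smooth_map_on M X" "tangent_field M X \<Longrightarrow> p \<in> M \<Longrightarrow> X p \<in> tangent_space M p"
  by (auto simp: tangent_field_def)

lemma smooth_map_on_mderiv:
  fixes f :: "'a::euclidean_space \<Rightarrow> 'b::real_normed_vector"
  assumes "smooth_map_on M f" "tangent_field M X"
  shows "smooth_map_on M (\<lambda>p. mderiv M f p (X p))"
proof (rule smooth_map_onI)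
  fix p assume "p \<in> M"
  from smooth_map_onE2[OF assms(1) tangent_fieldD(1)[OF assms(2)] this] obtain U F G where
    U: "open U" "p \<in> U" "smooth_on U F" "smooth_on U G"
    "\<And>x. x \<in> U \<Longrightarrow> x \<in> M \<Longrightarrow> F x = f x" "\<And>x. x \<in> U \<Longrightarrow> x \<in> M \<Longrightarrow> G x = X x" by blast
  then show "\<exists>U F. open U \<and> p \<in> U \<and> smooth_on U F \<and> (\<forall>x\<in>U \<inter> M. F x = mderiv M f x (X x))"
    using mderiv_extension[OF U(1) _ U(3,5)] tangent_fieldD(2)[OF assms(2)]
    by (intro exI[of _ U] exI[of _ "\<lambda>x. frechet_derivative F (at x) (G x)"])
      (auto intro: smooth_on_derivative_field)
qed

lemma smooth_map_on_along: "smooth_map_on M h \<Longrightarrow> tangent_field M X \<Longrightarrow> smooth_map_on M (along M X h)"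
  by (rule smooth_map_on_cong[OF smooth_map_on_mderiv]) (auto simp: along_def)

lemma mderiv_add:
  fixes f g :: "'a::euclidean_space \<Rightarrow> 'b::real_normed_vector"
  assumes "smooth_map_on M f" "smooth_map_on M g" "p \<in> M" "v \<in> tangent_space M p"
  shows "mderiv M (\<lambda>x. f x + g x) p v = mderiv M f p v + mderiv M g p v"
  by (rule mderiv_eq[OF has_derivative_add[OF smooth_map_on_has_derivative smooth_map_on_has_derivative]])
    (use assms in auto)

lemma mderiv_bilinear:
  fixes f :: "'a::euclidean_space \<Rightarrow> 'b::real_normed_vector" and g :: "'a::euclidean_space \<Rightarrow> 'c::real_normed_vector"
  assumes "bounded_bilinear B" "smooth_map_on M f" "smooth_map_on M g" "p \<in> M" "v \<in> tangent_space M p"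
  shows "mderiv M (\<lambda>x. B (f x) (g x)) p v = B (f p) (mderiv M g p v) + B (mderiv M f p v) (g p)"
  by (rule mderiv_eq[OF bounded_bilinear.FDERIV[OF assms(1) smooth_map_on_has_derivative smooth_map_on_has_derivative]])
    (use assms in auto)

lemma mderiv_const:
  "p \<in> M \<Longrightarrow> v \<in> tangent_space M p \<Longrightarrow> mderiv M (\<lambda>x. c) p v = 0"
  by (rule mderiv_eq[OF has_derivative_const])

lemma mderiv_sum:
  fixes f :: "'i \<Rightarrow> 'a::euclidean_space \<Rightarrow> 'b::real_normed_vector"
  assumes "\<And>i. i \<in> I \<Longrightarrow> smooth_map_on M (f i)" "p \<in> M" "v \<in> tangent_space M p"
  shows "mderiv M (\<lambda>x. \<Sum>i\<in>I. f i x) p v = (\<Sum>i\<in>I. mderiv M (f i) p v)"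
  by (rule mderiv_eq[OF has_derivative_sum[OF smooth_map_on_has_derivative]]) (use assms in auto)

lemma mderiv_cong:
  assumes "\<And>x. x \<in> M \<Longrightarrow> f x = g x" "p \<in> M"
  shows "mderiv M f p v = mderiv M g p v"
proof -
  have "(f has_derivative D) (at p within M) \<longleftrightarrow> (g has_derivative D) (at p within M)" for D
    using has_derivative_transform[of p M f g] has_derivative_transform[of p M g f] assms by metis
  then show ?thesis unfolding mderiv_def frechet_derivative_def by simp
qed

lemma mderiv_local:
  assumes "open U" "p \<in> U" "p \<in> M" "\<And>x. x \<in> U \<Longrightarrow> x \<in> M \<Longrightarrow> f x = g x"
  shows "mderiv M f p v = mderiv M g p v"
  using mderiv_cong[of "M \<inter> U" f g p v] mderiv_Int[OF assms(1,2), of M f] mderiv_Int[OF assms(1,2), of M g] assms by auto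

text \<open>Product rule for the derivative of \<open>F\<close> applied to a moving vector
  \<open>W x\<close>: one term moves the vector, the other is a second derivative with the vector
  frozen. Expansion in \<open>Basis\<close> reduces it to scalar products.\<close>

lemma frechet_derivative_field:
  fixes F :: "'a::euclidean_space \<Rightarrow> real"
  assumes U: "open U" "p \<in> U" and F: "smooth_on U F" and W: "smooth_on U W"
  shows "((\<lambda>x. frechet_derivative F (at x) (W x)) has_derivative
     (\<lambda>v. frechet_derivative F (at p) (frechet_derivative W (at p) v) +
        frechet_derivative (\<lambda>x. frechet_derivative F (at x) (W p)) (at p) v)) (at p)"
proof -
  let ?D = "\<lambda>b x. frechet_derivative F (at x) b"
  have lin: "linear (frechet_derivative F (at x))" if "x \<in> U" for x
    using smooth_on_has_derivative[OF F U(1) that] has_derivative_linear by blast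
  have exp: "frechet_derivative F (at x) w = (\<Sum>b\<in>Basis. (w \<bullet> b) * ?D b x)" if "x \<in> U" for x w
    by (rule trans[OF frechet_derivative_basis[OF smooth_on_has_derivative[OF F U(1) that]]]) simp
  have dD: "(?D b has_derivative frechet_derivative (?D b) (at p)) (at p)" for b
    by (rule smooth_on_has_derivative[OF smooth_on_derivative[OF F] U])
  have "((\<lambda>x. \<Sum>b\<in>Basis. (W x \<bullet> b) * ?D b x) has_derivative
      (\<lambda>v. \<Sum>b\<in>Basis. (W p \<bullet> b) * frechet_derivative (?D b) (at p) v +
        (frechet_derivative W (at p) v \<bullet> b) * ?D b p)) (at p)"
    by (intro has_derivative_sum has_derivative_mult dD has_derivative_inner_left
        smooth_on_has_derivative[OF W U])
  then have 1: "((\<lambda>x. frechet_derivative F (at x) (W x)) has_derivative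
      (\<lambda>v. \<Sum>b\<in>Basis. (W p \<bullet> b) * frechet_derivative (?D b) (at p) v +
        (frechet_derivative W (at p) v \<bullet> b) * ?D b p)) (at p)"
    by (rule has_derivative_transform_within_open[OF _ U]) (use exp in auto)
  have "((\<lambda>x. \<Sum>b\<in>Basis. (W p \<bullet> b) * ?D b x) has_derivative
      (\<lambda>v. \<Sum>b\<in>Basis. (W p \<bullet> b) * frechet_derivative (?D b) (at p) v)) (at p)"
    by (intro has_derivative_sum has_derivative_mult_right dD)
  then have "(?D (W p) has_derivative
      (\<lambda>v. \<Sum>b\<in>Basis. (W p \<bullet> b) * frechet_derivative (?D b) (at p) v)) (at p)"
    by (rule has_derivative_transform_within_open[OF _ U]) (use exp in auto)
  then have "frechet_derivative (?D (W p)) (at p) =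
      (\<lambda>v. \<Sum>b\<in>Basis. (W p \<bullet> b) * frechet_derivative (?D b) (at p) v)"
    by (rule frechet_derivative_at[symmetric])
  note e = this
  have "(\<lambda>v. frechet_derivative F (at p) (frechet_derivative W (at p) v) + frechet_derivative (?D (W p)) (at p) v)
    = (\<lambda>v. \<Sum>b\<in>Basis. (W p \<bullet> b) * frechet_derivative (?D b) (at p) v +
        (frechet_derivative W (at p) v \<bullet> b) * ?D b p)"
  proof
    fix v
    show "frechet_derivative F (at p) (frechet_derivative W (at p) v) + frechet_derivative (?D (W p)) (at p) v
      = (\<Sum>b\<in>Basis. (W p \<bullet> b) * frechet_derivative (?D b) (at p) v + (frechet_derivative W (at p) v \<bullet> b) * ?D b p)"
      unfolding exp[OF U(2), of "frechet_derivative W (at p) v"] e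
      by (simp add: sum.distrib add.commute)
  qed
  then show ?thesis using 1 by (simp only:)
qed

text \<open>The second derivatives cancel by symmetry. The right side uses the ambient derivative of
  an extension \<open>F\<close> because the bracket is not yet known to be tangent; its tangency is
  deduced from this formula.\<close>

lemma commutator_pointwise:
  fixes h :: "'a::euclidean_space \<Rightarrow> real"
  assumes h: "smooth_map_on M h" and X: "tangent_field M X" and Y: "tangent_field M Y" and p: "p \<in> M"
    and U: "open U" "p \<in> U" and F: "smooth_on U F" "\<And>x. x \<in> U \<Longrightarrow> x \<in> M \<Longrightarrow> F x = h x"
  shows "along M X (along M Y h) p - along M Y (along M X h) p =
    frechet_derivative F (at p) (lie_bracket M X Y p)"
proof -
  obtain V XX YY where V: "open V" "p \<in> V" "smooth_on V XX" "smooth_on V YY"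
    "\<And>x. x \<in> V \<Longrightarrow> x \<in> M \<Longrightarrow> XX x = X x" "\<And>x. x \<in> V \<Longrightarrow> x \<in> M \<Longrightarrow> YY x = Y x"
    using smooth_map_onE2[OF tangent_fieldD(1)[OF X] tangent_fieldD(1)[OF Y] p] by blast
  let ?O = "U \<inter> V"
  have O: "open ?O" "p \<in> ?O" "smooth_on ?O F" "smooth_on ?O XX" "smooth_on ?O YY"
    using U V F by (auto intro: smooth_on_subset)
  note tX = tangent_fieldD(2)[OF X] and tY = tangent_fieldD(2)[OF Y]
  have key: "along M Z (along M W h) p = frechet_derivative F (at p) (mderiv M W p (Z p)) +
      frechet_derivative (\<lambda>x. frechet_derivative F (at x) (W p)) (at p) (Z p)"
    if Z: "tangent_field M Z" and W: "tangent_field M W" and WW: "smooth_on ?O WW" "\<And>x. x \<in> ?O \<Longrightarrow> x \<in> M \<Longrightarrow> WW x = W x" for Z W WW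
  proof -
    have ext: "frechet_derivative F (at x) (WW x) = along M W h x" if "x \<in> ?O" "x \<in> M" for x
      using mderiv_extension[OF U(1) _ F(1,2) that(2) tangent_fieldD(2)[OF W that(2)]] that WW(2)[OF that]
      by (simp add: along_def)
    have "((\<lambda>x. frechet_derivative F (at x) (WW x)) has_derivative
     (\<lambda>v. frechet_derivative F (at p) (frechet_derivative WW (at p) v) +
        frechet_derivative (\<lambda>x. frechet_derivative F (at x) (WW p)) (at p) v)) (at p within M)"
      by (rule has_derivative_at_withinI[OF frechet_derivative_field[OF O(1,2,3) WW(1)]])
    then have "(along M W h has_derivative
     (\<lambda>v. frechet_derivative F (at p) (frechet_derivative WW (at p) v) +
        frechet_derivative (\<lambda>x. frechet_derivative F (at x) (WW p)) (at p) v)) (at p within M)"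
      by (rule has_derivative_transform_openin[OF _ O(1,2) p ext])
    from mderiv_eq[OF this tangent_fieldD(2)[OF Z p]]
    show ?thesis
      using mderiv_extension[OF O(1,2) WW p tangent_fieldD(2)[OF Z p]] WW(2)[OF O(2) p] p
      by (simp add: along_def)
  qed
  have lin: "linear (frechet_derivative F (at p))"
    using smooth_on_has_derivative[OF F(1) U] has_derivative_linear by blast
  have "Ck_on 2 ?O F" using O(3) by (simp add: smooth_on_def)
  from symmetric_second_derivative[OF O(1) this O(2), of "X p" "Y p"]
  show ?thesis
    using key[OF X Y O(5)] key[OF Y X O(4)] V(5,6) p linear_diff[OF lin]
    by (simp add: lie_bracket_def)
qed

text \<open>The functions \<open>a \<bullet> \<Phi> x\<close> with \<open>a\<close> orthogonal to
  \<open>S\<close> vanish on \<open>M\<close> near \<open>p\<close>; so do their derivatives along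
  \<open>X\<close> and \<open>Y\<close>, and the commutator formula shows that the bracket
  annihilates them.\<close>

lemma tangent_field_lie_bracket:
  assumes M: "submanifold k M" and X: "tangent_field M X" and Y: "tangent_field M Y"
  shows "tangent_field M (lie_bracket M X Y)"
  unfolding tangent_field_def
proof
  have "smooth_map_on M (\<lambda>p. mderiv M Y p (X p) - mderiv M X p (Y p))"
    by (intro smooth_map_on_diff smooth_map_on_mderiv tangent_fieldD X Y)
  then show "smooth_map_on M (lie_bracket M X Y)"
    by (rule smooth_map_on_cong) (simp add: lie_bracket_def)
  show "\<forall>p\<in>M. lie_bracket M X Y p \<in> tangent_space M p"
  proof
    fix p assume p: "p \<in> M"
    obtain U V \<Phi> \<Psi> S where c: "chart M U V \<Phi> \<Psi> S" and pU: "p \<in> U" using submanifold_chart[OF M p] .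
    have o: "open U" "smooth_on U \<Phi>" "subspace S" "\<Phi> ` (U \<inter> M) = V \<inter> S" using c by (auto simp: chart_def)
    have "a \<bullet> frechet_derivative \<Phi> (at p) (lie_bracket M X Y p) = 0" if a: "\<And>s. s \<in> S \<Longrightarrow> a \<bullet> s = 0" for a
    proof -
      let ?N = "M \<inter> U" and ?F = "\<lambda>x. a \<bullet> \<Phi> x"
      have F: "smooth_on U ?F" by (rule smooth_on_linear[OF bounded_linear_inner_right o(1,2)])
      have pN: "p \<in> ?N" using p pU by simp
      have tf: "tangent_field ?N Z" if "tangent_field M Z" for Z
        using that smooth_map_on_subset[of M Z ?N] tangent_space_Int[OF o(1), of _ M] by (auto simp: tangent_field_def)
      have z: "?F x = 0" if "x \<in> U" "x \<in> ?N" for x using that o(4) a by auto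
      have al: "along ?N Z (\<lambda>x. 0) = (\<lambda>x. 0)" if "tangent_field ?N Z" for Z
        using mderiv_const[of _ ?N _ "0::real"] tangent_fieldD(2)[OF that] by (auto simp: along_def)
      have "frechet_derivative ?F (at p) (lie_bracket ?N X Y p) = 0"
        using commutator_pointwise[OF smooth_map_on_const tf[OF X] tf[OF Y] pN o(1) pU F z] al tf X Y by simp
      moreover have "lie_bracket ?N X Y p = lie_bracket M X Y p"
        using p pU by (simp add: lie_bracket_def mderiv_Int[OF o(1) pU])
      moreover have "(?F has_derivative (\<lambda>v. a \<bullet> frechet_derivative \<Phi> (at p) v)) (at p)"
        by (rule has_derivative_inner_right[OF smooth_on_has_derivative[OF o(2,1) pU]])
      ultimately show ?thesis using frechet_derivative_at by metis
    qed
    then show "lie_bracket M X Y p \<in> tangent_space M p"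
      using chart_tangent_iff[OF c pU p] subspace_orthogonal_iff[OF o(3)] by blast
  qed
qed

lemma along_lie_bracket:
  assumes M: "submanifold k M" and h: "smooth_map_on M h" and X: "tangent_field M X" and Y: "tangent_field M Y"
  shows "along M (lie_bracket M X Y) h p = along M X (along M Y h) p - along M Y (along M X h) p"
proof (cases "p \<in> M")
  case True
  from smooth_map_onE[OF h this] obtain U F where
    U: "open U" "p \<in> U" "smooth_on U F" "\<And>x. x \<in> U \<Longrightarrow> x \<in> M \<Longrightarrow> F x = h x" by blast
  show ?thesis
    using commutator_pointwise[OF h X Y True U(1,2,3,4)] mderiv_extension[OF U(1,2,3,4) True]
      tangent_fieldD(2)[OF tangent_field_lie_bracket[OF M X Y] True] True by (simp add: along_def)
qed (simp add: along_def)

section \<open>One-forms, symmetric tensors and Cartan's formula\<close>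

lemma one_form_apply_smooth:
  assumes w: "one_form M \<omega>" and X: "smooth_map_on M X"
  shows "smooth_map_on M (\<lambda>p. \<omega> p (X p))"
proof (rule smooth_map_on_cong)
  show "smooth_map_on M (\<lambda>p. \<Sum>b\<in>Basis. (X p \<bullet> b) * \<omega> p b)"
    using w by (intro smooth_map_on_sum smooth_map_on_mult smooth_map_on_linear[OF bounded_linear_inner_left] X)
      (auto simp: one_form_def)
  fix p assume "p \<in> M"
  then have l: "linear (\<omega> p)" using w by (auto simp: one_form_def)
  have "\<omega> p (X p) = \<omega> p (\<Sum>b\<in>Basis. (X p \<bullet> b) *\<^sub>R b)" by (simp add: euclidean_representation)
  also have "\<dots> = (\<Sum>b\<in>Basis. (X p \<bullet> b) * \<omega> p b)" by (simp add: linear_sum[OF l] linear_scale[OF l])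
  finally show "(\<Sum>b\<in>Basis. (X p \<bullet> b) * \<omega> p b) = \<omega> p (X p)" by simp
qed

lemma one_form_product_rule:
  assumes w: "one_form M \<omega>" and X: "smooth_map_on M X" and p: "p \<in> M" and v: "v \<in> tangent_space M p"
  shows "mderiv M (\<lambda>q. \<omega> q (X q)) p v = mderiv M (\<lambda>q. \<omega> q (X p)) p v + \<omega> p (mderiv M X p v)"
proof -
  have ws: "smooth_map_on M (\<lambda>q. \<omega> q b)" for b using w by (auto simp: one_form_def)
  have lin: "linear (\<omega> q)" if "q \<in> M" for q using w that by (auto simp: one_form_def)
  have exp: "\<omega> q u = (\<Sum>b\<in>Basis. (u \<bullet> b) * \<omega> q b)" if "q \<in> M" for q u
  proof -
    have "\<omega> q u = \<omega> q (\<Sum>b\<in>Basis. (u \<bullet> b) *\<^sub>R b)" by (simp add: euclidean_representation)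
    then show ?thesis by (simp add: linear_sum[OF lin[OF that]] linear_scale[OF lin[OF that]])
  qed
  have xs: "smooth_map_on M (\<lambda>q. X q \<bullet> b)" for b
    by (rule smooth_map_on_linear[OF bounded_linear_inner_left X])
  have db: "mderiv M (\<lambda>q. X q \<bullet> b) p v = mderiv M X p v \<bullet> b" for b
    by (rule mderiv_eq[OF has_derivative_inner_left[OF smooth_map_on_has_derivative[OF X p]] v])
  have "mderiv M (\<lambda>q. \<omega> q (X q)) p v = mderiv M (\<lambda>q. \<Sum>b\<in>Basis. (X q \<bullet> b) * \<omega> q b) p v"
    by (rule mderiv_cong[OF exp p])
  also have "\<dots> = (\<Sum>b\<in>Basis. (X p \<bullet> b) * mderiv M (\<lambda>q. \<omega> q b) p v + (mderiv M X p v \<bullet> b) * \<omega> p b)"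
    by (simp add: mderiv_sum[OF smooth_map_on_mult[OF xs ws] p v]
        mderiv_bilinear[OF bounded_bilinear_mult xs ws p v] db)
  also have "\<dots> = (\<Sum>b\<in>Basis. (X p \<bullet> b) * mderiv M (\<lambda>q. \<omega> q b) p v) + \<omega> p (mderiv M X p v)"
    by (simp add: sum.distrib exp[OF p, of "mderiv M X p v"])
  also have "(\<Sum>b\<in>Basis. (X p \<bullet> b) * mderiv M (\<lambda>q. \<omega> q b) p v) = mderiv M (\<lambda>q. \<Sum>b\<in>Basis. (X p \<bullet> b) * \<omega> q b) p v"
    by (simp add: mderiv_sum[OF smooth_map_on_mult[OF smooth_map_on_const ws] p v]
        mderiv_bilinear[OF bounded_bilinear_mult smooth_map_on_const ws p v] mderiv_const[OF p v])
  also have "\<dots> = mderiv M (\<lambda>q. \<omega> q (X p)) p v"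
    by (rule mderiv_cong[OF exp[symmetric] p])
  finally show ?thesis .
qed

text \<open>Cartan's formula. The product rule produces the derivatives of \<open>X\<close> and
  \<open>Y\<close>, and these combine to the bracket.\<close>

lemma ext_deriv_fields:
  assumes w: "one_form M \<omega>" and X: "tangent_field M X" and Y: "tangent_field M Y" and p: "p \<in> M"
  shows "ext_deriv M \<omega> p (X p) (Y p) =
    mderiv M (\<lambda>q. \<omega> q (Y q)) p (X p) - mderiv M (\<lambda>q. \<omega> q (X q)) p (Y p) - \<omega> p (lie_bracket M X Y p)"
proof -
  have l: "linear (\<omega> p)" using w p by (auto simp: one_form_def)
  show ?thesis
    using one_form_product_rule[OF w tangent_fieldD(1)[OF Y] p tangent_fieldD(2)[OF X p]]
      one_form_product_rule[OF w tangent_fieldD(1)[OF X] p tangent_fieldD(2)[OF Y p]] p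
    by (simp add: ext_deriv_def lie_bracket_def linear_diff[OF l])
qed

text \<open>One slot at a time, each partial evaluation of \<open>g\<close> being a
  one-form.\<close>

lemma sym_tensor_product_rule:
  assumes g: "sym_tensor M g" and X: "smooth_map_on M X" and Y: "smooth_map_on M Y"
    and p: "p \<in> M" and v: "v \<in> tangent_space M p"
  shows "mderiv M (\<lambda>q. g q (X q) (Y q)) p v =
    mderiv M (\<lambda>q. g q (X p) (Y p)) p v + g p (mderiv M X p v) (Y p) + g p (X p) (mderiv M Y p v)"
proof -
  have bl: "bilinear (g q)" if "q \<in> M" for q using g that by (auto simp: sym_tensor_def)
  have gs: "smooth_map_on M (\<lambda>q. g q a b)" for a b using g by (auto simp: sym_tensor_def)
  have f1: "one_form M (\<lambda>q a. g q a (c))" and f2: "one_form M (\<lambda>q a. g q c a)" for c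
    using bl gs by (auto simp: one_form_def bilinear_def)
  have f3: "one_form M (\<lambda>q a. g q a (Y q))"
    unfolding one_form_def using bl one_form_apply_smooth[OF f2 Y] by (auto simp: bilinear_def)
  show ?thesis
    using one_form_product_rule[OF f3 X p v] one_form_product_rule[OF f2[of "X p"] Y p v] by simp
qed

section \<open>Prolongation\<close>

text \<open>The submodule generated by \<open>G\<close> when \<open>A\<close> is a subring of the
  ambient ring. Building it one summand at a time fits the inductions on the Leibniz rule and on
  estimates.\<close>

inductive_set mod_span :: "'r::comm_ring_1 set \<Rightarrow> 'r set \<Rightarrow> 'r set" for A G where
  zero: "0 \<in> mod_span A G"
| step: "a \<in> A \<Longrightarrow> g \<in> G \<Longrightarrow> x \<in> mod_span A G \<Longrightarrow> a * g + x \<in> mod_span A G"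

locale coefficient_ring =
  fixes A :: "'r::comm_ring_1 set"
  assumes one: "1 \<in> A" and add: "a \<in> A \<Longrightarrow> b \<in> A \<Longrightarrow> a + b \<in> A"
    and mult: "a \<in> A \<Longrightarrow> b \<in> A \<Longrightarrow> a * b \<in> A" and minus: "a \<in> A \<Longrightarrow> - a \<in> A"
begin

lemma A0: "0 \<in> A"
  using add[OF one minus[OF one]] by simp

lemma span_base: "g \<in> G \<Longrightarrow> g \<in> mod_span A G"
  using mod_span.step[OF one _ mod_span.zero] by fastforce

lemma span_add: "x \<in> mod_span A G \<Longrightarrow> y \<in> mod_span A G \<Longrightarrow> x + y \<in> mod_span A G"
  by (induction rule: mod_span.induct) (auto simp: add.assoc intro: mod_span.step)

lemma span_mult: "a \<in> A \<Longrightarrow> x \<in> mod_span A G \<Longrightarrow> a * x \<in> mod_span A G"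
proof (rotate_tac, induction rule: mod_span.induct)
  case (step b g x)
  then show ?case
    using mod_span.step[OF mult[of a b], of g G "a * x"] by (simp add: algebra_simps)
qed (simp add: mod_span.zero)

lemma span_minus: "x \<in> mod_span A G \<Longrightarrow> - x \<in> mod_span A G"
  using span_mult[OF minus[OF one]] by fastforce

lemma span_diff: "x \<in> mod_span A G \<Longrightarrow> y \<in> mod_span A G \<Longrightarrow> x - y \<in> mod_span A G"
  using span_add[of x G "- y"] span_minus by simp

lemma span_subset: "G \<subseteq> mod_span A H \<Longrightarrow> x \<in> mod_span A G \<Longrightarrow> x \<in> mod_span A H"
  by (rotate_tac, induction rule: mod_span.induct) (auto intro: mod_span.zero span_add span_mult)

lemma span_mono: "x \<in> mod_span A G \<Longrightarrow> G \<subseteq> H \<Longrightarrow> x \<in> mod_span A H"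
  by (rule span_subset) (auto intro: span_base)

lemma span_closed: "x \<in> mod_span A G \<Longrightarrow> G \<subseteq> A \<Longrightarrow> x \<in> A"
  by (induction rule: mod_span.induct) (auto intro: A0 add mult)

definition derivation :: "('r \<Rightarrow> 'r) \<Rightarrow> bool" where
  "derivation D \<longleftrightarrow> (\<forall>a\<in>A. D a \<in> A \<and> (\<forall>b\<in>A. D (a + b) = D a + D b \<and> D (a * b) = a * D b + D a * b))"

lemma derivation_props:
  assumes "derivation D" "a \<in> A" "b \<in> A"
  shows "D a \<in> A" "D (a + b) = D a + D b" "D (a * b) = a * D b + D a * b"
    "D 0 = 0" "D (a - b) = D a - D b"
proof -
  have d: "\<And>a b. a \<in> A \<Longrightarrow> b \<in> A \<Longrightarrow> D (a + b) = D a + D b" using assms(1) by (auto simp: derivation_def)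
  show "D a \<in> A" "D (a + b) = D a + D b" "D (a * b) = a * D b + D a * b"
    using assms by (auto simp: derivation_def)
  show "D 0 = 0" using d[OF A0 A0] by simp
  show "D (a - b) = D a - D b"
    using d[of "a - b" b] add[OF assms(2) minus[OF assms(3)]] assms(3) by simp
qed

text \<open>By the Leibniz rule \<open>D (a * h) = a * D h + D a * h\<close>, so generators suffice,
  provided they lie in the target module themselves.\<close>

lemma derivation_span:
  assumes D: "derivation D" and x: "x \<in> mod_span A G" and G: "G \<subseteq> A" "G \<subseteq> mod_span A H"
    and g: "\<And>g. g \<in> G \<Longrightarrow> D g \<in> mod_span A H"
  shows "D x \<in> mod_span A H"
  using x
proof (induction rule: mod_span.induct)
  case zero
  then show ?case using derivation_props(4)[OF D one one] mod_span.zero by simp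
next
  case (step a h x)
  then have "x \<in> A" "h \<in> A" "D a \<in> A" using span_closed G derivation_props(1)[OF D] by auto
  then have "D (a * h + x) = a * D h + D a * h + D x"
    using derivation_props[OF D] step mult by simp
  moreover have "h \<in> mod_span A H" using G step by auto
  ultimately show ?case using step g \<open>D a \<in> A\<close> by (auto intro!: span_add span_mult)
qed

end

text \<open>The weight computation isolated from geometry: \<open>A\<close> will be the smooth
  functions, \<open>e i\<close> and \<open>f i\<close> the derivatives along a frame of the two
  subbundles, \<open>T\<close> that along a transverse field. \<open>ef\<close> says that
  \<open>[e i, f j]\<close> is \<open>T\<close> or nothing up to contact directions;
  \<open>eT\<close> and \<open>fT\<close> say that a bracket with \<open>T\<close> is of first
  order. That \<open>u\<close> comes from a symmetry enters through \<open>eeu\<close> and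
  \<open>ffu\<close>.\<close>

locale prolongation = coefficient_ring A for A :: "'r::comm_ring_1 set" +
  fixes e f :: "'i \<Rightarrow> 'r \<Rightarrow> 'r" and T :: "'r \<Rightarrow> 'r" and i0 :: 'i and u half third :: 'r
  assumes half: "half \<in> A" "half + half = 1" and third: "third \<in> A" "third + third + third = 1"
    and de: "derivation (e i)" and df: "derivation (f i)"
    and T_def: "T h = e i0 (f i0 h) - f i0 (e i0 h)"
    and ef: "h \<in> A \<Longrightarrow> e i (f j h) - f j (e i h) - (if i = j then T h else 0)
       \<in> mod_span A (range (\<lambda>k. e k h) \<union> range (\<lambda>k. f k h))"
    and eT: "h \<in> A \<Longrightarrow> e i (T h) - T (e i h) \<in> mod_span A (insert (T h) (range (\<lambda>k. e k h) \<union> range (\<lambda>k. f k h)))"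
    and fT: "h \<in> A \<Longrightarrow> f i (T h) - T (f i h) \<in> mod_span A (insert (T h) (range (\<lambda>k. e k h) \<union> range (\<lambda>k. f k h)))"
    and u: "u \<in> A"
    and eeu: "e i (e j u) \<in> mod_span A (insert u (range (\<lambda>k. e k u) \<union> range (\<lambda>k. f k u)))"
    and ffu: "f i (f j u) \<in> mod_span A (insert u (range (\<lambda>k. e k u) \<union> range (\<lambda>k. f k u)))"
begin

text \<open>Generators up to weight \<open>k\<close>. For an index type with two elements there are
  at most 1, 5, 10, 14, 15 of them for \<open>k\<close> from 0 to 4.\<close>

definition gens :: "nat \<Rightarrow> 'r set" where
  "gens k = {u} \<union> (if k \<ge> 1 then range (\<lambda>i. e i u) \<union> range (\<lambda>i. f i u) else {}) \<union>
     (if k \<ge> 2 then insert (T u) (range (\<lambda>(i,j). e i (f j u))) else {}) \<union>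
     (if k \<ge> 3 then range (\<lambda>i. e i (T u)) \<union> range (\<lambda>i. f i (T u)) else {}) \<union>
     (if k \<ge> 4 then {T (T u)} else {})"

abbreviation W where "W k \<equiv> mod_span A (gens k)"

text \<open>As \<open>e i\<close> and \<open>f i\<close> have weight 1, the aim is
  \<open>raises k (k + 1)\<close> for \<open>k < 4\<close>, and then
  \<open>raises 4 4\<close>.\<close>

definition raises :: "nat \<Rightarrow> nat \<Rightarrow> bool" where
  "raises k l \<longleftrightarrow> (\<forall>x\<in>W k. \<forall>i. e i x \<in> W l \<and> f i x \<in> W l)"

abbreviation \<delta> :: "'i \<Rightarrow> 'i \<Rightarrow> 'r \<Rightarrow> 'r" where "\<delta> i j x \<equiv> (if i = j then x else 0)"

lemma closed_e: "x \<in> A \<Longrightarrow> e i x \<in> A" and closed_f: "x \<in> A \<Longrightarrow> f i x \<in> A"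
  using derivation_props(1)[OF de] derivation_props(1)[OF df] by auto

lemma closed_diff: "x \<in> A \<Longrightarrow> y \<in> A \<Longrightarrow> x - y \<in> A"
  using add[of x "- y"] minus by simp

lemma closed_T: "x \<in> A \<Longrightarrow> T x \<in> A"
  unfolding T_def by (intro closed_diff closed_e closed_f)

lemma closed_delta: "x \<in> A \<Longrightarrow> \<delta> i j x \<in> A"
  by (simp add: A0)

lemmas closed = closed_e closed_f closed_T closed_delta closed_diff add u

lemma e_diff: "x \<in> A \<Longrightarrow> y \<in> A \<Longrightarrow> e i (x - y) = e i x - e i y"
  and f_diff: "x \<in> A \<Longrightarrow> y \<in> A \<Longrightarrow> f i (x - y) = f i x - f i y"
  and e_add: "x \<in> A \<Longrightarrow> y \<in> A \<Longrightarrow> e i (x + y) = e i x + e i y"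
  and f_add: "x \<in> A \<Longrightarrow> y \<in> A \<Longrightarrow> f i (x + y) = f i x + f i y"
  and e_delta: "e k (\<delta> i j x) = \<delta> i j (e k x)"
  and f_delta: "f k (\<delta> i j x) = \<delta> i j (f k x)"
  using derivation_props[OF de] derivation_props[OF df] derivation_props(4)[OF de one one]
    derivation_props(4)[OF df one one] by auto

lemmas linear_simps = e_diff f_diff e_add f_add e_delta f_delta closed

lemma gens_closed: "gens k \<subseteq> A"
  unfolding gens_def using closed by auto

lemma W_closed: "x \<in> W k \<Longrightarrow> x \<in> A"
  using span_closed gens_closed by blast

lemma gens_mono: "k \<le> l \<Longrightarrow> gens k \<subseteq> gens l"
  unfolding gens_def by auto

lemma W_mono: "x \<in> W k \<Longrightarrow> k \<le> l \<Longrightarrow> x \<in> W l"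
  using span_mono gens_mono by blast

lemma W_delta: "x \<in> W k \<Longrightarrow> \<delta> i j x \<in> W k"
  by (simp add: mod_span.zero)

lemma W_half: "x + x \<in> W k \<Longrightarrow> x \<in> W k"
proof -
  assume "x + x \<in> W k"
  from span_mult[OF half(1) this] have "(half + half) * x \<in> W k" by (simp only: distrib_left distrib_right)
  then show ?thesis by (simp only: half(2) mult_1)
qed

lemma W_third: "x + x + x \<in> W k \<Longrightarrow> x \<in> W k"
proof -
  assume "x + x + x \<in> W k"
  from span_mult[OF third(1) this] have "(third + third + third) * x \<in> W k" by (simp only: distrib_left distrib_right)
  then show ?thesis by (simp only: third(2) mult_1)
qed

lemmas W_intros = span_add span_diff span_minus W_delta

lemma raisesI:
  assumes "\<And>g i. g \<in> gens k \<Longrightarrow> e i g \<in> W l" "\<And>g i. g \<in> gens k \<Longrightarrow> f i g \<in> W l" "k \<le> l"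
  shows "raises k l"
  unfolding raises_def
  using derivation_span[OF de _ gens_closed _ assms(1)] derivation_span[OF df _ gens_closed _ assms(2)]
    gens_mono[OF assms(3)] span_base by blast

lemma raisesD: "raises k l \<Longrightarrow> x \<in> W k \<Longrightarrow> e i x \<in> W l" "raises k l \<Longrightarrow> x \<in> W k \<Longrightarrow> f i x \<in> W l"
  by (auto simp: raises_def)

lemma raises_T: "raises k l \<Longrightarrow> raises l m \<Longrightarrow> x \<in> W k \<Longrightarrow> T x \<in> W m"
  by (subst T_def) (auto intro!: span_diff dest: raisesD)

lemma first_order_span:
  assumes "raises k l" "x \<in> W k" "y \<in> mod_span A (range (\<lambda>i. e i x) \<union> range (\<lambda>i. f i x))"
  shows "y \<in> W l"
  by (rule span_subset[OF _ assms(3)]) (use raisesD[OF assms(1,2)] in auto)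

lemma comm_ef: "raises k l \<Longrightarrow> x \<in> W k \<Longrightarrow> e i (f j x) - f j (e i x) - \<delta> i j (T x) \<in> W l"
  by (rule first_order_span[OF _ _ ef[OF W_closed]])

text \<open>Counting weights would allow one step beyond \<open>m\<close>; the commutator gains one
  weight because it is again an operator of first order, with \<open>T\<close> as its heaviest
  part.\<close>

lemma comm_T:
  assumes "raises k l" "raises l m" "l \<le> m" "x \<in> W k"
  shows "e i (T x) - T (e i x) \<in> W m" "f i (T x) - T (f i x) \<in> W m"
proof -
  have "insert (T x) (range (\<lambda>k. e k x) \<union> range (\<lambda>k. f k x)) \<subseteq> W m"
    using raises_T[OF assms(1,2,4)] raisesD[OF assms(1,4)] W_mono[OF _ assms(3)] by auto
  then show "e i (T x) - T (e i x) \<in> W m" "f i (T x) - T (f i x) \<in> W m"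
    using span_subset eT[OF W_closed[OF assms(4)]] fT[OF W_closed[OF assms(4)]] by blast+
qed

lemma base_u: "u \<in> W k" and base_eu: "k \<ge> 1 \<Longrightarrow> e i u \<in> W k" and base_fu: "k \<ge> 1 \<Longrightarrow> f i u \<in> W k"
  and base_efu: "k \<ge> 2 \<Longrightarrow> e i (f j u) \<in> W k" and base_Tu: "k \<ge> 2 \<Longrightarrow> T u \<in> W k"
  and base_eTu: "k \<ge> 3 \<Longrightarrow> e i (T u) \<in> W k" and base_fTu: "k \<ge> 3 \<Longrightarrow> f i (T u) \<in> W k"
  and base_TTu: "k \<ge> 4 \<Longrightarrow> T (T u) \<in> W k"
  by (auto simp: gens_def intro!: span_base)

lemma gens1: "gens 1 = insert u (range (\<lambda>k. e k u) \<union> range (\<lambda>k. f k u))"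
  by (auto simp: gens_def)

lemma eeu1: "e i (e j u) \<in> W 1" and ffu1: "f i (f j u) \<in> W 1"
  using eeu ffu gens1 by auto

lemma raises01: "raises 0 1"
  by (rule raisesI) (auto simp: gens_def intro!: base_eu base_fu span_base)

lemma raises12: "raises 1 2"
proof (rule raisesI)
  have fe: "f i (e j u) \<in> W 2" for i j
  proof -
    have c: "e j (f i u) - f i (e j u) - \<delta> j i (T u) \<in> W 2"
      using W_mono[OF comm_ef[OF raises01 base_u]] by simp
    have "e j (f i u) - (e j (f i u) - f i (e j u) - \<delta> j i (T u)) - \<delta> j i (T u) \<in> W 2"
      by (intro W_intros c base_efu base_Tu) auto
    then show ?thesis by simp
  qed
  show "e i g \<in> W 2" if "g \<in> gens 1" for g i
    using that W_mono[OF eeu1, of 2] unfolding gens1 by (auto intro: base_eu base_efu)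
  show "f i g \<in> W 2" if "g \<in> gens 1" for g i
    using that W_mono[OF ffu1, of 2] unfolding gens1 by (auto intro: base_fu fe)
qed simp

lemma T_eu: "e i (T u) - T (e i u) \<in> W 2" and T_fu: "f i (T u) - T (f i u) \<in> W 2"
  using comm_T[OF raises01 raises12 _ base_u] by auto

text \<open>Pulling \<open>f j\<close> out to the left past \<open>e i\<close> and
  \<open>e k\<close> leaves \<open>f j (e k (e i u))\<close>, which is of weight 2 by
  \<open>eeu1\<close>; only the commutators contribute in weight 3.\<close>

lemma e_efu: "e k (e i (f j u)) - \<delta> i j (e k (T u)) - \<delta> k j (e i (T u)) \<in> W 2"
proof -
  have x: "e k (e i (f j u) - f j (e i u) - \<delta> i j (T u)) \<in> W 2"
    by (rule raisesD[OF raises12 comm_ef[OF raises01 base_u]])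
  have y: "e k (f j (e i u)) - f j (e k (e i u)) - \<delta> k j (T (e i u)) \<in> W 2"
    by (rule comm_ef[OF raises12 base_eu]) simp
  have z: "f j (e k (e i u)) \<in> W 2" by (rule raisesD(2)[OF raises12 eeu1])
  have "e k (e i (f j u) - f j (e i u) - \<delta> i j (T u)) + (e k (f j (e i u)) - f j (e k (e i u)) - \<delta> k j (T (e i u)))
     + f j (e k (e i u)) - \<delta> k j (e i (T u) - T (e i u)) \<in> W 2"
    by (intro W_intros x y z T_eu)
  then show ?thesis by (simp add: linear_simps split: if_splits)
qed

text \<open>Here \<open>e i\<close> is pulled out to the left of \<open>f k\<close>, and
  \<open>e i (f k (f j u))\<close> drops to weight 2 by \<open>ffu1\<close>.\<close>

lemma f_efu: "f k (e i (f j u)) + \<delta> i k (f j (T u)) \<in> W 2"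
proof -
  have y: "e i (f k (f j u)) - f k (e i (f j u)) - \<delta> i k (T (f j u)) \<in> W 2"
    by (rule comm_ef[OF raises12 base_fu]) simp
  have z: "e i (f k (f j u)) \<in> W 2" by (rule raisesD(1)[OF raises12 ffu1])
  have "e i (f k (f j u)) - (e i (f k (f j u)) - f k (e i (f j u)) - \<delta> i k (T (f j u)))
     + \<delta> i k (f j (T u) - T (f j u)) \<in> W 2"
    by (intro W_intros y z T_fu)
  then show ?thesis by (simp add: algebra_simps split: if_splits)
qed

lemma raises23: "raises 2 3"
proof (rule raisesI)
  have g: "gens 2 = gens 1 \<union> insert (T u) (range (\<lambda>(i,j). e i (f j u)))"
    by (auto simp: gens_def)
  have eef: "e k (e i (f j u)) \<in> W 3" for k i j
  proof -
    have "(e k (e i (f j u)) - \<delta> i j (e k (T u)) - \<delta> k j (e i (T u))) + \<delta> i j (e k (T u)) + \<delta> k j (e i (T u)) \<in> W 3"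
      by (intro W_intros W_mono[OF e_efu] base_eTu) auto
    then show ?thesis by (simp add: algebra_simps)
  qed
  have fef: "f k (e i (f j u)) \<in> W 3" for k i j
  proof -
    have "(f k (e i (f j u)) + \<delta> i k (f j (T u))) - \<delta> i k (f j (T u)) \<in> W 3"
      by (intro W_intros W_mono[OF f_efu] base_fTu) auto
    then show ?thesis by (simp only: add_diff_cancel_right')
  qed
  show "e i x \<in> W 3" if "x \<in> gens 2" for x i
    using that W_mono[OF raisesD(1)[OF raises12 span_base], of x 3 i] eef base_eTu by (auto simp: g)
  show "f i x \<in> W 3" if "x \<in> gens 2" for x i
    using that W_mono[OF raisesD(2)[OF raises12 span_base], of x 3 i] fef base_fTu by (auto simp: g)
qed simp

text \<open>Pulling \<open>T\<close> out to the left leaves \<open>T (e k (e i u))\<close>, and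
  \<open>e k (e i u)\<close> has weight 1 instead of 2.\<close>

lemma eeTu: "e k (e i (T u)) \<in> W 3"
proof -
  have "e k (e i (T u) - T (e i u)) + (e k (T (e i u)) - T (e k (e i u))) + T (e k (e i u)) \<in> W 3"
    using base_eu[of 1]
    by (intro W_intros raisesD(1)[OF raises23 T_eu] comm_T(1)[OF raises12 raises23]
        raises_T[OF raises12 raises23 eeu1]) auto
  then show ?thesis by (simp add: linear_simps)
qed

lemma ffTu: "f k (f i (T u)) \<in> W 3"
proof -
  have "f k (f i (T u) - T (f i u)) + (f k (T (f i u)) - T (f k (f i u))) + T (f k (f i u)) \<in> W 3"
    using base_fu[of 1]
    by (intro W_intros raisesD(2)[OF raises23 T_fu] comm_T(2)[OF raises12 raises23]
        raises_T[OF raises12 raises23 ffu1]) auto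
  then show ?thesis by (simp add: linear_simps)
qed

lemma efTu: "e k (f i (T u)) - f i (e k (T u)) - \<delta> k i (T (T u)) \<in> W 3"
  by (rule comm_ef[OF raises23 base_Tu]) simp

text \<open>The key relation, from the two ways of computing \<open>f i (e l (e l (f l u)))\<close>.\<close>

lemma feTu_double: "(f i (e l (T u)) + f i (e l (T u))) + \<delta> l i (e l (f l (T u)) + T (e l (f l u))) \<in> W 3"
proof -
  let ?a = "e l (f l u)"
  have 1: "f i (e l ?a - e l (T u) - e l (T u)) \<in> W 3"
    using raisesD(2)[OF raises23 e_efu[of l l l]] by simp
  have 2: "e l (f i ?a) - f i (e l ?a) - \<delta> l i (T ?a) \<in> W 3"
    by (rule comm_ef[OF raises23 base_efu]) simp
  have 3: "e l (f i ?a + \<delta> l i (f l (T u))) \<in> W 3"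
    by (rule raisesD(1)[OF raises23 f_efu])
  have "e l (f i ?a + \<delta> l i (f l (T u))) - (e l (f i ?a) - f i (e l ?a) - \<delta> l i (T ?a))
      - f i (e l ?a - e l (T u) - e l (T u)) \<in> W 3"
    by (intro W_intros 1 2 3)
  then show ?thesis
    by (simp only: linear_simps) (simp add: algebra_simps split: if_splits)
qed

lemma feTu_ne: "i \<noteq> l \<Longrightarrow> f i (e l (T u)) \<in> W 3"
  using feTu_double[of i l] by (auto intro!: W_half[of "f i (e l (T u))"])

text \<open>On the diagonal \<open>e l (f l (T u))\<close> and \<open>T (e l (f l u))\<close> agree
  modulo weight 3, and both equal \<open>f l (e l (T u)) + T (T u)\<close>; substitution in
  \<open>feTu_double\<close> gives twice the claim.\<close>

lemma feTu_eq: "f l (e l (T u)) + f l (e l (T u)) + T (T u) \<in> W 3"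
proof (rule W_half)
  let ?x = "f l (e l (T u))" and ?y = "e l (f l (T u))" and ?a = "e l (f l u)"
  have 1: "?x + ?x + (?y + T ?a) \<in> W 3" using feTu_double[of l l] by simp
  have 2: "e l (T (f l u)) - T ?a \<in> W 3"
    using base_fu[of 1] by (intro comm_T(1)[OF raises12 raises23]) auto
  have 3: "e l (f l (T u) - T (f l u)) \<in> W 3" by (rule raisesD(1)[OF raises23 T_fu])
  have 4: "?y - ?x - T (T u) \<in> W 3" using efTu[of l l] by simp
  have "(?x + ?x + (?y + T ?a)) + (e l (T (f l u)) - T ?a) + e l (f l (T u) - T (f l u))
     - (?y - ?x - T (T u)) - (?y - ?x - T (T u)) \<in> W 3"
    by (intro W_intros 1 2 3 4)
  then show "?x + ?x + T (T u) + (?x + ?x + T (T u)) \<in> W 3"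
    by (simp only: linear_simps) (simp add: algebra_simps)
qed

lemma raises34: "raises 3 4"
proof (rule raisesI)
  have g: "gens 3 = gens 2 \<union> (range (\<lambda>i. e i (T u)) \<union> range (\<lambda>i. f i (T u)))"
    by (auto simp: gens_def)
  have fe: "f i (e l (T u)) \<in> W 4" for i l
  proof (cases "i = l")
    case True
    have "(f l (e l (T u)) + f l (e l (T u)) + T (T u)) - T (T u) \<in> W 4"
      by (intro W_intros W_mono[OF feTu_eq] base_TTu) auto
    then show ?thesis using True W_half[of "f l (e l (T u))"] by simp
  qed (use W_mono[OF feTu_ne] in auto)
  have ef: "e k (f i (T u)) \<in> W 4" for k i
  proof -
    have "(e k (f i (T u)) - f i (e k (T u)) - \<delta> k i (T (T u))) + f i (e k (T u)) + \<delta> k i (T (T u)) \<in> W 4"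
      by (intro W_intros W_mono[OF efTu] fe base_TTu) auto
    then show ?thesis by (simp add: algebra_simps)
  qed
  show "e i x \<in> W 4" if "x \<in> gens 3" for x i
    using that W_mono[OF raisesD(1)[OF raises23 span_base], of x 4 i] ef W_mono[OF eeTu] by (auto simp: g)
  show "f i x \<in> W 4" if "x \<in> gens 3" for x i
    using that W_mono[OF raisesD(2)[OF raises23 span_base], of x 4 i] fe W_mono[OF ffTu] by (auto simp: g)
qed simp

lemma T_eTu: "e k (T (T u)) - T (e k (T u)) \<in> W 4" and T_fTu: "f k (T (T u)) - T (f k (T u)) \<in> W 4"
  using comm_T[OF raises23 raises34 _ base_Tu] by auto

text \<open>Apply \<open>e k\<close> to \<open>feTu_eq\<close>. Modulo weight 4,
  \<open>e k (f k (e k (T u)))\<close> is \<open>T (e k (T u))\<close>, because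
  \<open>e k (e k (T u))\<close> has only weight 3, and this is \<open>e k (T (T u))\<close>. The
  multiplicities add up to 3.\<close>

lemma eTTu: "e k (T (T u)) \<in> W 4"
proof (rule W_third)
  let ?x = "f k (e k (T u))" and ?t = "e k (T (T u))"
  have 1: "e k (?x + ?x + T (T u)) \<in> W 4" by (rule raisesD(1)[OF raises34 feTu_eq])
  have 2: "e k ?x - f k (e k (e k (T u))) - T (e k (T u)) \<in> W 4"
    using comm_ef[OF raises34 base_eTu, where j=k and i=k] by simp
  have 3: "f k (e k (e k (T u))) \<in> W 4" by (rule raisesD(2)[OF raises34 eeTu])
  let ?b = "(e k ?x - f k (e k (e k (T u))) - T (e k (T u))) + f k (e k (e k (T u))) - (?t - T (e k (T u)))"
  have "e k (?x + ?x + T (T u)) - ?b - ?b \<in> W 4"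
    by (intro W_intros 1 2 3 T_eTu)
  then show "?t + ?t + ?t \<in> W 4" by (simp only: linear_simps) (simp add: algebra_simps)
qed

text \<open>As for \<open>eTTu\<close>, but the low function is now \<open>f k (f k (T u))\<close>,
  so \<open>f k (e k (T u))\<close> is first rewritten as \<open>e k (f k (T u)) - T (T u)\<close>;
  the total multiplicity is -3.\<close>

lemma fTTu: "f k (T (T u)) \<in> W 4"
proof (rule W_third)
  let ?x = "f k (e k (T u))" and ?y = "e k (f k (T u))" and ?t = "f k (T (T u))"
  have 1: "f k (?x + ?x + T (T u)) \<in> W 4" by (rule raisesD(2)[OF raises34 feTu_eq])
  have 2: "f k (?y - ?x - T (T u)) \<in> W 4" using raisesD(2)[OF raises34 efTu[of k k]] by simp
  have 3: "e k (f k (f k (T u))) - f k ?y - T (f k (T u)) \<in> W 4"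
    using comm_ef[OF raises34 base_fTu, where j=k and i=k] by simp
  have 4: "e k (f k (f k (T u))) \<in> W 4" by (rule raisesD(1)[OF raises34 ffTu])
  let ?b = "f k (?y - ?x - T (T u)) + (e k (f k (f k (T u))) - f k ?y - T (f k (T u)))
    - e k (f k (f k (T u))) - (?t - T (f k (T u)))"
  have "- (f k (?x + ?x + T (T u)) + ?b + ?b) \<in> W 4"
    by (intro W_intros 1 2 3 4 T_fTu)
  then show "?t + ?t + ?t \<in> W 4" by (simp only: linear_simps) (simp add: algebra_simps)
qed

lemma raises44: "raises 4 4"
proof (rule raisesI)
  have g: "gens 4 = insert (T (T u)) (gens 3)" by (auto simp: gens_def)
  show "e i x \<in> W 4" "f i x \<in> W 4" if "x \<in> gens 4" for x i
    using that raisesD[OF raises34 span_base, of x i] eTTu fTTu by (auto simp: g)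
qed simp

theorem prolongation_closes:
  assumes "x \<in> W 4"
  shows "e i x \<in> W 4" "f i x \<in> W 4" "T x \<in> W 4"
  using raisesD[OF raises44 assms] raises_T[OF raises44 raises44 assms] by auto

end

section \<open>Unique continuation and contact frames\<close>

text \<open>With \<open>F\<close> the sum of squares, the bound gives \<open>F' \<le> K * F\<close>,
  so \<open>F t * exp (- K * t)\<close> cannot increase from its initial value 0.\<close>

lemma gronwall_zero:
  fixes h h' :: "'i \<Rightarrow> real \<Rightarrow> real"
  assumes I: "finite I"
    and d: "\<And>i t. i \<in> I \<Longrightarrow> 0 \<le> t \<Longrightarrow> t \<le> 1 \<Longrightarrow> (h i has_real_derivative h' i t) (at t)"
    and b: "\<And>i t. i \<in> I \<Longrightarrow> 0 \<le> t \<Longrightarrow> t \<le> 1 \<Longrightarrow> \<bar>h' i t\<bar> \<le> C * (\<Sum>j\<in>I. \<bar>h j t\<bar>)"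
    and z: "\<And>i. i \<in> I \<Longrightarrow> h i 0 = 0" and i: "i \<in> I"
  shows "h i 1 = 0"
proof -
  define F where "F t = (\<Sum>i\<in>I. (h i t)\<^sup>2)" for t
  \<comment> \<open>2 from the derivative of a square, \<open>card I\<close> from the Cauchy-Schwarz
    estimate of the squared sum.\<close>
  define K where "K = 2 * C * card I"
  have "\<exists>y. ((\<lambda>t. F t * exp (- K * t)) has_real_derivative y) (at t) \<and> y \<le> 0" if t: "0 \<le> t" "t \<le> 1" for t
  proof -
    let ?F' = "\<Sum>i\<in>I. 2 * h i t * h' i t"
    have "((\<lambda>t. F t * exp (- K * t)) has_real_derivative (?F' - K * F t) * exp (- K * t)) (at t)"
      unfolding F_def by (auto intro!: derivative_eq_intros d t simp: algebra_simps sum_distrib_left sum_subtractf)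
    moreover have "?F' \<le> K * F t"
    proof -
      let ?S = "\<Sum>j\<in>I. \<bar>h j t\<bar>"
      have "?F' \<le> (\<Sum>i\<in>I. 2 * \<bar>h i t\<bar> * (C * ?S))"
      proof (rule sum_mono)
        fix i assume "i \<in> I"
        have "2 * h i t * h' i t \<le> \<bar>2 * h i t * h' i t\<bar>" by simp
        also have "\<dots> = 2 * \<bar>h i t\<bar> * \<bar>h' i t\<bar>" by (simp add: abs_mult)
        also have "\<dots> \<le> 2 * \<bar>h i t\<bar> * (C * ?S)" by (intro mult_left_mono b t \<open>i \<in> I\<close>) auto
        finally show "2 * h i t * h' i t \<le> 2 * \<bar>h i t\<bar> * (C * ?S)" .
      qed
      also have "\<dots> = 2 * (C * ?S\<^sup>2)"
        by (simp add: sum_distrib_left[symmetric] sum_distrib_right[symmetric] power2_eq_square mult.assoc mult.left_commute)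
      also have "\<dots> \<le> 2 * (C * (card I * F t))"
      proof (cases "C \<ge> 0")
        case True
        have "?S\<^sup>2 \<le> (\<Sum>j\<in>I. \<bar>h j t\<bar>\<^sup>2) * card I"
          using sum_squared_le_sum_of_squares[of "\<lambda>j. \<bar>h j t\<bar>" I] by simp
        then show ?thesis using True by (intro mult_left_mono) (auto simp: F_def mult.commute)
      next
        \<comment> \<open>A negative \<open>C\<close> is compatible with the bound only if all the
          functions vanish at \<open>t\<close>.\<close>
        case False
        have "0 \<le> \<bar>h' i t\<bar>" by simp
        then have "0 \<le> C * ?S" using b[OF i t] by linarith
        moreover have "?S \<ge> 0" by (simp add: sum_nonneg)
        ultimately have "?S = 0" using False by (simp add: zero_le_mult_iff)
        then have "\<forall>j\<in>I. h j t = 0" using I by (simp add: sum_nonneg_eq_0_iff)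
        then have "F t = 0" by (simp add: F_def)
        then show ?thesis using \<open>?S = 0\<close> by simp
      qed
      finally show ?thesis by (simp add: K_def mult.assoc)
    qed
    ultimately show ?thesis by (intro exI conjI) (auto simp: mult_le_0_iff)
  qed
  from DERIV_nonpos_imp_nonincreasing[of 0 1, OF _ this]
  have "F 1 * exp (- K) \<le> F 0" by auto
  moreover have "F 0 = 0" using z by (simp add: F_def)
  ultimately have "F 1 \<le> 0" by (simp add: mult_le_0_iff)
  moreover have "F 1 \<ge> 0" by (simp add: F_def sum_nonneg)
  ultimately show ?thesis using I i by (simp add: F_def sum_nonneg_eq_0_iff)
qed

text \<open>The coefficients are continuous, hence bounded near \<open>x\<close>; this turns
  membership in the module into the growth estimate for \<open>gronwall_zero\<close>.\<close>

lemma mod_span_bound: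
  assumes "h \<in> mod_span {a. smooth_map_on N a} G" "finite G" "x \<in> N"
  shows "\<exists>W C. open W \<and> x \<in> W \<and> (\<forall>y\<in>N \<inter> W. \<bar>h y\<bar> \<le> C * (\<Sum>g\<in>G. \<bar>g y :: real\<bar>))"
  using assms(1)
proof (induction rule: mod_span.induct)
  case zero
  show ?case by (intro exI[of _ UNIV] exI[of _ 0]) auto
next
  case (step a g h)
  then obtain W C where W: "open W" "x \<in> W" "\<forall>y\<in>N \<inter> W. \<bar>h y\<bar> \<le> C * (\<Sum>g\<in>G. \<bar>g y\<bar>)" by blast
  have "continuous_on N a" using step smooth_map_on_continuous_on by blast
  then obtain d where d: "d > 0" "\<And>y. y \<in> N \<Longrightarrow> dist y x < d \<Longrightarrow> dist (a y) (a x) < 1"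
    using assms(3) unfolding continuous_on_iff by (metis zero_less_one)
  show ?case
  proof (intro exI[of _ "W \<inter> ball x d"] exI[of _ "\<bar>a x\<bar> + 1 + C"] conjI ballI)
    fix y assume y: "y \<in> N \<inter> (W \<inter> ball x d)"
    let ?S = "\<Sum>g\<in>G. \<bar>g y\<bar>"
    have "\<bar>a y\<bar> \<le> \<bar>a x\<bar> + 1" using d(2)[of y] y by (auto simp: dist_real_def dist_commute)
    moreover have "\<bar>g y\<bar> \<le> ?S" using assms(2) step(2) member_le_sum[of g G "\<lambda>g. \<bar>g y\<bar>"] by auto
    ultimately have "\<bar>a y\<bar> * \<bar>g y\<bar> \<le> (\<bar>a x\<bar> + 1) * ?S" by (intro mult_mono) auto
    moreover have "\<bar>h y\<bar> \<le> C * ?S" using W y by auto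
    moreover have "\<bar>(a * g + h) y\<bar> \<le> \<bar>a y\<bar> * \<bar>g y\<bar> + \<bar>h y\<bar>"
      using abs_triangle_ineq[of "a y * g y" "h y"] by (simp add: abs_mult)
    ultimately show "\<bar>(a * g + h) y\<bar> \<le> (\<bar>a x\<bar> + 1 + C) * ?S" by (simp add: algebra_simps)
  qed (use W d in auto)
qed

lemma tangent_field_Int: "open U \<Longrightarrow> tangent_field M X \<Longrightarrow> tangent_field (M \<inter> U) X"
  using smooth_map_on_subset[of M X "M \<inter> U"] tangent_space_Int[of U _ M] by (auto simp: tangent_field_def)

text \<open>The constant field \<open>b\<close> of the flat model carried to \<open>N\<close>;
  finitely many of these span the directions of all segments in the chart.\<close>

lemma chart_field:
  assumes c: "chart N U V \<Phi> \<Psi> S" and b: "b \<in> S"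
  shows "tangent_field (N \<inter> U) (\<lambda>x. frechet_derivative \<Psi> (at (\<Phi> x)) b)"
proof -
  have o: "open U" "open V" "smooth_on U \<Phi>" "smooth_on V \<Psi>" "\<Phi> ` U = V" "\<Phi> ` (U \<inter> N) = V \<inter> S"
    "\<And>x. x \<in> U \<Longrightarrow> \<Psi> (\<Phi> x) = x"
    using c by (auto simp: chart_def)
  have "smooth_on U (\<lambda>x. frechet_derivative \<Psi> (at (\<Phi> x)) b)"
    by (rule smooth_on_compose[OF o(1,2) _ smooth_on_derivative[OF o(4)] o(3)]) (use o(5) in auto)
  then have "smooth_map_on (N \<inter> U) (\<lambda>x. frechet_derivative \<Psi> (at (\<Phi> x)) b)"
    by (rule smooth_on_imp_smooth_map_on[OF _ o(1)]) simp
  moreover have "frechet_derivative \<Psi> (at (\<Phi> x)) b \<in> tangent_space (N \<inter> U) x" if "x \<in> N \<inter> U" for x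
    using chart_tangentI[OF c _ _ b, of "\<Phi> x"] that o tangent_space_Int[OF o(1), of x N] by auto
  ultimately show ?thesis by (simp add: tangent_field_def)
qed

text \<open>Points near \<open>p\<close> are joined to \<open>p\<close> by segments in a chart, along which the functions in
  \<open>G\<close> solve a homogeneous linear system of ordinary differential equations.\<close>

lemma unique_continuation:
  fixes N :: "'a::euclidean_space set" and G :: "('a \<Rightarrow> real) set"
  assumes N: "submanifold k N" and p: "p \<in> N" and G: "finite G" "\<And>g. g \<in> G \<Longrightarrow> smooth_map_on N g"
    and z: "\<And>g. g \<in> G \<Longrightarrow> g p = 0"
    and closed: "\<And>U Y g. open U \<Longrightarrow> tangent_field (N \<inter> U) Y \<Longrightarrow> g \<in> G \<Longrightarrow>
      along (N \<inter> U) Y g \<in> mod_span {a. smooth_map_on (N \<inter> U) a} G"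
  shows "\<exists>W. open W \<and> p \<in> W \<and> (\<forall>x\<in>N \<inter> W. \<forall>g\<in>G. g x = 0)"
proof -
  obtain U V \<Phi> \<Psi> S where c: "chart N U V \<Phi> \<Psi> S" and pU: "p \<in> U" using submanifold_chart[OF N p] .
  have o: "open U" "open V" "smooth_on U \<Phi>" "smooth_on V \<Psi>" "subspace S" "\<Phi> ` U = V" "\<Phi> ` (U \<inter> N) = V \<inter> S"
    "\<And>x. x \<in> U \<Longrightarrow> \<Psi> (\<Phi> x) = x"
    using c by (auto simp: chart_def)
  obtain B where B: "B \<subseteq> S" "independent B" "S \<subseteq> span B" using basis_exists by metis
  have finB: "finite B" using B(2) independent_imp_finite by blast
  define Y where "Y b x = frechet_derivative \<Psi> (at (\<Phi> x)) b" for b x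
  have Y: "tangent_field (N \<inter> U) (Y b)" if "b \<in> S" for b unfolding Y_def by (rule chart_field[OF c that])
  have pN: "p \<in> N \<inter> U" using p pU by simp
  have "\<exists>W C. open W \<and> p \<in> W \<and> (\<forall>y\<in>N \<inter> U \<inter> W. \<bar>along (N \<inter> U) (Y b) g y\<bar> \<le> C * (\<Sum>g\<in>G. \<bar>g y\<bar>))"
    if "b \<in> B" "g \<in> G" for b g
    by (rule mod_span_bound[OF closed[OF o(1) Y that(2)] G(1) pN]) (use that B in auto)
  then obtain W0 C0 where WC: "\<And>b g. b \<in> B \<Longrightarrow> g \<in> G \<Longrightarrow> open (W0 b g) \<and> p \<in> W0 b g \<and>
      (\<forall>y\<in>N \<inter> U \<inter> W0 b g. \<bar>along (N \<inter> U) (Y b) g y\<bar> \<le> C0 b g * (\<Sum>g\<in>G. \<bar>g y\<bar>))"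
    by metis
  \<comment> \<open>One neighbourhood and one constant for all the finitely many pairs of a
    direction and a function.\<close>
  define W1 where "W1 = (\<Inter>b\<in>B. \<Inter>g\<in>G. W0 b g) \<inter> U"
  define C1 where "C1 = (\<Sum>b\<in>B. \<Sum>g\<in>G. \<bar>C0 b g\<bar>)"
  have W1: "open W1" "p \<in> W1" unfolding W1_def using WC finB G(1) o(1) pU by (auto intro!: open_INT)
  have bd: "\<bar>along (N \<inter> U) (Y b) g y\<bar> \<le> C1 * (\<Sum>g\<in>G. \<bar>g y\<bar>)" if "b \<in> B" "g \<in> G" "y \<in> N \<inter> W1" for b g y
  proof -
    have "\<bar>along (N \<inter> U) (Y b) g y\<bar> \<le> C0 b g * (\<Sum>g\<in>G. \<bar>g y\<bar>)" using WC[OF that(1,2)] that by (auto simp: W1_def)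
    also have "\<dots> \<le> C1 * (\<Sum>g\<in>G. \<bar>g y\<bar>)"
    proof (rule mult_right_mono)
      have "C0 b g \<le> \<bar>C0 b g\<bar>" by simp
      also have "\<dots> \<le> (\<Sum>g\<in>G. \<bar>C0 b g\<bar>)" using that G(1) by (intro member_le_sum) auto
      also have "\<dots> \<le> C1" unfolding C1_def using that finB
        by (intro member_le_sum[of b B "\<lambda>b. \<Sum>g\<in>G. \<bar>C0 b g\<bar>"]) (auto intro: sum_nonneg)
      finally show "C0 b g \<le> C1" .
    qed (simp add: sum_nonneg)
    finally show ?thesis .
  qed
  have "open (V \<inter> \<Psi> -` W1)"
    by (rule continuous_open_preimage[OF smooth_on_continuous_on[OF o(4)] o(2) W1(1)])
  moreover have "\<Phi> p \<in> V \<inter> \<Psi> -` W1" using W1(2) o(6,8) pU by auto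
  ultimately obtain r where r: "r > 0" "ball (\<Phi> p) r \<subseteq> V \<inter> \<Psi> -` W1" by (meson openE)
  define W where "W = U \<inter> \<Phi> -` ball (\<Phi> p) r"
  have "open W" unfolding W_def
    by (rule continuous_open_preimage[OF smooth_on_continuous_on[OF o(3)] o(1)]) simp
  moreover have "p \<in> W" using pU r by (simp add: W_def)
  moreover have "g x = 0" if x: "x \<in> N \<inter> W" and g: "g \<in> G" for x g
  proof -
    define s where "s = \<Phi> x - \<Phi> p"
    have pS: "\<Phi> p \<in> S" "\<Phi> x \<in> S" using o(7) pU p x by (auto simp: W_def)
    then have sS: "s \<in> S" unfolding s_def using o(5) by (simp add: subspace_diff)
    define y where "y t = \<Phi> p + t *\<^sub>R s" for t
    have ball: "y t \<in> ball (\<Phi> p) r" if "0 \<le> t" "t \<le> 1" for t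
    proof -
      have "dist (\<Phi> p) (y t) = \<bar>t\<bar> * norm s" by (simp add: y_def dist_norm)
      also have "\<dots> \<le> 1 * norm s" using that by (intro mult_right_mono) auto
      also have "\<dots> < r" using x by (auto simp: W_def s_def dist_norm norm_minus_commute)
      finally show ?thesis by simp
    qed
    have yS: "y t \<in> S" for t unfolding y_def using pS sS o(5) by (simp add: subspace_add subspace_scale)
    have yV: "y t \<in> V" and \<Psi>W: "\<Psi> (y t) \<in> W1" if "0 \<le> t" "t \<le> 1" for t using ball[OF that] r by auto
    have \<Psi>N: "\<Psi> (y t) \<in> N \<inter> U" "\<Phi> (\<Psi> (y t)) = y t" if "0 \<le> t" "t \<le> 1" for t
      using chart_segment[OF c yV[OF that] yS] by auto
    obtain q where q: "s = (\<Sum>b\<in>B. q b *\<^sub>R b)"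
      using sS B(3) span_finite[OF finB] by (auto simp: image_def)
    have deriv: "((\<lambda>t. g (\<Psi> (y t))) has_real_derivative (\<Sum>b\<in>B. q b * along (N \<inter> U) (Y b) g (\<Psi> (y t)))) (at t)"
      if g: "g \<in> G" and t: "0 \<le> t" "t \<le> 1" for g t
    proof -
      have d: "(\<Psi> has_derivative frechet_derivative \<Psi> (at (y t))) (at (y t))"
        by (rule smooth_on_has_derivative[OF o(4,2) yV[OF t]])
      have l: "linear (frechet_derivative \<Psi> (at (y t)))" using d has_derivative_linear by blast
      \<comment> \<open>\<open>curve_has_derivative\<close> differentiates at parameter 0, so time
        is shifted by \<open>t\<close> here and shifted back at the end.\<close>
      have "((\<lambda>\<tau>. y (t + \<tau>)) has_vector_derivative s) (at 0)"
        unfolding y_def by (auto intro!: derivative_eq_intros)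
      then have cur: "((\<lambda>\<tau>. \<Psi> (y (t + \<tau>))) has_vector_derivative frechet_derivative \<Psi> (at (y t)) s) (at 0)"
        by (intro curve_has_derivative[where e=1 and M=UNIV and p="y t" and f=\<Psi> and v=s] d) auto
      have "continuous_on UNIV (\<lambda>\<tau>. y (t + \<tau>))" unfolding y_def by (intro continuous_intros)
      then have "open ((\<lambda>\<tau>. y (t + \<tau>)) -` V)" using o(2) by (simp add: open_vimage)
      moreover have "0 \<in> (\<lambda>\<tau>. y (t + \<tau>)) -` V" using yV[OF t] by simp
      ultimately obtain \<epsilon> where \<epsilon>: "\<epsilon> > 0" "ball 0 \<epsilon> \<subseteq> (\<lambda>\<tau>. y (t + \<tau>)) -` V" by (meson openE)
      have inN: "\<Psi> (y (t + \<tau>)) \<in> N \<inter> U" if "\<tau> \<in> {-\<epsilon><..<\<epsilon>}" for \<tau>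
      proof -
        have "y (t + \<tau>) \<in> V" using \<epsilon> that by (auto simp: subset_eq dist_real_def)
        then show ?thesis using chart_segment[OF c _ yS] by auto
      qed
      have gs: "smooth_map_on (N \<inter> U) g" by (rule smooth_map_on_subset[OF G(2)[OF g]]) simp
      have "((\<lambda>\<tau>. g (\<Psi> (y (t + \<tau>)))) has_vector_derivative
          mderiv (N \<inter> U) g (\<Psi> (y t)) (frechet_derivative \<Psi> (at (y t)) s)) (at 0)"
        by (rule curve_has_derivative[OF smooth_map_on_has_derivative[OF gs \<Psi>N(1)[OF t]] \<epsilon>(1) inN _ cur]) auto
      moreover have "mderiv (N \<inter> U) g (\<Psi> (y t)) (frechet_derivative \<Psi> (at (y t)) s) =
          (\<Sum>b\<in>B. q b * along (N \<inter> U) (Y b) g (\<Psi> (y t)))"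
      proof -
        have m: "linear (mderiv (N \<inter> U) g (\<Psi> (y t)))" by (rule mderiv_linear[OF gs \<Psi>N(1)[OF t]])
        show ?thesis
          using \<Psi>N[OF t] unfolding q
          by (simp add: linear_sum[OF l] linear_scale[OF l] linear_sum[OF m] linear_scale[OF m] along_def Y_def)
      qed
      ultimately have "((\<lambda>\<tau>. g (\<Psi> (y (t + \<tau>)))) has_real_derivative (\<Sum>b\<in>B. q b * along (N \<inter> U) (Y b) g (\<Psi> (y t)))) (at 0)"
        by (simp add: has_real_derivative_iff_has_vector_derivative)
      then show ?thesis
        using DERIV_shift[of "\<lambda>t. g (\<Psi> (y t))" _ 0 t] by (simp add: add.commute)
    qed
    have bound: "\<bar>\<Sum>b\<in>B. q b * along (N \<inter> U) (Y b) g (\<Psi> (y t))\<bar> \<le> ((\<Sum>b\<in>B. \<bar>q b\<bar>) * C1) * (\<Sum>g\<in>G. \<bar>g (\<Psi> (y t))\<bar>)"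
      if g: "g \<in> G" and t: "0 \<le> t" "t \<le> 1" for g t
    proof -
      have in1: "\<Psi> (y t) \<in> N \<inter> W1" using \<Psi>N[OF t] \<Psi>W[OF t] by auto
      have "\<bar>\<Sum>b\<in>B. q b * along (N \<inter> U) (Y b) g (\<Psi> (y t))\<bar> \<le> (\<Sum>b\<in>B. \<bar>q b\<bar> * \<bar>along (N \<inter> U) (Y b) g (\<Psi> (y t))\<bar>)"
        by (rule order_trans[OF sum_abs]) (simp add: abs_mult)
      also have "\<dots> \<le> (\<Sum>b\<in>B. \<bar>q b\<bar> * (C1 * (\<Sum>g\<in>G. \<bar>g (\<Psi> (y t))\<bar>)))"
        by (intro sum_mono mult_left_mono bd g in1) auto
      finally show ?thesis by (simp add: sum_distrib_right mult.assoc)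
    qed
    have "g (\<Psi> (y 1)) = 0"
      by (rule gronwall_zero[where h="\<lambda>g t. g (\<Psi> (y t))" and i=g, OF G(1) deriv bound])
        (use z pU o(8) g in \<open>auto simp: y_def\<close>)
    then show ?thesis using x o(8) by (simp add: y_def s_def W_def)
  qed
  ultimately show ?thesis by blast
qed

text \<open>Along a tangent field the coordinate function \<open>x \<bullet> b\<close>
  differentiates to the component in direction \<open>b\<close>; brackets can thus be compared as
  commutators of derivations.\<close>

lemma lie_bracket_along:
  assumes N: "submanifold k N" and X: "tangent_field N X" and Y: "tangent_field N Y" and p: "p \<in> N"
  shows "lie_bracket N X Y p \<bullet> b = along N X (along N Y (\<lambda>x. x \<bullet> b)) p - along N Y (along N X (\<lambda>x. x \<bullet> b)) p"
proof -
  have "smooth_map_on N (\<lambda>x. x \<bullet> b)"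
    by (rule smooth_map_on_linear[OF bounded_linear_inner_left smooth_map_on_ident])
  from along_lie_bracket[OF N this X Y]
  have "along N (lie_bracket N X Y) (\<lambda>x. x \<bullet> b) p = along N X (along N Y (\<lambda>x. x \<bullet> b)) p - along N Y (along N X (\<lambda>x. x \<bullet> b)) p" .
  moreover have "along N (lie_bracket N X Y) (\<lambda>x. x \<bullet> b) p = lie_bracket N X Y p \<bullet> b"
    using p mderiv_eq[OF has_derivative_inner_left[OF has_derivative_ident] tangent_fieldD(2)[OF tangent_field_lie_bracket[OF N X Y] p]]
    by (simp add: along_def)
  ultimately show ?thesis by simp
qed

lemma along_diff:
  assumes "tangent_field N X" "smooth_map_on N g" "smooth_map_on N h"
  shows "along N X (\<lambda>x. g x - h x) p = along N X g p - along N X h p"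
proof (cases "p \<in> N")
  case True
  then show ?thesis
    using mderiv_eq[OF has_derivative_diff[OF smooth_map_on_has_derivative[OF assms(2)] smooth_map_on_has_derivative[OF assms(3)]]]
      tangent_fieldD(2)[OF assms(1)] by (simp add: along_def)
qed (simp add: along_def)

lemma along_uminus:
  assumes "tangent_field N X" "smooth_map_on N h"
  shows "along N X (\<lambda>x. - h x) p = - along N X h p"
proof (cases "p \<in> N")
  case True
  then show ?thesis
    using mderiv_eq[OF has_derivative_minus[OF smooth_map_on_has_derivative[OF assms(2)]]]
      tangent_fieldD(2)[OF assms(1)] by (simp add: along_def)
qed (simp add: along_def)

text \<open>Tested on coordinate functions, where it is the formal identity for commutators of
  operators.\<close>

lemma jacobi:
  assumes N: "submanifold k N" and X: "tangent_field N X" and Y: "tangent_field N Y" and Z: "tangent_field N Z" and p: "p \<in> N"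
  shows "lie_bracket N (lie_bracket N X Y) Z p + lie_bracket N Y (lie_bracket N X Z) p =
    lie_bracket N X (lie_bracket N Y Z) p"
proof (rule euclidean_eqI)
  fix b :: 'a
  let ?h = "\<lambda>x::'a. x \<bullet> b"
  note B = tangent_field_lie_bracket[OF N]
  have h: "smooth_map_on N ?h"
    by (rule smooth_map_on_linear[OF bounded_linear_inner_left smooth_map_on_ident])
  have a: "smooth_map_on N (along N V g)" if "smooth_map_on N g" "tangent_field N V" for V g
    using smooth_map_on_along that by blast
  have ex: "along N (lie_bracket N V W) g = (\<lambda>p. along N V (along N W g) p - along N W (along N V g) p)"
    if "smooth_map_on N g" "tangent_field N V" "tangent_field N W" for V W g
    using along_lie_bracket[OF N that] by blast
  show "(lie_bracket N (lie_bracket N X Y) Z p + lie_bracket N Y (lie_bracket N X Z) p) \<bullet> b =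
    lie_bracket N X (lie_bracket N Y Z) p \<bullet> b"
    unfolding inner_add_left lie_bracket_along[OF N B[OF X Y] Z p] lie_bracket_along[OF N Y B[OF X Z] p]
      lie_bracket_along[OF N X B[OF Y Z] p]
    by (simp add: ex a h X Y Z along_diff)
qed

section \<open>The exterior derivative on contact fields, and dual frames\<close>

definition kills :: "('a::euclidean_space \<Rightarrow> 'a \<Rightarrow> real) \<Rightarrow> 'a set \<Rightarrow> ('a \<Rightarrow> 'a) \<Rightarrow> bool" where
  "kills \<omega> N X \<longleftrightarrow> (\<forall>x\<in>N. \<omega> x (X x) = 0)"

lemma along_zero_on:
  assumes "tangent_field N X" "\<And>x. x \<in> N \<Longrightarrow> h x = 0"
  shows "along N X h x = 0"
  using mderiv_cong[of N h "\<lambda>x. 0" x "X x"] mderiv_const[of x N "X x" 0] tangent_fieldD(2)[OF assms(1)] assms(2)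
  by (auto simp: along_def)

lemma ext_deriv_kills:
  assumes "one_form N \<omega>" "tangent_field N X" "tangent_field N Y" "kills \<omega> N X" "kills \<omega> N Y" "x \<in> N"
  shows "ext_deriv N \<omega> x (X x) (Y x) = - \<omega> x (lie_bracket N X Y x)"
  using ext_deriv_fields[OF assms(1,2,3,6)] along_zero_on[OF assms(2), of "\<lambda>q. \<omega> q (Y q)" x]
    along_zero_on[OF assms(3), of "\<lambda>q. \<omega> q (X q)" x] assms(4,5,6)
  by (simp add: kills_def along_def)

text \<open>\<open>ext_deriv\<close> is defined with frozen arguments; Cartan's formula exhibits its
  value on moving arguments as a smooth expression.\<close>

lemma ext_deriv_smooth:
  assumes "one_form N \<omega>" "submanifold k N" "tangent_field N X" "tangent_field N Y"
  shows "smooth_map_on N (\<lambda>x. ext_deriv N \<omega> x (X x) (Y x))"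
proof (rule smooth_map_on_cong)
  show "smooth_map_on N (\<lambda>x. mderiv N (\<lambda>q. \<omega> q (Y q)) x (X x) - mderiv N (\<lambda>q. \<omega> q (X q)) x (Y x) - \<omega> x (lie_bracket N X Y x))"
    by (intro smooth_map_on_diff smooth_map_on_mderiv one_form_apply_smooth assms tangent_fieldD(1)[OF assms(3)]
        tangent_fieldD(1)[OF assms(4)] tangent_fieldD(1)[OF tangent_field_lie_bracket[OF assms(2,3,4)]])
qed (simp add: ext_deriv_fields[OF assms(1,3,4)])

lemma ext_deriv_skew: "ext_deriv N \<omega> x u v = - ext_deriv N \<omega> x v u"
  by (simp add: ext_deriv_def)

lemma ext_deriv_linear:
  assumes w: "one_form N \<omega>" and N: "submanifold k N" and x: "x \<in> N"
    and u: "u \<in> tangent_space N x" and u': "u' \<in> tangent_space N x" and v: "v \<in> tangent_space N x"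
  shows "ext_deriv N \<omega> x (u + u') v = ext_deriv N \<omega> x u v + ext_deriv N \<omega> x u' v"
    "ext_deriv N \<omega> x (c *\<^sub>R u) v = c * ext_deriv N \<omega> x u v"
proof -
  have ws: "smooth_map_on N (\<lambda>q. \<omega> q b)" for b using w by (auto simp: one_form_def)
  have lin: "linear (\<omega> q)" if "q \<in> N" for q using w that by (auto simp: one_form_def)
  have l: "linear (mderiv N (\<lambda>q. \<omega> q b) x)" for b by (rule mderiv_linear[OF ws x])
  have "mderiv N (\<lambda>q. \<omega> q (u + u')) x v = mderiv N (\<lambda>q. \<omega> q u + \<omega> q u') x v"
    by (rule mderiv_cong) (use linear_add[OF lin] x in auto)
  then show "ext_deriv N \<omega> x (u + u') v = ext_deriv N \<omega> x u v + ext_deriv N \<omega> x u' v"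
    by (simp add: ext_deriv_def linear_add[OF l] mderiv_add[OF ws ws x v])
  have "mderiv N (\<lambda>q. \<omega> q (c *\<^sub>R u)) x v = mderiv N (\<lambda>q. c * \<omega> q u) x v"
    by (rule mderiv_cong) (use linear_scale[OF lin] x in auto)
  also have "\<dots> = c * mderiv N (\<lambda>q. \<omega> q u) x v"
    using mderiv_bilinear[OF bounded_bilinear_mult smooth_map_on_const ws x v, of c] mderiv_const[OF x v, of c] by simp
  finally show "ext_deriv N \<omega> x (c *\<^sub>R u) v = c * ext_deriv N \<omega> x u v"
    by (simp add: ext_deriv_def linear_scale[OF l] algebra_simps)
qed

lemma ext_deriv_sum:
  assumes w: "one_form N \<omega>" and N: "submanifold k N" and x: "x \<in> N" and I: "finite I"
    and u: "\<And>i. i \<in> I \<Longrightarrow> u i \<in> tangent_space N x" and v: "v \<in> tangent_space N x"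
  shows "ext_deriv N \<omega> x (\<Sum>i\<in>I. c i *\<^sub>R u i) v = (\<Sum>i\<in>I. c i * ext_deriv N \<omega> x (u i) v)"
  using I u
proof (induction I rule: finite_induct)
  case empty
  then show ?case
    using ext_deriv_linear(2)[OF w N x subspace_0[OF subspace_tangent_space[OF N x]] subspace_0[OF subspace_tangent_space[OF N x]] v, of 0]
    by simp
next
  case (insert i I)
  have "(\<Sum>i\<in>I. c i *\<^sub>R u i) \<in> tangent_space N x"
    using insert by (intro subspace_sum subspace_scale subspace_tangent_space[OF N x]) auto
  then show ?case
    using insert ext_deriv_linear[OF w N x _ _ v] subspace_scale[OF subspace_tangent_space[OF N x]] by simp
qed

lemma ext_deriv_linear_right:
  assumes "one_form N \<omega>" "submanifold k N" "x \<in> N"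
    "u \<in> tangent_space N x" "u' \<in> tangent_space N x" "v \<in> tangent_space N x"
  shows "ext_deriv N \<omega> x v (u + u') = ext_deriv N \<omega> x v u + ext_deriv N \<omega> x v u'"
    "ext_deriv N \<omega> x v (c *\<^sub>R u) = c * ext_deriv N \<omega> x v u"
  using ext_deriv_linear[OF assms] ext_deriv_skew[of N \<omega> x v] by simp_all

lemma ext_deriv_sum_right:
  assumes "one_form N \<omega>" "submanifold k N" "x \<in> N" "finite I"
    "\<And>i. i \<in> I \<Longrightarrow> u i \<in> tangent_space N x" "v \<in> tangent_space N x"
  shows "ext_deriv N \<omega> x v (\<Sum>i\<in>I. c i *\<^sub>R u i) = (\<Sum>i\<in>I. c i * ext_deriv N \<omega> x v (u i))"
proof -
  have "ext_deriv N \<omega> x v (\<Sum>i\<in>I. c i *\<^sub>R u i) = - (\<Sum>i\<in>I. c i * ext_deriv N \<omega> x (u i) v)"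
    by (subst ext_deriv_skew) (simp add: ext_deriv_sum[OF assms])
  also have "\<dots> = (\<Sum>i\<in>I. c i * ext_deriv N \<omega> x v (u i))"
    by (subst ext_deriv_skew) (simp add: sum_negf)
  finally show ?thesis .
qed

lemma ext_deriv_uminus:
  assumes w: "one_form N \<omega>" and t: "x \<in> N" "u \<in> tangent_space N x" "v \<in> tangent_space N x"
  shows "ext_deriv N (\<lambda>x v. - \<omega> x v) x u v = - ext_deriv N \<omega> x u v"
proof -
  have ws: "smooth_map_on N (\<lambda>q. \<omega> q b)" for b using w by (auto simp: one_form_def)
  show ?thesis
    using mderiv_eq[OF has_derivative_minus[OF smooth_map_on_has_derivative[OF ws t(1)]] t(2)]
      mderiv_eq[OF has_derivative_minus[OF smooth_map_on_has_derivative[OF ws t(1)]] t(3)]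
    by (simp add: ext_deriv_def)
qed

text \<open>A frame adapted to the splitting and dual for \<open>d\<omega>\<close>. Isotropy of a
  subbundle only puts brackets of its sections into the contact distribution; it does not make the
  subbundle integrable.\<close>

locale contact_frame =
  fixes k :: nat and N :: "'a::euclidean_space set" and \<omega> :: "'a \<Rightarrow> 'a \<Rightarrow> real"
    and e f :: "'i::finite \<Rightarrow> 'a \<Rightarrow> 'a"
  assumes N: "submanifold k N" and w: "one_form N \<omega>"
    and te: "tangent_field N (e i)" and tf: "tangent_field N (f i)"
    and we: "kills \<omega> N (e i)" and wf: "kills \<omega> N (f i)"
    and Oee: "x \<in> N \<Longrightarrow> ext_deriv N \<omega> x (e i x) (e j x) = 0"
    and Off: "x \<in> N \<Longrightarrow> ext_deriv N \<omega> x (f i x) (f j x) = 0"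
    and Oef: "x \<in> N \<Longrightarrow> ext_deriv N \<omega> x (e i x) (f j x) = (if i = j then 1 else 0)"
    and frame: "x \<in> N \<Longrightarrow> v \<in> distr N \<omega> x \<Longrightarrow> \<exists>a b. v = (\<Sum>i\<in>UNIV. a i *\<^sub>R e i x) + (\<Sum>i\<in>UNIV. b i *\<^sub>R f i x)"

lemma distr_Int: "open U \<Longrightarrow> x \<in> U \<Longrightarrow> distr (M \<inter> U) \<omega> x = distr M \<omega> x"
  by (simp add: distr_def tangent_space_Int)

lemma ext_deriv_Int: "open U \<Longrightarrow> x \<in> U \<Longrightarrow> ext_deriv (M \<inter> U) \<omega> x u v = ext_deriv M \<omega> x u v"
  by (simp add: ext_deriv_def mderiv_Int)

lemma one_form_subset: "one_form M \<omega> \<Longrightarrow> N \<subseteq> M \<Longrightarrow> one_form N \<omega>"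
  unfolding one_form_def using smooth_map_on_subset by blast

lemma contact_frame_Int:
  assumes "contact_frame k N \<omega> e f" "open U"
  shows "contact_frame k (N \<inter> U) \<omega> e f"
proof -
  interpret contact_frame k N \<omega> e f by fact
  show ?thesis
    by unfold_locales
      (use N w te tf we wf Oee Off Oef frame assms(2) in
        \<open>auto simp: distr_Int ext_deriv_Int kills_def intro: submanifold_Int one_form_subset tangent_field_Int\<close>)
qed

text \<open>Exchanging the subbundles reverses the sign of the duality, which is absorbed by
  negating \<open>\<omega>\<close>. Statements about \<open>f\<close> then follow from those about
  \<open>e\<close>.\<close>

lemma contact_frame_swap:
  assumes "contact_frame k N \<omega> e f"
  shows "contact_frame k N (\<lambda>x v. - \<omega> x v) f e"
proof -
  interpret contact_frame k N \<omega> e f by fact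
  note ed = ext_deriv_uminus[OF w]
  have di: "distr N (\<lambda>x v. - \<omega> x v) x = distr N \<omega> x" for x by (simp add: distr_def)
  show ?thesis
  proof
    show "one_form N (\<lambda>x v. - \<omega> x v)"
      using w by (auto simp: one_form_def intro: smooth_map_on_minus linear_compose_neg)
    fix x i j assume x: "x \<in> N"
    note t = tangent_fieldD(2)[OF te x] tangent_fieldD(2)[OF tf x]
    show "ext_deriv N (\<lambda>x v. - \<omega> x v) x (f i x) (f j x) = 0" using ed[OF x] t Off[OF x] by simp
    show "ext_deriv N (\<lambda>x v. - \<omega> x v) x (e i x) (e j x) = 0" using ed[OF x] t Oee[OF x] by simp
    show "ext_deriv N (\<lambda>x v. - \<omega> x v) x (f i x) (e j x) = (if i = j then 1 else 0)"
      using ed[OF x] t Oef[OF x, of j i] ext_deriv_skew[of N \<omega> x "f i x" "e j x"] by auto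
  next
    fix x v assume "x \<in> N" "v \<in> distr N (\<lambda>x v. - \<omega> x v) x"
    then show "\<exists>a b. v = (\<Sum>i\<in>UNIV. a i *\<^sub>R f i x) + (\<Sum>i\<in>UNIV. b i *\<^sub>R e i x)"
      using frame[of x v] di by (metis add.commute)
  qed (use N te tf we wf in \<open>auto simp: kills_def\<close>)
qed

context contact_frame
begin

lemmas ed_linear = ext_deriv_linear[OF w N] ext_deriv_linear_right[OF w N]
  and ed_sum = ext_deriv_sum[OF w N] ext_deriv_sum_right[OF w N]

lemma w_linear: "x \<in> N \<Longrightarrow> linear (\<omega> x)"
  using w by (auto simp: one_form_def)

text \<open>Duality reads off the coefficients as values of \<open>d\<omega>\<close>; for smooth
  fields they are therefore smooth functions.\<close>

lemma frame_coefficients: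
  assumes x: "x \<in> N" and v: "v \<in> distr N \<omega> x"
  shows "v = (\<Sum>i\<in>UNIV. ext_deriv N \<omega> x v (f i x) *\<^sub>R e i x) + (\<Sum>i\<in>UNIV. ext_deriv N \<omega> x (e i x) v *\<^sub>R f i x)"
proof -
  obtain a b where ab: "v = (\<Sum>i\<in>UNIV. a i *\<^sub>R e i x) + (\<Sum>i\<in>UNIV. b i *\<^sub>R f i x)" using frame[OF x v] by blast
  note t = tangent_fieldD(2)[OF te x] tangent_fieldD(2)[OF tf x]
  have s: "(\<Sum>i\<in>UNIV. a i *\<^sub>R e i x) \<in> tangent_space N x" "(\<Sum>i\<in>UNIV. b i *\<^sub>R f i x) \<in> tangent_space N x"
    using t by (auto intro!: subspace_sum subspace_scale subspace_tangent_space[OF N x])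
  have "ext_deriv N \<omega> x v (f i x) = a i" for i
    unfolding ab using x t s by (simp add: ed_linear(1) ed_sum(1) Oef Off if_distrib[of "(*) _"] cong: if_cong)
  moreover have "ext_deriv N \<omega> x (e i x) v = b i" for i
    unfolding ab using x t s by (simp add: ed_linear(3) ed_sum(2) Oef Oee if_distrib[of "(*) _"] cong: if_cong)
  ultimately show ?thesis using ab by simp
qed

end

section \<open>Smooth functions as coefficient ring, and the algebra of brackets\<close>

lemma smooth_coefficient_ring: "coefficient_ring {a :: 'a::euclidean_space \<Rightarrow> real. smooth_map_on N a}"
  by unfold_locales
    (auto simp: one_fun_def plus_fun_def times_fun_def fun_Compl_def
      intro: smooth_map_on_const smooth_map_on_add smooth_map_on_mult smooth_map_on_minus)

lemma (in coefficient_ring) span_sum: "(\<And>i. i \<in> I \<Longrightarrow> x i \<in> mod_span A G) \<Longrightarrow> sum x I \<in> mod_span A G"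
  by (induction I rule: infinite_finite_induct) (auto intro: span_add mod_span.zero)

lemma sum_fun_apply: "sum h I x = (\<Sum>i\<in>I. h i x :: 'b::comm_monoid_add)"
  by (induction I rule: infinite_finite_induct) auto

lemma along_derivation:
  fixes N :: "'a::euclidean_space set"
  assumes "tangent_field N X"
  shows "coefficient_ring.derivation {a. smooth_map_on N a} (along N X)"
  unfolding coefficient_ring.derivation_def[OF smooth_coefficient_ring]
proof (intro ballI conjI; clarsimp)
  fix a b :: "'a \<Rightarrow> real" assume s: "smooth_map_on N a" "smooth_map_on N b"
  show "smooth_map_on N (along N X a)" by (rule smooth_map_on_along[OF s(1) assms])
  show "along N X (a + b) = along N X a + along N X b"
    using mderiv_add[OF s] tangent_fieldD(2)[OF assms] by (auto simp: along_def plus_fun_def)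
  show "along N X (a * b) = a * along N X b + along N X a * b"
    using mderiv_bilinear[OF bounded_bilinear_mult s] tangent_fieldD(2)[OF assms] by (auto simp: along_def times_fun_def plus_fun_def)
qed

lemma tangent_field_add: "submanifold k N \<Longrightarrow> tangent_field N X \<Longrightarrow> tangent_field N Y \<Longrightarrow> tangent_field N (\<lambda>x. X x + Y x)"
  unfolding tangent_field_def by (auto intro: smooth_map_on_add subspace_add subspace_tangent_space)

lemma tangent_field_scale: "submanifold k N \<Longrightarrow> smooth_map_on N c \<Longrightarrow> tangent_field N X \<Longrightarrow> tangent_field N (\<lambda>x. c x *\<^sub>R X x)"
  unfolding tangent_field_def by (auto intro: smooth_map_on_scaleR subspace_scale subspace_tangent_space)

lemma tangent_field_zero: "submanifold k N \<Longrightarrow> tangent_field N (\<lambda>x. 0)"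
  unfolding tangent_field_def by (auto intro: smooth_map_on_const subspace_0 subspace_tangent_space)

lemma tangent_field_sum:
  "submanifold k N \<Longrightarrow> (\<And>i. i \<in> I \<Longrightarrow> tangent_field N (X i)) \<Longrightarrow> tangent_field N (\<lambda>x. \<Sum>i\<in>I. X i x)"
  by (induction I rule: infinite_finite_induct) (auto intro: tangent_field_zero tangent_field_add)

lemma lie_bracket_cong:
  assumes "\<And>x. x \<in> N \<Longrightarrow> X x = Y x"
  shows "lie_bracket N X Z p = lie_bracket N Y Z p"
  using mderiv_cong[of N X Y p] assms by (auto simp: lie_bracket_def)

lemma lie_bracket_add:
  assumes "tangent_field N X" "tangent_field N Y" "tangent_field N Z"
  shows "lie_bracket N (\<lambda>x. X x + Y x) Z p = lie_bracket N X Z p + lie_bracket N Y Z p"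
  using mderiv_add[OF tangent_fieldD(1)[OF assms(1)] tangent_fieldD(1)[OF assms(2)]] tangent_fieldD(2)[OF assms(3)]
    linear_add[OF mderiv_linear[OF tangent_fieldD(1)[OF assms(3)]]]
  by (simp add: lie_bracket_def)

lemma lie_bracket_scale:
  assumes "tangent_field N X" "smooth_map_on N c" "tangent_field N Z"
  shows "lie_bracket N (\<lambda>x. c x *\<^sub>R X x) Z p = c p *\<^sub>R lie_bracket N X Z p - along N Z c p *\<^sub>R X p"
  using mderiv_bilinear[OF bounded_bilinear_scaleR assms(2) tangent_fieldD(1)[OF assms(1)]] tangent_fieldD(2)[OF assms(3)]
    linear_scale[OF mderiv_linear[OF tangent_fieldD(1)[OF assms(3)]]]
  by (simp add: lie_bracket_def along_def scaleR_diff_right)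

lemma lie_bracket_sum:
  fixes X :: "'i \<Rightarrow> 'a::euclidean_space \<Rightarrow> 'a"
  assumes "submanifold k N" "finite I" "\<And>i. i \<in> I \<Longrightarrow> tangent_field N (X i)" "tangent_field N Z"
  shows "lie_bracket N (\<lambda>x. \<Sum>i\<in>I. X i x) Z p = (\<Sum>i\<in>I. lie_bracket N (X i) Z p)"
  using assms(2,3)
proof (induction I rule: finite_induct)
  case empty
  then show ?case
    using mderiv_const[of p N "Z p" "0::'a"] tangent_fieldD(2)[OF assms(4)] linear_0[OF mderiv_linear[OF tangent_fieldD(1)[OF assms(4)]]]
    by (simp add: lie_bracket_def)
next
  case (insert i I)
  then show ?case
    using lie_bracket_add[OF _ tangent_field_sum[OF assms(1)] assms(4), of "X i" I X] by simp
qed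

context contact_frame
begin

text \<open>Any index would do; \<open>undefined\<close> picks one. Duality and Cartan's formula
  give \<open>\<omega> x (T x) = -1\<close>, the source of the signs below.\<close>

definition T :: "'a \<Rightarrow> 'a" where "T = lie_bracket N (e undefined) (f undefined)"

lemma tT: "tangent_field N T"
  unfolding T_def by (rule tangent_field_lie_bracket[OF N te tf])

lemma wT: "x \<in> N \<Longrightarrow> \<omega> x (T x) = -1"
  using ext_deriv_kills[OF w te tf we wf, of x undefined undefined] Oef[of x undefined undefined]
  unfolding T_def by simp

lemma expansion_field:
  "tangent_field N Y \<Longrightarrow> tangent_field N (\<lambda>x. Y x + \<omega> x (Y x) *\<^sub>R T x)"
  by (intro tangent_field_add[OF N] tangent_field_scale[OF N] tT one_form_apply_smooth[OF w tangent_fieldD(1)])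

text \<open>As \<open>\<omega> x (T x) = -1\<close>, adding \<open>\<omega> x (Y x)\<close> times
  \<open>T\<close> removes the transverse part of \<open>Y\<close>.\<close>

lemma expansion:
  assumes Y: "tangent_field N Y" and x: "x \<in> N"
  defines "Y' \<equiv> \<lambda>x. Y x + \<omega> x (Y x) *\<^sub>R T x"
  shows "Y x = (- \<omega> x (Y x)) *\<^sub>R T x + (\<Sum>i\<in>UNIV. ext_deriv N \<omega> x (Y' x) (f i x) *\<^sub>R e i x)
     + (\<Sum>i\<in>UNIV. ext_deriv N \<omega> x (e i x) (Y' x) *\<^sub>R f i x)"
proof -
  have "\<omega> x (Y' x) = 0"
    using wT[OF x] by (simp add: Y'_def linear_add[OF w_linear[OF x]] linear_scale[OF w_linear[OF x]])
  then have "Y' x \<in> distr N \<omega> x"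
    using tangent_fieldD(2)[OF expansion_field[OF Y] x] by (simp add: distr_def Y'_def)
  from frame_coefficients[OF x this]
  show ?thesis unfolding Y'_def by (simp add: algebra_simps)
qed

lemma ed_diff: "x \<in> N \<Longrightarrow> u \<in> tangent_space N x \<Longrightarrow> u' \<in> tangent_space N x \<Longrightarrow> v \<in> tangent_space N x \<Longrightarrow>
    ext_deriv N \<omega> x v (u - u') = ext_deriv N \<omega> x v u - ext_deriv N \<omega> x v u'"
  using ed_linear(3)[of x u "(-1) *\<^sub>R u'" v] ed_linear(4)[of x u' u' v "-1"]
    subspace_neg[OF subspace_tangent_space[OF N, of x], of u'] by simp

lemma along_expansion:
  assumes Y: "tangent_field N Y" and h: "smooth_map_on N h"
  obtains a b where "\<And>i. smooth_map_on N (a i)" "\<And>i. smooth_map_on N (b i)"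
    "along N Y h = - (\<lambda>x. \<omega> x (Y x)) * along N T h + (\<Sum>i\<in>UNIV. a i * along N (e i) h) + (\<Sum>i\<in>UNIV. b i * along N (f i) h)"
proof
  let ?Y' = "\<lambda>x. Y x + \<omega> x (Y x) *\<^sub>R T x"
  let ?a = "\<lambda>i x. ext_deriv N \<omega> x (?Y' x) (f i x)" and ?b = "\<lambda>i x. ext_deriv N \<omega> x (e i x) (?Y' x)"
  show "smooth_map_on N (?a i)" "smooth_map_on N (?b i)" for i
    by (rule ext_deriv_smooth[OF w N expansion_field[OF Y] tf] ext_deriv_smooth[OF w N te expansion_field[OF Y]])+
  show "along N Y h = - (\<lambda>x. \<omega> x (Y x)) * along N T h + (\<Sum>i\<in>UNIV. ?a i * along N (e i) h) + (\<Sum>i\<in>UNIV. ?b i * along N (f i) h)"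
  proof
    fix x
    show "along N Y h x = (- (\<lambda>x. \<omega> x (Y x)) * along N T h + (\<Sum>i\<in>UNIV. ?a i * along N (e i) h) + (\<Sum>i\<in>UNIV. ?b i * along N (f i) h)) x"
    proof (cases "x \<in> N")
      case True
      have l: "linear (mderiv N h x)" by (rule mderiv_linear[OF h True])
      show ?thesis
        using arg_cong[OF expansion(1)[OF Y True], of "mderiv N h x"] True
        by (simp add: along_def sum_fun_apply linear_add[OF l] linear_sum[OF l] linear_scale[OF l] linear_neg[OF l] linear_diff[OF l])
    qed (simp add: along_def sum_fun_apply)
  qed
qed

abbreviation R where "R \<equiv> {a :: 'a \<Rightarrow> real. smooth_map_on N a}"

text \<open>The source of the assumptions \<open>ef\<close>, \<open>eT\<close> and \<open>fT\<close>
  of the prolongation: a bracket is a tangent field, and its \<open>T\<close> term is absent when it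
  is a contact direction.\<close>

lemma along_span:
  assumes Y: "tangent_field N Y" and h: "smooth_map_on N h"
  shows "along N Y h \<in> mod_span R (insert (along N T h) (range (\<lambda>i. along N (e i) h) \<union> range (\<lambda>i. along N (f i) h)))"
    and "kills \<omega> N Y \<Longrightarrow> along N Y h \<in> mod_span R (range (\<lambda>i. along N (e i) h) \<union> range (\<lambda>i. along N (f i) h))"
proof -
  interpret coefficient_ring R by (rule smooth_coefficient_ring)
  obtain a b where ab: "\<And>i. smooth_map_on N (a i)" "\<And>i. smooth_map_on N (b i)"
    "along N Y h = - (\<lambda>x. \<omega> x (Y x)) * along N T h + (\<Sum>i\<in>UNIV. a i * along N (e i) h) + (\<Sum>i\<in>UNIV. b i * along N (f i) h)"
    using along_expansion[OF Y h] by blast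
  have c: "- (\<lambda>x. \<omega> x (Y x)) \<in> R"
    using smooth_map_on_minus[OF one_form_apply_smooth[OF w tangent_fieldD(1)[OF Y]]] by (simp add: fun_Compl_def)
  show "along N Y h \<in> mod_span R (insert (along N T h) (range (\<lambda>i. along N (e i) h) \<union> range (\<lambda>i. along N (f i) h)))"
    unfolding ab(3) by (intro span_add span_sum span_mult span_base c) (use ab in auto)
  assume k: "kills \<omega> N Y"
  have "- (\<lambda>x. \<omega> x (Y x)) * along N T h = 0"
    using k by (auto simp: kills_def along_def fun_eq_iff)
  then have "along N Y h = (\<Sum>i\<in>UNIV. a i * along N (e i) h) + (\<Sum>i\<in>UNIV. b i * along N (f i) h)"
    using ab(3) by simp
  then show "along N Y h \<in> mod_span R (range (\<lambda>i. along N (e i) h) \<union> range (\<lambda>i. along N (f i) h))"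
    by (simp only:) (intro span_add span_sum span_mult span_base, use ab in auto)
qed

text \<open>Invariance of the two subbundles: each is maximal isotropic for
  \<open>d\<omega>\<close>, so a contact vector that is \<open>d\<omega>\<close>-orthogonal to all
  \<open>e j\<close> lies in their span, and likewise for \<open>f j\<close>.\<close>

definition frame_symmetry :: "('a \<Rightarrow> 'a) \<Rightarrow> bool" where
  "frame_symmetry X \<longleftrightarrow> tangent_field N X \<and>
    (\<forall>i. kills \<omega> N (lie_bracket N X (e i)) \<and> kills \<omega> N (lie_bracket N X (f i))) \<and>
    (\<forall>x\<in>N. \<forall>i j. ext_deriv N \<omega> x (e j x) (lie_bracket N X (e i) x) = 0 \<and>
       ext_deriv N \<omega> x (f j x) (lie_bracket N X (f i) x) = 0)"

text \<open>The generating function (contact Hamiltonian) of a contact field, cut off outside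
  \<open>N\<close> in accordance with \<open>along\<close>.\<close>

definition potential :: "('a \<Rightarrow> 'a) \<Rightarrow> 'a \<Rightarrow> real" where
  "potential X x = (if x \<in> N then \<omega> x (X x) else 0)"

text \<open>\<open>\<tau>\<close> and \<open>\<sigma>\<close> are the components of
  \<open>d\<omega>\<close> against \<open>T\<close>; they may be nonzero because \<open>T\<close> is
  a bracket of frame fields and need not be a Reeb field.\<close>

definition \<tau> :: "'i \<Rightarrow> 'a \<Rightarrow> real" where "\<tau> i x = ext_deriv N \<omega> x (e i x) (T x)"
definition \<sigma> :: "'i \<Rightarrow> 'a \<Rightarrow> real" where "\<sigma> i x = ext_deriv N \<omega> x (T x) (f i x)"

lemma smooth_tau: "smooth_map_on N (\<tau> i)" and smooth_sigma: "smooth_map_on N (\<sigma> i)"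
  using ext_deriv_smooth[OF w N te tT] ext_deriv_smooth[OF w N tT tf] by (auto simp: \<tau>_def[abs_def] \<sigma>_def[abs_def])

definition acoef :: "('a \<Rightarrow> 'a) \<Rightarrow> 'i \<Rightarrow> 'a \<Rightarrow> real" where
  "acoef X i = \<sigma> i * potential X - along N (f i) (potential X)"
definition bcoef :: "('a \<Rightarrow> 'a) \<Rightarrow> 'i \<Rightarrow> 'a \<Rightarrow> real" where
  "bcoef X i = \<tau> i * potential X + along N (e i) (potential X)"

lemma smooth_potential: "tangent_field N X \<Longrightarrow> smooth_map_on N (potential X)"
  by (rule smooth_map_on_cong[OF one_form_apply_smooth[OF w tangent_fieldD(1)]]) (auto simp: potential_def)

lemma smooth_acoef: "tangent_field N X \<Longrightarrow> smooth_map_on N (acoef X i)"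
  and smooth_bcoef: "tangent_field N X \<Longrightarrow> smooth_map_on N (bcoef X i)"
  unfolding acoef_def bcoef_def fun_diff_def plus_fun_def times_fun_def
  by (intro smooth_map_on_add smooth_map_on_diff smooth_map_on_mult smooth_tau smooth_sigma smooth_potential
      smooth_map_on_along te tf; assumption)+

text \<open>Since \<open>[X, e i]\<close> and \<open>[X, f i]\<close> are contact directions,
  Cartan's formula turns \<open>d\<omega>\<close> of \<open>X\<close> with the frame into
  derivatives of the generating function; by duality these are the components of \<open>X\<close> up
  to \<open>\<tau>\<close> and \<open>\<sigma>\<close>.\<close>

lemma symmetry_expansion:
  assumes X: "frame_symmetry X" and x: "x \<in> N"
  shows "X x = (- potential X x) *\<^sub>R T x + (\<Sum>i\<in>UNIV. acoef X i x *\<^sub>R e i x) + (\<Sum>i\<in>UNIV. bcoef X i x *\<^sub>R f i x)"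
proof -
  have tX: "tangent_field N X" using X by (simp add: frame_symmetry_def)
  note t = tangent_fieldD(2)[OF te x] tangent_fieldD(2)[OF tf x] tangent_fieldD(2)[OF tT x] tangent_fieldD(2)[OF tX x]
  have p: "mderiv N (\<lambda>q. \<omega> q (X q)) x v = mderiv N (potential X) x v" for v
    by (rule mderiv_cong[OF _ x]) (simp add: potential_def)
  have k: "\<omega> x (lie_bracket N X (e i) x) = 0" "\<omega> x (lie_bracket N X (f i) x) = 0" for i
    using X x by (auto simp: frame_symmetry_def kills_def)
  have "lie_bracket N (e i) X x = - lie_bracket N X (e i) x" for i by (simp add: lie_bracket_def)
  then have k': "\<omega> x (lie_bracket N (e i) X x) = 0" for i using k linear_neg[OF w_linear[OF x]] by simp
  have z: "along N X (\<lambda>q. \<omega> q (e i q)) x = 0" "along N X (\<lambda>q. \<omega> q (f i q)) x = 0" for i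
    using we wf by (auto intro!: along_zero_on[OF tX] simp: kills_def)
  have 1: "ext_deriv N \<omega> x (e i x) (X x) = along N (e i) (potential X) x" for i
    using ext_deriv_fields[OF w te tX x, of i] k' p z[of i] x by (simp add: along_def)
  have 2: "ext_deriv N \<omega> x (X x) (f i x) = - along N (f i) (potential X) x" for i
    using ext_deriv_fields[OF w tX tf x, of i] k p z[of i] x by (simp add: along_def)
  have s: "\<omega> x (X x) *\<^sub>R T x \<in> tangent_space N x" using t subspace_scale subspace_tangent_space[OF N x] by blast
  have "ext_deriv N \<omega> x (X x + \<omega> x (X x) *\<^sub>R T x) (f i x) = acoef X i x" for i
    using ed_linear(1)[OF x t(4) s t(2)] ed_linear(2)[OF x t(3) t(3) t(2)] 2 x
    by (simp add: acoef_def potential_def \<sigma>_def)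
  moreover have "ext_deriv N \<omega> x (e i x) (X x + \<omega> x (X x) *\<^sub>R T x) = bcoef X i x" for i
    using ed_linear(3)[OF x t(4) s t(1)] ed_linear(4)[OF x t(3) t(3) t(1)] 1 x
    by (simp add: bcoef_def potential_def \<tau>_def)
  ultimately show ?thesis using expansion(1)[OF tX x] x by (simp add: potential_def)
qed

text \<open>\<open>d\<omega>\<close> vanishes on \<open>e j\<close> and \<open>[X, e i]\<close>.
  When \<open>X\<close> is expanded, isotropy removes the terms \<open>e i (acoef X m)\<close> and
  duality keeps \<open>e i (bcoef X j)\<close>, whose second order part is
  \<open>e i (e j u)\<close>; everything else is of first order.\<close>

lemma ee_potential:
  assumes X: "frame_symmetry X"
  shows "along N (e i) (along N (e j) (potential X)) \<in>
    mod_span R (insert (potential X) (range (\<lambda>k. along N (e k) (potential X)) \<union> range (\<lambda>k. along N (f k) (potential X))))"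
    (is "?l \<in> mod_span R ?G")
proof -
  interpret coefficient_ring R by (rule smooth_coefficient_ring)
  let ?u = "potential X"
  have tX: "tangent_field N X" using X by (simp add: frame_symmetry_def)
  note B = tangent_field_lie_bracket[OF N]
  note u = smooth_potential[OF tX] and a = smooth_acoef[OF tX] and b = smooth_bcoef[OF tX]
  define P where "P x = ext_deriv N \<omega> x (e j x) (lie_bracket N T (e i) x)" for x
  define Q where "Q m x = ext_deriv N \<omega> x (e j x) (lie_bracket N (e m) (e i) x)" for m x
  define S where "S m x = ext_deriv N \<omega> x (e j x) (lie_bracket N (f m) (e i) x)" for m x
  have sm: "smooth_map_on N P" "smooth_map_on N (Q m)" "smooth_map_on N (S m)" for m
    unfolding P_def Q_def S_def using ext_deriv_smooth[OF w N te B[OF tT te]]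
      ext_deriv_smooth[OF w N te B[OF te te]] ext_deriv_smooth[OF w N te B[OF tf te]] by auto
  have main: "?l = - (P * ?u) - along N (e i) (\<tau> j) * ?u + (\<Sum>m\<in>UNIV. Q m * acoef X m) + (\<Sum>m\<in>UNIV. S m * bcoef X m)"
  proof
    fix x
    show "?l x = (- (P * ?u) - along N (e i) (\<tau> j) * ?u + (\<Sum>m\<in>UNIV. Q m * acoef X m) + (\<Sum>m\<in>UNIV. S m * bcoef X m)) x"
    proof (cases "x \<in> N")
      case x: True
      note t = tangent_fieldD(2)[OF te x] tangent_fieldD(2)[OF tf x] tangent_fieldD(2)[OF tT x]
        tangent_fieldD(2)[OF B[OF te te] x] tangent_fieldD(2)[OF B[OF tf te] x] tangent_fieldD(2)[OF B[OF tT te] x]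
      note st = subspace_tangent_space[OF N x]
      have mu: "smooth_map_on N (\<lambda>x. - ?u x)" by (rule smooth_map_on_minus[OF u])
      note T1 = tangent_field_scale[OF N mu tT] and T2 = tangent_field_scale[OF N a te] and T3 = tangent_field_scale[OF N b tf]
      have "lie_bracket N X (e i) x = lie_bracket N (\<lambda>x. ((- ?u x) *\<^sub>R T x + (\<Sum>m\<in>UNIV. acoef X m x *\<^sub>R e m x))
          + (\<Sum>m\<in>UNIV. bcoef X m x *\<^sub>R f m x)) (e i) x"
        by (rule lie_bracket_cong) (use symmetry_expansion[OF X] in auto)
      also have "\<dots> = ((- ?u x) *\<^sub>R lie_bracket N T (e i) x - along N (e i) (\<lambda>x. - ?u x) x *\<^sub>R T x)
         + (\<Sum>m\<in>UNIV. acoef X m x *\<^sub>R lie_bracket N (e m) (e i) x - along N (e i) (acoef X m) x *\<^sub>R e m x)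
         + (\<Sum>m\<in>UNIV. bcoef X m x *\<^sub>R lie_bracket N (f m) (e i) x - along N (e i) (bcoef X m) x *\<^sub>R f m x)"
        by (simp only: lie_bracket_add[OF tangent_field_add[OF N T1 tangent_field_sum[OF N T2]] tangent_field_sum[OF N T3] te]
            lie_bracket_add[OF T1 tangent_field_sum[OF N T2] te] lie_bracket_sum[OF N finite T2 te] lie_bracket_sum[OF N finite T3 te]
            lie_bracket_scale[OF tT mu te] lie_bracket_scale[OF te a te] lie_bracket_scale[OF tf b te])
      also have "\<dots> = ((- ?u x) *\<^sub>R lie_bracket N T (e i) x + along N (e i) ?u x *\<^sub>R T x)
         + ((\<Sum>m\<in>UNIV. acoef X m x *\<^sub>R lie_bracket N (e m) (e i) x) + (\<Sum>m\<in>UNIV. (- along N (e i) (acoef X m) x) *\<^sub>R e m x))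
         + ((\<Sum>m\<in>UNIV. bcoef X m x *\<^sub>R lie_bracket N (f m) (e i) x) + (\<Sum>m\<in>UNIV. (- along N (e i) (bcoef X m) x) *\<^sub>R f m x))"
        by (simp add: along_uminus[OF te u] sum_subtractf sum_negf)
      finally have br: "lie_bracket N X (e i) x = \<dots>" .
      have "0 = ext_deriv N \<omega> x (e j x) (lie_bracket N X (e i) x)" using X x by (auto simp: frame_symmetry_def)
      also have "\<dots> = - ?u x * P x + along N (e i) ?u x * \<tau> j x + (\<Sum>m\<in>UNIV. acoef X m x * Q m x)
         + (\<Sum>m\<in>UNIV. bcoef X m x * S m x) - along N (e i) (bcoef X j) x"
        unfolding br using x t st
        by (simp add: ed_linear(3) ed_linear(4) ed_diff subspace_diff ed_sum(2) subspace_add subspace_scale subspace_sum subspace_neg Oee Oef P_def Q_def S_def \<tau>_def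
            sum_negf if_distrib[of "(*) _"] cong: if_cong)
      also have "along N (e i) (bcoef X j) x = \<tau> j x * along N (e i) ?u x + along N (e i) (\<tau> j) x * ?u x + ?l x"
        unfolding bcoef_def
        using derivation_props[OF along_derivation[OF te], of "\<tau> j * ?u" "along N (e j) ?u"]
          derivation_props(3)[OF along_derivation[OF te], of "\<tau> j" ?u] smooth_tau u smooth_map_on_along[OF u te]
          mult[of "\<tau> j" ?u] by simp
      finally show ?thesis by (simp add: sum_fun_apply algebra_simps)
    qed (simp add: along_def potential_def acoef_def bcoef_def sum_fun_apply)
  qed
  have uG: "?u \<in> mod_span R ?G" and eG: "along N (e m) ?u \<in> mod_span R ?G" and fG: "along N (f m) ?u \<in> mod_span R ?G" for m
    by (rule span_base, simp)+
  have R: "\<tau> m \<in> R" "\<sigma> m \<in> R" "P \<in> R" "Q m \<in> R" "S m \<in> R" "along N (e i) (\<tau> m) \<in> R" for m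
    using smooth_tau smooth_sigma sm smooth_map_on_along[OF smooth_tau te] by simp_all
  have aG: "acoef X m \<in> mod_span R ?G" and bG: "bcoef X m \<in> mod_span R ?G" for m
    unfolding acoef_def bcoef_def by (intro span_add span_diff span_mult R uG eG fG)+
  show ?thesis
    unfolding main by (intro span_add span_diff span_minus span_sum span_mult R uG aG bG)
qed

end

lemma along_minus_fun: "tangent_field N X \<Longrightarrow> smooth_map_on N h \<Longrightarrow> along N X (- h) = - along N X h"
  using along_uminus[of N X h] by (auto simp: fun_Compl_def)

context contact_frame
begin

lemma frame_symmetry_swap:
  assumes "frame_symmetry X"
  shows "contact_frame.frame_symmetry N (\<lambda>x v. - \<omega> x v) f e X"
proof -
  interpret swap: contact_frame k N "\<lambda>x v. - \<omega> x v" f e by (rule contact_frame_swap) unfold_locales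
  note ed = ext_deriv_uminus[OF w]
  have tX: "tangent_field N X" using assms by (simp add: frame_symmetry_def)
  note t = tangent_fieldD(2)[OF te] tangent_fieldD(2)[OF tf] tangent_fieldD(2)[OF tangent_field_lie_bracket[OF N tX te]] tangent_fieldD(2)[OF tangent_field_lie_bracket[OF N tX tf]]
  show ?thesis
    using assms unfolding frame_symmetry_def swap.frame_symmetry_def
    by (simp add: kills_def ed t)
qed

text \<open>From \<open>ee_potential\<close> for the swapped frame, whose generating function is
  \<open>- potential X\<close>.\<close>

lemma ff_potential:
  assumes X: "frame_symmetry X"
  shows "along N (f i) (along N (f j) (potential X)) \<in>
    mod_span R (insert (potential X) (range (\<lambda>k. along N (e k) (potential X)) \<union> range (\<lambda>k. along N (f k) (potential X))))"
    (is "_ \<in> mod_span R ?G")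
proof -
  interpret swap: contact_frame k N "\<lambda>x v. - \<omega> x v" f e by (rule contact_frame_swap) unfold_locales
  interpret coefficient_ring R by (rule smooth_coefficient_ring)
  have tX: "tangent_field N X" using X by (simp add: frame_symmetry_def)
  have u: "smooth_map_on N (potential X)" by (rule smooth_potential[OF tX])
  have p: "swap.potential X = - potential X" by (auto simp: swap.potential_def potential_def)
  have "along N (f i) (along N (f j) (swap.potential X)) = - along N (f i) (along N (f j) (potential X))"
    unfolding p using along_minus_fun[OF tf u] along_minus_fun[OF tf smooth_map_on_along[OF u tf]] by simp
  then have "- along N (f i) (along N (f j) (potential X)) \<in> mod_span R (insert (- potential X)
      (range (\<lambda>k. - along N (f k) (potential X)) \<union> range (\<lambda>k. - along N (e k) (potential X))))"
    using swap.ee_potential[OF frame_symmetry_swap[OF X], of i j] along_minus_fun[OF tf u] along_minus_fun[OF te u]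
    unfolding p by simp
  moreover have "insert (- potential X) (range (\<lambda>k. - along N (f k) (potential X)) \<union> range (\<lambda>k. - along N (e k) (potential X)))
      \<subseteq> mod_span R ?G"
    by (auto intro!: span_minus[OF span_base])
  ultimately have "- along N (f i) (along N (f j) (potential X)) \<in> mod_span R ?G"
    using span_subset by blast
  then show ?thesis using span_minus by fastforce
qed

text \<open>The set \<open>gens 4\<close> of the prolongation, with its operators written as
  derivatives along the frame.\<close>

definition jets :: "('a \<Rightarrow> real) \<Rightarrow> ('a \<Rightarrow> real) set" where
  "jets u = {u} \<union> (range (\<lambda>i. along N (e i) u) \<union> range (\<lambda>i. along N (f i) u)) \<union>
     insert (along N T u) (range (\<lambda>(i,j). along N (e i) (along N (f j) u))) \<union>
     (range (\<lambda>i. along N (e i) (along N T u)) \<union> range (\<lambda>i. along N (f i) (along N T u))) \<union>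
     {along N T (along N T u)}"

lemma jets_smooth: "smooth_map_on N u \<Longrightarrow> g \<in> jets u \<Longrightarrow> smooth_map_on N g"
  unfolding jets_def by (auto intro!: smooth_map_on_along te tf tT)

lemma finite_jets: "finite (jets u)"
  unfolding jets_def by auto

lemma jets_closed:
  assumes X: "frame_symmetry X" and g: "g \<in> jets (potential X)"
  shows "along N (e i) g \<in> mod_span R (jets (potential X))" "along N (f i) g \<in> mod_span R (jets (potential X))"
    "along N T g \<in> mod_span R (jets (potential X))"
proof -
  let ?u = "potential X"
  \<comment> \<open>The prolongation takes its \<open>T\<close> to be a commutator on all functions,
    while \<open>along N T\<close> is known to be this commutator on smooth functions only;
    \<open>TT\<close> bridges the two.\<close>
  define TT where "TT h = along N (e undefined) (along N (f undefined) h) - along N (f undefined) (along N (e undefined) h)" for h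
  have tX: "tangent_field N X" using X by (simp add: frame_symmetry_def)
  have u: "smooth_map_on N ?u" by (rule smooth_potential[OF tX])
  have TT: "TT h = along N T h" if "smooth_map_on N h" for h
    using along_lie_bracket[OF N that te tf] by (auto simp: TT_def T_def)
  note B = tangent_field_lie_bracket[OF N] and sm = smooth_map_on_along
  have br: "along N (lie_bracket N Y Z) h = along N Y (along N Z h) - along N Z (along N Y h)"
    if "smooth_map_on N h" "tangent_field N Y" "tangent_field N Z" for Y Z h
    using along_lie_bracket[OF N that] by auto
  have half: "(\<lambda>x. 1/2) + (\<lambda>x. 1/2) = (1 :: 'a \<Rightarrow> real)" and third: "(\<lambda>x. 1/3) + (\<lambda>x. 1/3) + (\<lambda>x. 1/3) = (1 :: 'a \<Rightarrow> real)"
    by auto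
  interpret coefficient_ring R by (rule smooth_coefficient_ring)
  interpret P: prolongation R "\<lambda>i. along N (e i)" "\<lambda>i. along N (f i)" TT undefined ?u "\<lambda>x. 1/2" "\<lambda>x. 1/3"
  proof
    fix h :: "'a \<Rightarrow> real" and i j
    show "TT h = along N (e undefined) (along N (f undefined) h) - along N (f undefined) (along N (e undefined) h)" by (rule TT_def)
    assume "h \<in> R"
    then have h: "smooth_map_on N h" by simp
    let ?G = "range (\<lambda>k. along N (e k) h) \<union> range (\<lambda>k. along N (f k) h)"
    show "along N (e i) (along N (f j) h) - along N (f j) (along N (e i) h) - (if i = j then TT h else 0) \<in> mod_span R ?G"
    proof -
      have wef: "\<omega> x (lie_bracket N (e i) (f j) x) = (if i = j then - 1 else 0)" if "x \<in> N" for x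
        using ext_deriv_kills[OF w te tf we wf that, of i j] Oef[OF that, of i j] by (simp split: if_splits)
      \<comment> \<open>\<open>\<omega>\<close> takes the value -1 on \<open>T\<close> and
        \<open>c\<close> on \<open>[e i, f j]\<close>; hence adding \<open>c\<close> times
        \<open>T\<close> leaves a contact field.\<close>
      define c :: real where "c = (if i = j then -1 else 0)"
      let ?Y = "\<lambda>x. lie_bracket N (e i) (f j) x + c *\<^sub>R T x"
      have tY: "tangent_field N ?Y" by (intro tangent_field_add[OF N] tangent_field_scale[OF N] tT B te tf smooth_map_on_const)
      have kY: "kills \<omega> N ?Y"
        using wef wT by (auto simp: kills_def c_def linear_add[OF w_linear] linear_neg[OF w_linear] linear_0[OF w_linear])
      have "along N ?Y h = along N (e i) (along N (f j) h) - along N (f j) (along N (e i) h) - (if i = j then TT h else 0)"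
      proof
        fix x
        show "along N ?Y h x = (along N (e i) (along N (f j) h) - along N (f j) (along N (e i) h) - (if i = j then TT h else 0)) x"
        proof (cases "x \<in> N")
          case x: True
          have l: "linear (mderiv N h x)" by (rule mderiv_linear[OF h x])
          have "along N ?Y h x = along N (lie_bracket N (e i) (f j)) h x + c * along N T h x"
            using x by (simp add: along_def linear_add[OF l] linear_scale[OF l])
          then show ?thesis unfolding br[OF h te tf] TT[OF h] by (simp add: c_def)
        qed (simp add: along_def TT[OF h])
      qed
      then show ?thesis using along_span(2)[OF tY h kY] by simp
    qed
    show "along N (e i) (TT h) - TT (along N (e i) h) \<in> mod_span R (insert (TT h) ?G)"
      using along_span(1)[OF B[OF te tT] h, of i] br[OF h te tT, of i] TT[OF h] TT[OF sm[OF h te, of i]] by simp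
    show "along N (f i) (TT h) - TT (along N (f i) h) \<in> mod_span R (insert (TT h) ?G)"
      using along_span(1)[OF B[OF tf tT] h, of i] br[OF h tf tT, of i] TT[OF h] TT[OF sm[OF h tf, of i]] by simp
  qed (use half third u ee_potential[OF X] ff_potential[OF X] in
      \<open>auto intro: along_derivation te tf smooth_map_on_const\<close>)
  have "P.gens 4 = jets ?u"
    unfolding P.gens_def jets_def by (simp add: TT u sm[OF u tT])
  then have W: "P.gens 4 = jets ?u" "g \<in> mod_span R (P.gens 4)" using span_base[OF g] by auto
  show "along N (e i) g \<in> mod_span R (jets ?u)" "along N (f i) g \<in> mod_span R (jets ?u)" "along N T g \<in> mod_span R (jets ?u)"
    using P.prolongation_closes[OF W(2)] TT[OF jets_smooth[OF u g]] unfolding W(1) by auto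
qed

lemma along_Int:
  assumes "open U"
  shows "along (N \<inter> U) Y g = indicator U * along N Y g"
  by (auto simp: along_def indicator_def mderiv_Int[OF assms])

text \<open>Every tangent field is a combination of \<open>e i\<close>, \<open>f i\<close> and
  \<open>T\<close>, so the jet functions satisfy the closure hypothesis of
  \<open>unique_continuation\<close>. Once they vanish near \<open>q\<close>, so does the expansion
  of \<open>X\<close> in first derivatives of its generating function.\<close>

theorem frame_symmetry_unique:
  assumes X: "frame_symmetry X" and q: "q \<in> N" and z: "\<And>g. g \<in> jets (potential X) \<Longrightarrow> g q = 0"
  shows "\<exists>W. open W \<and> q \<in> W \<and> (\<forall>x\<in>N \<inter> W. X x = 0)"
proof -
  let ?u = "potential X"
  have tX: "tangent_field N X" using X by (simp add: frame_symmetry_def)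
  have u: "smooth_map_on N ?u" by (rule smooth_potential[OF tX])
  have "\<exists>W. open W \<and> q \<in> W \<and> (\<forall>x\<in>N \<inter> W. \<forall>g\<in>jets ?u. g x = 0)"
  proof (rule unique_continuation[where G="jets ?u" and N=N and p=q, OF N q finite_jets])
    show "smooth_map_on N g" "g q = 0" if "g \<in> jets ?u" for g
      using jets_smooth[OF u that] z[OF that] by auto
  next
    fix U Y g assume U: "open U" and Y: "tangent_field (N \<inter> U) Y" and g: "g \<in> jets ?u"
    let ?R = "{a :: 'a \<Rightarrow> real. smooth_map_on (N \<inter> U) a}"
    interpret r: contact_frame k "N \<inter> U" \<omega> e f by (rule contact_frame_Int[OF _ U]) unfold_locales
    interpret coefficient_ring ?R by (rule smooth_coefficient_ring)
    have sub: "x \<in> mod_span ?R G" if "x \<in> mod_span R G" for x G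
      using that
    proof (induction rule: mod_span.induct)
      case (step a g x)
      then show ?case using smooth_map_on_subset[of N a "N \<inter> U"] by (intro mod_span.step) auto
    qed (rule mod_span.zero)
    \<comment> \<open>\<open>along (N \<inter> U)\<close> and \<open>along N\<close> differ by this
      factor, which is constantly 1 on \<open>N \<inter> U\<close> and hence an admissible
      coefficient.\<close>
    have ind: "indicator U \<in> ?R"
      by (auto intro!: smooth_map_on_cong[OF smooth_map_on_const[of _ 1]])
    have res: "along (N \<inter> U) V g \<in> mod_span ?R (jets ?u)" if "along N V g \<in> mod_span R (jets ?u)" for V
      unfolding along_Int[OF U] by (rule span_mult[OF ind sub[OF that]])
    have "along (N \<inter> U) r.T g = along (N \<inter> U) T g"
      unfolding r.T_def T_def by (auto simp: along_def lie_bracket_def mderiv_Int[OF U])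
    then have "insert (along (N \<inter> U) r.T g) (range (\<lambda>i. along (N \<inter> U) (e i) g) \<union> range (\<lambda>i. along (N \<inter> U) (f i) g))
        \<subseteq> mod_span ?R (jets ?u)"
      using res jets_closed[OF X g] by auto
    moreover have "smooth_map_on (N \<inter> U) g"
      using smooth_map_on_subset[OF jets_smooth[OF u g]] by simp
    ultimately show "along (N \<inter> U) Y g \<in> mod_span ?R (jets ?u)"
      using r.along_span(1)[OF Y] span_subset by blast
  qed
  then obtain W where W: "open W" "q \<in> W" "\<And>x g. x \<in> N \<inter> W \<Longrightarrow> g \<in> jets ?u \<Longrightarrow> g x = 0" by blast
  have "X x = 0" if x: "x \<in> N \<inter> W" for x
  proof -
    have "?u x = 0" "along N (e i) ?u x = 0" "along N (f i) ?u x = 0" for i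
      using W(3)[OF x] by (auto simp: jets_def)
    then show ?thesis using symmetry_expansion[OF X, of x] x by (simp add: acoef_def bcoef_def)
  qed
  then show ?thesis using W by blast
qed

lemma along_local:
  assumes "open W" "tangent_field N Y" "\<And>x. x \<in> N \<inter> W \<Longrightarrow> h x = 0" "x \<in> N \<inter> W"
  shows "along N Y h x = 0"
proof -
  have "mderiv N h x (Y x) = mderiv N (\<lambda>x. 0) x (Y x)"
    by (rule mderiv_local[OF assms(1)]) (use assms in auto)
  then show ?thesis using mderiv_const[of x N "Y x" "0::real"] tangent_fieldD(2)[OF assms(2)] assms(4) by (simp add: along_def)
qed

text \<open>Makes vanishing of the jet at a point a property of the germ; together with
  \<open>frame_symmetry_unique\<close> the jet and the germ vanish simultaneously.\<close>

lemma jets_local: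
  assumes W: "open W" and X: "tangent_field N X" "\<And>x. x \<in> N \<inter> W \<Longrightarrow> X x = 0" and g: "g \<in> jets (potential X)" and x: "x \<in> N \<inter> W"
  shows "g x = 0"
proof -
  have u: "potential X x = 0" if "x \<in> N \<inter> W" for x
    using X(2)[OF that] that linear_0[OF w_linear] by (simp add: potential_def)
  note l = along_local[OF W te] along_local[OF W tf] along_local[OF W tT]
  have 1: "along N (e i) (potential X) x = 0" "along N (f i) (potential X) x = 0" "along N T (potential X) x = 0"
    if "x \<in> N \<inter> W" for x i by (rule l u that; assumption?)+
  have 2: "along N (e i) (along N (f j) (potential X)) x = 0" "along N (e i) (along N T (potential X)) x = 0"
     "along N (f i) (along N T (potential X)) x = 0" "along N T (along N T (potential X)) x = 0" for i j
    by (rule l 1 x; assumption?)+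
  show ?thesis using g 1 2 u x by (auto simp: jets_def)
qed

lemma frame_symmetry_add:
  assumes X: "frame_symmetry X" and Y: "frame_symmetry Y"
  shows "frame_symmetry (\<lambda>x. X x + Y x)"
proof -
  have t: "tangent_field N X" "tangent_field N Y" using X Y by (auto simp: frame_symmetry_def)
  note B = tangent_field_lie_bracket[OF N]
  note tt = tangent_fieldD(2)[OF te] tangent_fieldD(2)[OF tf] tangent_fieldD(2)[OF B[OF t(1) te]] tangent_fieldD(2)[OF B[OF t(2) te]]
    tangent_fieldD(2)[OF B[OF t(1) tf]] tangent_fieldD(2)[OF B[OF t(2) tf]]
  show ?thesis
    using X Y t unfolding frame_symmetry_def
    by (simp add: tangent_field_add[OF N] kills_def lie_bracket_add te tf linear_add[OF w_linear] ed_linear(3) tt)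
qed

lemma ed_scale:
  "x \<in> N \<Longrightarrow> u \<in> tangent_space N x \<Longrightarrow> v \<in> tangent_space N x \<Longrightarrow>
    ext_deriv N \<omega> x v (c *\<^sub>R u) = c * ext_deriv N \<omega> x v u"
  by (rule ed_linear(4))

lemma frame_symmetry_scale:
  assumes X: "frame_symmetry X"
  shows "frame_symmetry (\<lambda>x. c *\<^sub>R X x)"
proof -
  have t: "tangent_field N X" using X by (auto simp: frame_symmetry_def)
  note B = tangent_field_lie_bracket[OF N]
  note tt = tangent_fieldD(2)[OF te] tangent_fieldD(2)[OF tf] tangent_fieldD(2)[OF B[OF t(1) te]] tangent_fieldD(2)[OF B[OF t(1) tf]]
  have z: "along N Z (\<lambda>x. c) p = 0" if "tangent_field N Z" for Z p
    using mderiv_const[of p N "Z p" c] tangent_fieldD(2)[OF that] by (simp add: along_def)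
  show ?thesis
    using X t unfolding frame_symmetry_def
    by (simp add: tangent_field_scale[OF N smooth_map_on_const] kills_def lie_bracket_scale smooth_map_on_const z te tf
        linear_scale[OF w_linear] ed_scale tt)
qed

lemma potential_add: "potential (\<lambda>x. X x + Y x) = potential X + potential Y"
  and potential_scale: "potential (\<lambda>x. c *\<^sub>R X x) = (\<lambda>x. c) * potential X"
  by (auto simp: potential_def linear_add[OF w_linear] linear_scale[OF w_linear])

end

section \<open>Symmetries in an adapted frame\<close>

text \<open>Write \<open>w = x + y\<close> with \<open>x\<close> in the positive and
  \<open>y\<close> in the negative part. Orthogonality of \<open>w\<close> to both gives
  \<open>B x x = - B x y = B y y\<close>, where the left side is nonnegative and the right side
  nonpositive.\<close>

lemma split_signature_nondegenerate:
  assumes s: "split_signature n V B" and B: "bilinear B" and sym: "\<And>u v. B u v = B v u"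
    and w: "w \<in> V" "\<And>u. u \<in> V \<Longrightarrow> B u w = 0"
  shows "w = 0"
proof -
  obtain P Q where PQ: "subspace V" "dim V = 2 * n" "subspace P" "subspace Q" "P \<subseteq> V" "Q \<subseteq> V"
    "dim P = n" "dim Q = n" "\<And>v. v \<in> P \<Longrightarrow> v \<noteq> 0 \<Longrightarrow> B v v > 0" "\<And>v. v \<in> Q \<Longrightarrow> v \<noteq> 0 \<Longrightarrow> B v v < 0"
    using s unfolding split_signature_def by blast
  have "P \<inter> Q = {0}" using PQ(3,4,9,10) subspace_0 by fastforce
  then have "dim {x + y |x y. x \<in> P \<and> y \<in> Q} = dim V"
    using dim_sums_Int[OF PQ(3,4)] PQ(2,7,8) by simp
  moreover have "{x + y |x y. x \<in> P \<and> y \<in> Q} \<subseteq> V" using PQ(1,5,6) subspace_add by blast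
  ultimately have "{x + y |x y. x \<in> P \<and> y \<in> Q} = V"
    using subspace_dim_equal[OF subspace_sums[OF PQ(3,4)] PQ(1)] by simp
  then obtain x y where xy: "x \<in> P" "y \<in> Q" "w = x + y" using w(1) by blast
  have l: "B x (x + y) = B x x + B x y" "B y (x + y) = B y x + B y y"
    using bilinear_radd[OF B] by auto
  have "B x x + B x y = 0" "B y x + B y y = 0"
    using w(2)[of x] w(2)[of y] xy PQ(5,6) l by auto
  then have "B x x = B y y" using sym[of x y] by simp
  then have "x = 0" "y = 0" using PQ(9)[OF xy(1)] PQ(10)[OF xy(2)] bilinear_lzero[OF B, of 0] by force+
  then show ?thesis using xy by simp
qed

text \<open>The map \<open>L\<close> collecting the values \<open>B b w\<close> on a basis is
  injective on \<open>V\<close>, hence onto. This makes the definite description in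
  \<open>K_endo\<close> meaningful; \<open>\<phi>\<close> is linear on \<open>V\<close> only, since
  \<open>ext_deriv\<close> is controlled on tangent vectors.\<close>

lemma nondegenerate_representation:
  fixes B :: "'a::euclidean_space \<Rightarrow> 'a \<Rightarrow> real"
  assumes B: "bilinear B" and V: "subspace V" and nd: "\<And>w. w \<in> V \<Longrightarrow> (\<And>u. u \<in> V \<Longrightarrow> B u w = 0) \<Longrightarrow> w = 0"
    and \<phi>: "\<And>u v. u \<in> V \<Longrightarrow> v \<in> V \<Longrightarrow> \<phi> (u + v) = \<phi> u + \<phi> v" "\<And>c u. u \<in> V \<Longrightarrow> \<phi> (c *\<^sub>R u) = c * (\<phi> u :: real)"
  shows "\<exists>!w. w \<in> V \<and> (\<forall>u\<in>V. B u w = \<phi> u)"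
proof -
  obtain C where C: "C \<subseteq> V" "independent C" "V \<subseteq> span C" "card C = dim V" using basis_exists by metis
  have finC: "finite C" using C(2) independent_imp_finite by blast
  define L where "L w = (\<Sum>b\<in>C. B b w *\<^sub>R b)" for w
  have linB: "linear (B u)" "linear (\<lambda>u. B u w)" for u w using B by (auto simp: bilinear_def)
  have L: "linear L" unfolding L_def
    by (rule linearI) (simp_all add: linear_add[OF linB(1)] linear_scale[OF linB(1)] scaleR_add_left sum.distrib scaleR_sum_right)
  have coef: "a b = a' b" if "(\<Sum>b\<in>C. a b *\<^sub>R b) = (\<Sum>b\<in>C. a' b *\<^sub>R b)" "b \<in> C" for a a' b
  proof -
    have "(\<Sum>b\<in>C. (a b - a' b) *\<^sub>R b) = 0" using that by (simp add: scaleR_diff_left sum_subtractf)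
    then have "a b - a' b = 0" using C(2) finC that(2) independent_explicit[of C] by fast
    then show ?thesis by simp
  qed
  have exp: "\<exists>q. u = (\<Sum>b\<in>C. q b *\<^sub>R b)" if "u \<in> V" for u
    using C(3) that span_finite[OF finC] by auto
  have sumB: "B (\<Sum>b\<in>C. q b *\<^sub>R b) w = (\<Sum>b\<in>C. q b * B b w)" for q w
    by (simp add: linear_sum[OF linB(2)] linear_scale[OF linB(2)])
  have LV: "L ` V \<subseteq> V"
    unfolding L_def using C(1) V by (auto intro!: subspace_sum subspace_scale)
  have inj: "w = 0" if "w \<in> V" "L w = 0" for w
  proof (rule nd[OF that(1)])
    fix u assume "u \<in> V"
    have "B b w = 0" if "b \<in> C" for b using coef[of "\<lambda>b. B b w" "\<lambda>b. 0" b] \<open>L w = 0\<close> that by (simp add: L_def)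
    then show "B u w = 0" using exp[OF \<open>u \<in> V\<close>] sumB by auto
  qed
  have injL: "inj_on L V"
  proof (rule inj_onI)
    fix x y assume "x \<in> V" "y \<in> V" "L x = L y"
    then have "x - y = 0" using inj[of "x - y"] V by (simp add: subspace_diff linear_diff[OF L])
    then show "x = y" by simp
  qed
  have sV: "span V = V" using V by (simp add: span_eq_iff)
  have "dim (L ` V) = dim V" by (rule dim_image_eq[OF L]) (simp only: sV injL)
  then have LV': "L ` V = V"
    using subspace_dim_equal[OF linear_subspace_image[OF L V] V LV] by simp
  have "(\<Sum>b\<in>C. \<phi> b *\<^sub>R b) \<in> V" using C(1) V by (auto intro!: subspace_sum subspace_scale)
  then obtain w where w: "w \<in> V" "L w = (\<Sum>b\<in>C. \<phi> b *\<^sub>R b)" using LV' by (metis (no_types, lifting) imageE)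
  have \<phi>sum: "\<phi> (\<Sum>b\<in>D. q b *\<^sub>R b) = (\<Sum>b\<in>D. q b * \<phi> b)" if "D \<subseteq> C" for D q
  proof -
    have "finite D" using that finC finite_subset by blast
    then show ?thesis using that
    proof (induction D rule: finite_induct)
      case empty
      then show ?case using \<phi>(2)[OF subspace_0[OF V], of 0] by simp
    next
      case (insert b D)
      then show ?case using C(1) V by (auto simp: \<phi> subspace_scale subspace_sum subset_eq)
    qed
  qed
  have "B u w = \<phi> u" if u: "u \<in> V" for u
  proof -
    obtain q where q: "u = (\<Sum>b\<in>C. q b *\<^sub>R b)" using exp[OF u] by blast
    have "B b w = \<phi> b" if "b \<in> C" for b using coef[of "\<lambda>b. B b w" \<phi> b] w(2) that by (simp add: L_def)
    then show ?thesis unfolding q sumB \<phi>sum[OF order_refl] by simp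
  qed
  moreover have "w' = w''" if "w' \<in> V" "w'' \<in> V" "\<forall>u\<in>V. B u w' = \<phi> u" "\<forall>u\<in>V. B u w'' = \<phi> u" for w' w''
    using nd[of "w' - w''"] that V by (simp add: subspace_diff linear_diff[OF linB(1)])
  ultimately show ?thesis using w(1) by blast
qed

lemma distr_subspace:
  assumes "submanifold k M" "one_form M \<omega>" "p \<in> M"
  shows "subspace (distr M \<omega> p)"
proof -
  have l: "linear (\<omega> p)" using assms by (auto simp: one_form_def)
  show ?thesis using subspace_tangent_space[OF assms(1,3)]
    unfolding distr_def subspace_def by (simp add: linear_add[OF l] linear_scale[OF l] linear_0[OF l])
qed

lemma K_endo_char:
  assumes M: "submanifold k M" and w: "one_form M \<omega>" and g: "sym_tensor M g"
    and s: "split_signature n (distr M \<omega> p) (g p)" and p: "p \<in> M" and v: "v \<in> distr M \<omega> p"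
  shows "K_endo M \<omega> g p v \<in> distr M \<omega> p"
    "u \<in> distr M \<omega> p \<Longrightarrow> g p u (K_endo M \<omega> g p v) = ext_deriv M \<omega> p u v"
proof -
  have B: "bilinear (g p)" and sym: "g p a b = g p b a" for a b using g p by (auto simp: sym_tensor_def)
  have t: "x \<in> tangent_space M p" if "x \<in> distr M \<omega> p" for x using that by (simp add: distr_def)
  have "\<exists>!w. w \<in> distr M \<omega> p \<and> (\<forall>u\<in>distr M \<omega> p. g p u w = ext_deriv M \<omega> p u v)"
    using ext_deriv_linear(1)[OF w M p] t v
      ext_deriv_linear(2)[OF w M p _ subspace_0[OF subspace_tangent_space[OF M p]]]
    by (intro nondegenerate_representation[OF B distr_subspace[OF M w p] split_signature_nondegenerate[OF s B sym]]) auto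
  from theI'[OF this] show "K_endo M \<omega> g p v \<in> distr M \<omega> p"
    "u \<in> distr M \<omega> p \<Longrightarrow> g p u (K_endo M \<omega> g p v) = ext_deriv M \<omega> p u v"
    unfolding K_endo_def by auto
qed

text \<open>With the second argument in an eigenspace, \<open>g\<close> is proportional to
  \<open>d\<omega>\<close> although one is symmetric and the other skew; this tension is what forces
  symmetries to preserve the subbundles.\<close>

lemma K_eigen_metric:
  assumes M: "submanifold k M" and w: "one_form M \<omega>" and g: "sym_tensor M g"
    and s: "split_signature n (distr M \<omega> p) (g p)" and p: "p \<in> M" and u: "u \<in> distr M \<omega> p" and v: "v \<in> K_eigen M \<omega> g c \<epsilon> p"
  shows "\<epsilon> * g p u v = c p * ext_deriv M \<omega> p u v"
proof -
  have B: "linear (g p u)" using g p by (auto simp: sym_tensor_def bilinear_def)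
  have v': "v \<in> distr M \<omega> p" "c p *\<^sub>R K_endo M \<omega> g p v = \<epsilon> *\<^sub>R v" using v by (auto simp: K_eigen_def)
  have "\<epsilon> * g p u v = g p u (c p *\<^sub>R K_endo M \<omega> g p v)" by (simp add: v'(2) linear_scale[OF B])
  also have "\<dots> = c p * ext_deriv M \<omega> p u v"
    using K_endo_char(2)[OF M w g s p v'(1) u] by (simp add: linear_scale[OF B])
  finally show ?thesis .
qed

lemma span_pair_independent:
  fixes u v :: "'a::euclidean_space"
  assumes "dim (span {u, v}) = 2" "a *\<^sub>R u + b *\<^sub>R v = 0"
  shows "a = 0" "b = 0"
proof -
  have *: "a = 0" if "dim (span {u, v}) = 2" "a *\<^sub>R u + b *\<^sub>R v = 0" for a b :: real and u v :: 'a
  proof (rule ccontr)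
    assume a: "a \<noteq> 0"
    have "a *\<^sub>R u = (- b) *\<^sub>R v" using that(2) by (simp add: eq_neg_iff_add_eq_0)
    then have "(1 / a) *\<^sub>R (a *\<^sub>R u) = (1 / a) *\<^sub>R ((- b) *\<^sub>R v)" by simp
    then have "u = (1 / a) *\<^sub>R ((- b) *\<^sub>R v)" using a by simp
    moreover have "(1 / a) *\<^sub>R ((- b) *\<^sub>R v) \<in> span {v}" by (intro span_scale span_base) simp
    ultimately have "u \<in> span {v}" by simp
    then have "span {u, v} = span {v}" using span_redundant by metis
    then have "dim (span {u, v}) \<le> card {v}" using dim_le_card'[of "{v}"] by (simp add: dim_span)
    then show False using that(1) by simp
  qed
  show "a = 0" using *[OF assms] .
  show "b = 0" using *[of v u b a] assms by (simp add: insert_commute add.commute)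
qed

text \<open>Families with two members, indexed by the type \<open>2\<close>, which indexes the
  frames in dimension 5.\<close>

definition pick :: "'b \<Rightarrow> 'b \<Rightarrow> 2 \<Rightarrow> 'b" where
  "pick x y i = (if i = 1 then x else y)"

lemma pick_simps [simp]: "pick x y 1 = x" "pick x y 2 = y"
  by (auto simp: pick_def)

lemma span_pairE:
  assumes "v \<in> span {x, y :: 'a::real_vector}"
  obtains a b where "v = a *\<^sub>R x + b *\<^sub>R y"
  using assms by (auto simp: span_breakdown_eq algebra_simps)

text \<open>As both subbundles are isotropic and \<open>d\<omega>\<close> is nondegenerate, the
  matrix of \<open>d\<omega>\<close> between the given local bases is invertible. Its inverse,
  applied to the basis of \<open>D2\<close>, gives a smooth dual frame.\<close>

lemma contact_frame_pair:
  fixes N :: "'a::euclidean_space set"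
  assumes N: "submanifold k N" and w: "one_form N \<omega>"
    and t: "tangent_field N E1" "tangent_field N E2" "tangent_field N F1" "tangent_field N F2"
    and D1: "\<And>x. x \<in> N \<Longrightarrow> D1 x = span {E1 x, E2 x} \<and> dim (D1 x) = 2"
    and D2: "\<And>x. x \<in> N \<Longrightarrow> D2 x = span {F1 x, F2 x} \<and> dim (D2 x) = 2"
    and D: "\<And>x. x \<in> N \<Longrightarrow> {u + v |u v. u \<in> D1 x \<and> v \<in> D2 x} = distr N \<omega> x"
    and O1: "\<And>x u v. x \<in> N \<Longrightarrow> u \<in> D1 x \<Longrightarrow> v \<in> D1 x \<Longrightarrow> ext_deriv N \<omega> x u v = 0"
    and O2: "\<And>x u v. x \<in> N \<Longrightarrow> u \<in> D2 x \<Longrightarrow> v \<in> D2 x \<Longrightarrow> ext_deriv N \<omega> x u v = 0"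
    and nd: "\<And>x u. x \<in> N \<Longrightarrow> u \<in> distr N \<omega> x \<Longrightarrow> (\<And>v. v \<in> distr N \<omega> x \<Longrightarrow> ext_deriv N \<omega> x u v = 0) \<Longrightarrow> u = 0"
  shows "\<exists>f :: 2 \<Rightarrow> 'a \<Rightarrow> 'a. contact_frame k N \<omega> (pick E1 E2) f \<and> (\<forall>x\<in>N. \<forall>i. f i x \<in> D2 x)"
proof -
  let ?O = "ext_deriv N \<omega>"
  define B11 where "B11 x = ?O x (E1 x) (F1 x)" for x
  define B12 where "B12 x = ?O x (E1 x) (F2 x)" for x
  define B21 where "B21 x = ?O x (E2 x) (F1 x)" for x
  define B22 where "B22 x = ?O x (E2 x) (F2 x)" for x
  note B = B11_def B12_def B21_def B22_def
  define d where "d x = B11 x * B22 x - B12 x * B21 x" for x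
  have sB: "smooth_map_on N B11" "smooth_map_on N B12" "smooth_map_on N B21" "smooth_map_on N B22"
    unfolding B by (intro ext_deriv_smooth[OF w N] t)+
  have sd: "smooth_map_on N d"
    unfolding d_def by (intro smooth_map_on_diff smooth_map_on_mult sB)
  have inD1: "E1 x \<in> D1 x" "E2 x \<in> D1 x" and inD2: "F1 x \<in> D2 x" "F2 x \<in> D2 x" if "x \<in> N" for x
    using D1[OF that] D2[OF that] by (auto intro: span_base)
  have sub: "D1 x \<subseteq> distr N \<omega> x" "D2 x \<subseteq> distr N \<omega> x" if "x \<in> N" for x
  proof -
    have "0 \<in> D1 x" "0 \<in> D2 x" using D1[OF that] D2[OF that] by (auto intro: span_zero)
    then show "D1 x \<subseteq> distr N \<omega> x" "D2 x \<subseteq> distr N \<omega> x" unfolding D[OF that, symmetric] by force+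
  qed
  have tan: "v \<in> tangent_space N x" if "v \<in> distr N \<omega> x" for v x using that by (simp add: distr_def)
  note tt = tangent_fieldD(2)[OF t(1)] tangent_fieldD(2)[OF t(2)] tangent_fieldD(2)[OF t(3)] tangent_fieldD(2)[OF t(4)]
  have ts: "subspace (tangent_space N x)" if "x \<in> N" for x using subspace_tangent_space[OF N that] .
  have lin: "?O x (a *\<^sub>R u + b *\<^sub>R u') v = a * ?O x u v + b * ?O x u' v"
    "?O x v (a *\<^sub>R u + b *\<^sub>R u') = a * ?O x v u + b * ?O x v u'"
    if "x \<in> N" "u \<in> tangent_space N x" "u' \<in> tangent_space N x" "v \<in> tangent_space N x" for x a b u u' v
    using ext_deriv_linear[OF w N that(1)] ext_deriv_linear_right[OF w N that(1)] that ts
    by (simp_all add: subspace_scale)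
  \<comment> \<open>A relation between the rows of the matrix yields a vector of \<open>D1\<close>
    that is \<open>d\<omega>\<close>-orthogonal to \<open>D2\<close> and, by isotropy, to
    \<open>D1\<close>.\<close>
  have key: "a = 0 \<and> b = 0" if x: "x \<in> N" and z: "a * B11 x + b * B21 x = 0" "a * B12 x + b * B22 x = 0" for x a b
  proof -
    let ?v = "a *\<^sub>R E1 x + b *\<^sub>R E2 x"
    have vD: "?v \<in> D1 x"
      unfolding conjunct1[OF D1[OF x]] by (intro span_add span_scale span_base) auto
    have "?v = 0"
    proof (rule nd[OF x])
      show "?v \<in> distr N \<omega> x" using vD sub[OF x] by auto
      fix v assume "v \<in> distr N \<omega> x"
      then obtain p q where pq: "p \<in> D1 x" "q \<in> D2 x" "v = p + q" using D[OF x] by blast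
      then obtain \<alpha> \<beta> where q: "q = \<alpha> *\<^sub>R F1 x + \<beta> *\<^sub>R F2 x" using D2[OF x] span_pairE by metis
      have z0: "?O x ?v (F1 x) = 0" "?O x ?v (F2 x) = 0"
        using lin(1)[OF x] tt x z by (simp_all add: B)
      have "?O x ?v q = \<alpha> * ?O x ?v (F1 x) + \<beta> * ?O x ?v (F2 x)"
        unfolding q using lin(2)[OF x] tt x vD sub[OF x] tan by auto
      then have "?O x ?v q = 0" by (simp add: z0)
      moreover have "?O x ?v p = 0" by (rule O1[OF x vD pq(1)])
      moreover have "?O x ?v v = ?O x ?v p + ?O x ?v q"
        unfolding pq(3) using pq vD sub[OF x] tan x by (intro ext_deriv_linear_right(1)[OF w N x]) auto
      ultimately show "?O x ?v v = 0" by simp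
    qed
    then show ?thesis using span_pair_independent[of "E1 x" "E2 x" a b] D1[OF x] by auto
  qed
  have nz: "d x \<noteq> 0" if x: "x \<in> N" for x
  proof
    assume "d x = 0"
    then have d0: "B11 x * B22 x = B12 x * B21 x" by (simp add: d_def)
    \<comment> \<open>With zero determinant the entries themselves provide row relations, so by
      \<open>key\<close> they all vanish; then 1, 0 is a relation as well, against
      \<open>key\<close>.\<close>
    have 1: "B22 x = 0 \<and> - B12 x = 0" using key[OF x, of "B22 x" "- B12 x"] d0 by (simp add: algebra_simps)
    have 2: "B21 x = 0 \<and> - B11 x = 0" using key[OF x, of "B21 x" "- B11 x"] d0 by (simp add: algebra_simps)
    show False using key[OF x, of 1 0] 1 2 by simp
  qed
  \<comment> \<open>Cramer's rule: the coefficients of \<open>f1\<close> and \<open>f2\<close> are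
    the columns of the inverse matrix.\<close>
  define f1 where "f1 x = (B22 x * inverse (d x)) *\<^sub>R F1 x + (- B21 x * inverse (d x)) *\<^sub>R F2 x" for x
  define f2 where "f2 x = (- B12 x * inverse (d x)) *\<^sub>R F1 x + (B11 x * inverse (d x)) *\<^sub>R F2 x" for x
  have tf: "tangent_field N f1" "tangent_field N f2"
    unfolding f1_def f2_def
    by (intro tangent_field_add[OF N] tangent_field_scale[OF N] smooth_map_on_mult smooth_map_on_minus smooth_map_on_inverse sd sB nz t; assumption)+
  have fD: "f1 x \<in> D2 x" "f2 x \<in> D2 x" if "x \<in> N" for x
    unfolding conjunct1[OF D2[OF that]] f1_def f2_def by (intro span_add span_scale span_base; simp)+
  have det_inverse: "B11 x * B22 x * inverse (d x) - B12 x * B21 x * inverse (d x) = 1" if "x \<in> N" for x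
    using nz[OF that] by (simp add: d_def left_diff_distrib[symmetric])
  have F: "F1 x = B11 x *\<^sub>R f1 x + B21 x *\<^sub>R f2 x" "F2 x = B12 x *\<^sub>R f1 x + B22 x *\<^sub>R f2 x" if x: "x \<in> N" for x
  proof -
    note e = det_inverse[OF x]
    have "B11 x *\<^sub>R f1 x + B21 x *\<^sub>R f2 x = (B11 x * B22 x * inverse (d x) - B12 x * B21 x * inverse (d x)) *\<^sub>R F1 x"
      unfolding f1_def f2_def by (simp add: algebra_simps)
    then show "F1 x = B11 x *\<^sub>R f1 x + B21 x *\<^sub>R f2 x" unfolding e by simp
    have "B12 x *\<^sub>R f1 x + B22 x *\<^sub>R f2 x = (B11 x * B22 x * inverse (d x) - B12 x * B21 x * inverse (d x)) *\<^sub>R F2 x"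
      unfolding f1_def f2_def by (simp add: algebra_simps)
    then show "F2 x = B12 x *\<^sub>R f1 x + B22 x *\<^sub>R f2 x" unfolding e by simp
  qed
  have Oval: "?O x (E1 x) (f1 x) = 1" "?O x (E1 x) (f2 x) = 0" "?O x (E2 x) (f1 x) = 0" "?O x (E2 x) (f2 x) = 1" if x: "x \<in> N" for x
    unfolding f1_def f2_def using tt x det_inverse[OF x]
    by (simp_all only: lin(2)[OF x] B[symmetric]) (simp_all add: algebra_simps)
  have "contact_frame k N \<omega> (pick E1 E2) (pick f1 f2)"
  proof
    fix x :: 'a and i j :: 2
    show "tangent_field N (pick E1 E2 i)" "tangent_field N (pick f1 f2 i)" using t tf by (auto simp: pick_def)
    show "kills \<omega> N (pick E1 E2 i)" using inD1 sub by (auto simp: kills_def pick_def distr_def subset_eq)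
    show "kills \<omega> N (pick f1 f2 i)" using fD sub by (auto simp: kills_def pick_def distr_def subset_eq)
    assume x: "x \<in> N"
    show "?O x (pick E1 E2 i x) (pick E1 E2 j x) = 0" using O1[OF x] inD1[OF x] by (auto simp: pick_def)
    show "?O x (pick f1 f2 i x) (pick f1 f2 j x) = 0" using O2[OF x] fD[OF x] by (auto simp: pick_def)
    show "?O x (pick E1 E2 i x) (pick f1 f2 j x) = (if i = j then 1 else 0)"
      using Oval[OF x] exhaust_2[of i] exhaust_2[of j] by (auto simp: pick_def)
  next
    fix x v assume x: "x \<in> N" and v: "v \<in> distr N \<omega> x"
    then obtain p q where pq: "p \<in> D1 x" "q \<in> D2 x" "v = p + q" using D[OF x] by blast
    obtain a b where p: "p = a *\<^sub>R E1 x + b *\<^sub>R E2 x" using pq(1) D1[OF x] span_pairE by metis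
    obtain \<alpha> \<beta> where q: "q = \<alpha> *\<^sub>R F1 x + \<beta> *\<^sub>R F2 x" using pq(2) D2[OF x] span_pairE by metis
    have "q = (\<alpha> * B11 x + \<beta> * B12 x) *\<^sub>R f1 x + (\<alpha> * B21 x + \<beta> * B22 x) *\<^sub>R f2 x"
      unfolding q by (subst F(1)[OF x], subst F(2)[OF x]) (simp add: algebra_simps)
    then show "\<exists>a b. v = (\<Sum>i\<in>UNIV. a i *\<^sub>R pick E1 E2 i x) + (\<Sum>i\<in>UNIV. b i *\<^sub>R pick f1 f2 i x)"
      unfolding pq(3) p
      by (intro exI[of _ "pick a b"] exI[of _ "pick (\<alpha> * B11 x + \<beta> * B12 x) (\<alpha> * B21 x + \<beta> * B22 x)"])
        (simp add: sum_2)
  qed (use N w in auto)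
  then show ?thesis using fD by (intro exI[of _ "pick f1 f2"]) (auto simp: pick_def)
qed


text \<open>Local bases of the two eigenbundles on a common neighbourhood, made dual. The last two
  conclusions record \<open>K_eigen_metric\<close> and stand in for the endomorphism
  \<open>K\<close> from here on.\<close>

lemma legendrean_frame:
  fixes M :: "'a::euclidean_space set"
  assumes L: "legendrean_contact 2 M \<omega> g" and p: "p \<in> M"
  obtains W and e f :: "2 \<Rightarrow> 'a \<Rightarrow> 'a" and c where "open W" "p \<in> W" "contact_frame 5 (M \<inter> W) \<omega> e f"
    "\<And>x. x \<in> M \<inter> W \<Longrightarrow> c x \<noteq> 0"
    "\<And>x v i. x \<in> M \<inter> W \<Longrightarrow> v \<in> distr M \<omega> x \<Longrightarrow> g x v (e i x) = c x * ext_deriv M \<omega> x v (e i x)"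
    "\<And>x v i. x \<in> M \<inter> W \<Longrightarrow> v \<in> distr M \<omega> x \<Longrightarrow> g x v (f i x) = - c x * ext_deriv M \<omega> x v (f i x)"
proof -
  obtain c where c: "contact_form 2 M \<omega>" "sym_tensor M g" "\<And>x. x \<in> M \<Longrightarrow> split_signature 2 (distr M \<omega> x) (g x)"
    "\<And>x. x \<in> M \<Longrightarrow> c x \<noteq> 0" "legendrean_splitting 2 M \<omega> (K_eigen M \<omega> g c 1) (K_eigen M \<omega> g c (-1))"
    using L unfolding legendrean_contact_def by blast
  let ?D1 = "K_eigen M \<omega> g c 1" and ?D2 = "K_eigen M \<omega> g c (-1)"
  have M: "submanifold 5 M" and w: "one_form M \<omega>"
    and nd: "\<And>x u. x \<in> M \<Longrightarrow> u \<in> distr M \<omega> x \<Longrightarrow> (\<And>v. v \<in> distr M \<omega> x \<Longrightarrow> ext_deriv M \<omega> x u v = 0) \<Longrightarrow> u = 0"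
    using c(1) by (auto simp: contact_form_def)
  have sb: "subbundle 2 M ?D1" "subbundle 2 M ?D2"
    and sp: "\<And>x. x \<in> M \<Longrightarrow> {u + v |u v. u \<in> ?D1 x \<and> v \<in> ?D2 x} = distr M \<omega> x"
      "\<And>x u v. x \<in> M \<Longrightarrow> u \<in> ?D1 x \<Longrightarrow> v \<in> ?D1 x \<Longrightarrow> ext_deriv M \<omega> x u v = 0"
      "\<And>x u v. x \<in> M \<Longrightarrow> u \<in> ?D2 x \<Longrightarrow> v \<in> ?D2 x \<Longrightarrow> ext_deriv M \<omega> x u v = 0"
    using c(5) by (auto simp: legendrean_splitting_def)
  have two: "(\<lambda>i. h i q) ` {..<2::nat} = {h 0 q, h 1 q}" for h :: "nat \<Rightarrow> 'a \<Rightarrow> 'a" and q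
    by (auto simp: lessThan_Suc numeral_2_eq_2)
  have local: "\<exists>U E1 E2. open U \<and> p \<in> U \<and> tangent_field (M \<inter> U) E1 \<and> tangent_field (M \<inter> U) E2 \<and>
      (\<forall>x\<in>M \<inter> U. D x = span {E1 x, E2 x} \<and> dim (D x) = 2)" if D: "subbundle 2 M D" for D
  proof -
    obtain U and h :: "nat \<Rightarrow> 'a \<Rightarrow> 'a" where U: "open U" "p \<in> U" "\<And>i. i < 2 \<Longrightarrow> smooth_map_on (M \<inter> U) (h i)"
      "\<And>q. q \<in> M \<inter> U \<Longrightarrow> D q = span {h 0 q, h 1 q}"
    proof -
      from bspec[OF conjunct2[OF D[unfolded subbundle_def two]] p]
      obtain U and h :: "nat \<Rightarrow> 'a \<Rightarrow> 'a" where "open U" "p \<in> U" "\<forall>i<2. smooth_map_on (M \<inter> U) (h i)"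
        "\<forall>q\<in>M \<inter> U. D q = span {h 0 q, h 1 q}" by (elim exE conjE) (rule that)
      then show ?thesis by (intro that[of U h]) auto
    qed
    have d: "dim (D q) = 2" "D q \<subseteq> tangent_space M q" if "q \<in> M" for q
      using D that unfolding subbundle_def by blast+
    have "h 0 q \<in> tangent_space (M \<inter> U) q" "h 1 q \<in> tangent_space (M \<inter> U) q" if "q \<in> M \<inter> U" for q
      using U(4)[OF that] d(2)[of q] that span_superset[of "{h 0 q, h 1 q}"] tangent_space_Int[OF U(1), of q M] by auto
    then have "tangent_field (M \<inter> U) (h 0)" "tangent_field (M \<inter> U) (h 1)" using U(3)[of 0] U(3)[of 1] by (auto simp: tangent_field_def)
    moreover have "\<forall>x\<in>M \<inter> U. D x = span {h 0 x, h 1 x} \<and> dim (D x) = 2"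
      by (intro ballI conjI U(4) d(1)) auto
    ultimately show ?thesis using U(1,2) by blast
  qed
  obtain U1 E1 E2 where U1: "open U1" "p \<in> U1" "tangent_field (M \<inter> U1) E1" "tangent_field (M \<inter> U1) E2"
    "\<And>x. x \<in> M \<inter> U1 \<Longrightarrow> ?D1 x = span {E1 x, E2 x} \<and> dim (?D1 x) = 2" using local[OF sb(1)] by blast
  obtain U2 F1 F2 where U2: "open U2" "p \<in> U2" "tangent_field (M \<inter> U2) F1" "tangent_field (M \<inter> U2) F2"
    "\<And>x. x \<in> M \<inter> U2 \<Longrightarrow> ?D2 x = span {F1 x, F2 x} \<and> dim (?D2 x) = 2" using local[OF sb(2)] by blast
  let ?W = "U1 \<inter> U2"
  have W: "open ?W" "p \<in> ?W" using U1 U2 by auto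
  have sub: "M \<inter> ?W \<subseteq> M" by auto
  have tE: "tangent_field (M \<inter> ?W) E1" "tangent_field (M \<inter> ?W) E2"
    using tangent_field_Int[OF U2(1) U1(3)] tangent_field_Int[OF U2(1) U1(4)] by (simp_all add: Int_assoc)
  have tF: "tangent_field (M \<inter> ?W) F1" "tangent_field (M \<inter> ?W) F2"
    using tangent_field_Int[OF U1(1) U2(3)] tangent_field_Int[OF U1(1) U2(4)] by (simp_all add: Int_ac)
  have dI: "distr (M \<inter> ?W) \<omega> x = distr M \<omega> x" "ext_deriv (M \<inter> ?W) \<omega> x = ext_deriv M \<omega> x" if "x \<in> M \<inter> ?W" for x
    using distr_Int[OF W(1)] ext_deriv_Int[OF W(1)] that by (auto simp: fun_eq_iff)
  have "\<exists>f :: 2 \<Rightarrow> 'a \<Rightarrow> 'a. contact_frame 5 (M \<inter> ?W) \<omega> (pick E1 E2) f \<and> (\<forall>x\<in>M \<inter> ?W. \<forall>i. f i x \<in> ?D2 x)"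
  proof (rule contact_frame_pair[where ?D1.0="?D1" and ?D2.0="?D2", OF submanifold_Int[OF M W(1)] one_form_subset[OF w sub] tE tF])
    fix x assume x: "x \<in> M \<inter> ?W"
    show "?D1 x = span {E1 x, E2 x} \<and> dim (?D1 x) = 2" by (rule U1(5)) (use x in auto)
    show "?D2 x = span {F1 x, F2 x} \<and> dim (?D2 x) = 2" by (rule U2(5)) (use x in auto)
    show "{u + v |u v. u \<in> ?D1 x \<and> v \<in> ?D2 x} = distr (M \<inter> ?W) \<omega> x" using sp(1)[of x] dI(1)[OF x] x by auto
    show "ext_deriv (M \<inter> ?W) \<omega> x u v = 0" if "u \<in> ?D1 x" "v \<in> ?D1 x" for u v using sp(2)[of x u v] that dI(2)[OF x] x by auto
    show "ext_deriv (M \<inter> ?W) \<omega> x u v = 0" if "u \<in> ?D2 x" "v \<in> ?D2 x" for u v using sp(3)[of x u v] that dI(2)[OF x] x by auto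
    show "u = 0" if "u \<in> distr (M \<inter> ?W) \<omega> x" "\<And>v. v \<in> distr (M \<inter> ?W) \<omega> x \<Longrightarrow> ext_deriv (M \<inter> ?W) \<omega> x u v = 0" for u
      using nd[of x u] that dI[OF x] x by auto
  qed
  then obtain f :: "2 \<Rightarrow> 'a \<Rightarrow> 'a" where f: "contact_frame 5 (M \<inter> ?W) \<omega> (pick E1 E2) f" "\<And>x i. x \<in> M \<inter> ?W \<Longrightarrow> f i x \<in> ?D2 x"
    by blast
  show ?thesis
  proof (rule that[OF W f(1), of c])
    fix x v and i :: 2 assume x: "x \<in> M \<inter> ?W" and v: "v \<in> distr M \<omega> x"
    have xM: "x \<in> M" using x by simp
    have "pick E1 E2 i x \<in> ?D1 x" using U1(5)[of x] x span_superset[of "{E1 x, E2 x}"] by (auto simp: pick_def)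
    then show "g x v (pick E1 E2 i x) = c x * ext_deriv M \<omega> x v (pick E1 E2 i x)"
      using K_eigen_metric[OF M w c(2) c(3)[OF xM] xM v] by fastforce
    show "g x v (f i x) = - c x * ext_deriv M \<omega> x v (f i x)"
      using K_eigen_metric[OF M w c(2) c(3)[OF xM] xM v f(2)[OF x, of i]] by linarith
  qed (use c(4) in auto)
qed

text \<open>A symmetry preserves both Legendrean subbundles: it rescales the contact form, hence \<open>\<Omega>\<close> on the contact
  distribution, and it rescales \<open>g\<close>; the two invariances have opposite symmetry types on each subbundle.\<close>

lemma symmetry_frame_symmetry:
  fixes e f :: "2 \<Rightarrow> 'a::euclidean_space \<Rightarrow> 'a"
  assumes F: "contact_frame k (M \<inter> W) \<omega> e f" and g: "sym_tensor M g"
    and c: "\<And>x. x \<in> M \<inter> W \<Longrightarrow> c x \<noteq> 0"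
    and ge: "\<And>x v i. x \<in> M \<inter> W \<Longrightarrow> v \<in> distr M \<omega> x \<Longrightarrow> g x v (e i x) = c x * ext_deriv M \<omega> x v (e i x)"
    and gf: "\<And>x v i. x \<in> M \<inter> W \<Longrightarrow> v \<in> distr M \<omega> x \<Longrightarrow> g x v (f i x) = - c x * ext_deriv M \<omega> x v (f i x)"
    and W: "open W" and U: "open U" "W \<subseteq> U" and X: "X \<in> symmetries (M \<inter> U) \<omega> g"
  shows "contact_frame.frame_symmetry (M \<inter> W) \<omega> e f X"
proof -
  let ?N = "M \<inter> W"
  interpret contact_frame k ?N \<omega> e f by fact
  obtain r q \<mu> where vX: "vector_field (M \<inter> U) X"
    and r: "\<And>p u. p \<in> M \<inter> U \<Longrightarrow> u \<in> tangent_space (M \<inter> U) p \<Longrightarrow> lie_deriv_form (M \<inter> U) X \<omega> p u = r p * \<omega> p u"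
    and q: "\<And>p u v. p \<in> M \<inter> U \<Longrightarrow> u \<in> tangent_space (M \<inter> U) p \<Longrightarrow> v \<in> tangent_space (M \<inter> U) p \<Longrightarrow>
      lie_deriv_tensor (M \<inter> U) X g p u v = q p * g p u v + (\<mu> p u * \<omega> p v + \<omega> p u * \<mu> p v) / 2"
    using X unfolding symmetries_def by blast
  have sub: "?N = (M \<inter> U) \<inter> W" using U(2) by auto
  have tX: "tangent_field ?N X"
  proof -
    have "tangent_field (M \<inter> U) X" using vX by (auto simp: vector_field_def tangent_field_def)
    from tangent_field_Int[OF W this] show ?thesis using sub by simp
  qed
  have loc: "x \<in> M \<inter> U" "tangent_space (M \<inter> U) x = tangent_space ?N x" if "x \<in> ?N" for x
    using that U(2) tangent_space_Int[OF W, of x "M \<inter> U"] sub by auto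
  have md: "mderiv (M \<inter> U) h x v = mderiv ?N h x v" if "x \<in> ?N" for h :: "'a \<Rightarrow> 'c::real_normed_vector" and x v
    using mderiv_Int[OF W, of x "M \<inter> U" h v] that sub by simp
  have dI: "distr ?N \<omega> x = distr M \<omega> x" "ext_deriv ?N \<omega> x = ext_deriv M \<omega> x" if "x \<in> ?N" for x
    using distr_Int[OF W] ext_deriv_Int[OF W] that by (auto simp: fun_eq_iff)
  note B = tangent_field_lie_bracket[OF N]
  have L1: "kills \<omega> ?N (lie_bracket ?N X V)" if V: "tangent_field ?N V" "kills \<omega> ?N V" for V
    unfolding kills_def
  proof
    fix x assume x: "x \<in> ?N"
    note tv = tangent_fieldD(2)[OF V(1) x] tangent_fieldD(2)[OF tX x]
    have "mderiv ?N (\<lambda>q. \<omega> q (V q)) x (X x) = 0"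
      using along_zero_on[OF tX, of "\<lambda>q. \<omega> q (V q)" x] V(2) x by (simp add: kills_def along_def)
    moreover have "lie_deriv_form (M \<inter> U) X \<omega> x (V x) = 0"
      using r[OF loc(1)[OF x], of "V x"] loc(2)[OF x] tv V(2) x by (simp add: kills_def)
    ultimately show "\<omega> x (lie_bracket ?N X V x) = 0"
      using one_form_product_rule[OF w tangent_fieldD(1)[OF V(1)] x tv(2)] x
      by (simp add: lie_deriv_form_def md lie_bracket_def linear_diff[OF w_linear[OF x]])
  qed
  have gN: "sym_tensor ?N g"
  proof -
    have "smooth_map_on ?N (\<lambda>p. g p u v)" for u v
      using g smooth_map_on_subset[of M "\<lambda>p. g p u v" ?N] by (auto simp: sym_tensor_def)
    then show ?thesis using g by (auto simp: sym_tensor_def)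
  qed
  have L2: "g x (lie_bracket ?N X V x) (Z x) + g x (V x) (lie_bracket ?N X Z x) = 0"
    if V: "tangent_field ?N V" "kills \<omega> ?N V" and Z: "tangent_field ?N Z" "kills \<omega> ?N Z"
      and zero: "\<And>x. x \<in> ?N \<Longrightarrow> g x (V x) (Z x) = 0" and x: "x \<in> ?N" for V Z x
  proof -
    note tv = tangent_fieldD(2)[OF V(1) x] tangent_fieldD(2)[OF Z(1) x] tangent_fieldD(2)[OF tX x]
    have bl: "bilinear (g x)" using gN x by (auto simp: sym_tensor_def)
    have "mderiv ?N (\<lambda>q. g q (V q) (Z q)) x (X x) = 0"
      using along_zero_on[OF tX, of "\<lambda>q. g q (V q) (Z q)" x] zero x by (simp add: along_def)
    moreover have "lie_deriv_tensor (M \<inter> U) X g x (V x) (Z x) = 0"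
      using q[OF loc(1)[OF x], of "V x" "Z x"] loc(2)[OF x] tv V(2) Z(2) zero x by (simp add: kills_def)
    ultimately show ?thesis
      using sym_tensor_product_rule[OF gN tangent_fieldD(1)[OF V(1)] tangent_fieldD(1)[OF Z(1)] x tv(3)] x
      by (simp add: lie_deriv_tensor_def md lie_bracket_def bilinear_lsub[OF bl] bilinear_rsub[OF bl])
  qed
  have L3: "ext_deriv ?N \<omega> x (Z x) (lie_bracket ?N X V x) = 0"
    if V: "tangent_field ?N V" "kills \<omega> ?N V" and Z: "tangent_field ?N Z" "kills \<omega> ?N Z"
      and O: "\<And>x. x \<in> ?N \<Longrightarrow> ext_deriv ?N \<omega> x (V x) (Z x) = 0"
      and gV: "\<And>x v. x \<in> ?N \<Longrightarrow> v \<in> distr M \<omega> x \<Longrightarrow> g x v (V x) = \<epsilon> * c x * ext_deriv M \<omega> x v (V x)"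
      and gZ: "\<And>x v. x \<in> ?N \<Longrightarrow> v \<in> distr M \<omega> x \<Longrightarrow> g x v (Z x) = \<epsilon> * c x * ext_deriv M \<omega> x v (Z x)"
      and \<epsilon>: "\<epsilon> \<noteq> 0" and x: "x \<in> ?N" for V Z \<epsilon> x
  proof -
    have kd: "Y x \<in> distr M \<omega> x" if "tangent_field ?N Y" "kills \<omega> ?N Y" "x \<in> ?N" for Y x
      using dI(1)[OF that(3)] tangent_fieldD(2)[OF that(1,3)] that(2,3) by (auto simp: distr_def kills_def)
    have sg: "g x u v = g x v u" for u v using gN x by (auto simp: sym_tensor_def)
    let ?a = "ext_deriv ?N \<omega> x (lie_bracket ?N X V x) (Z x)" and ?b = "ext_deriv ?N \<omega> x (V x) (lie_bracket ?N X Z x)"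
    have kVZ: "kills \<omega> ?N (lie_bracket ?N V Z)"
      using ext_deriv_kills[OF w V(1) Z(1) V(2) Z(2)] O by (auto simp: kills_def)
    have kXV: "kills \<omega> ?N (lie_bracket ?N X V)" and kXZ: "kills \<omega> ?N (lie_bracket ?N X Z)"
      using L1 V Z by auto
    \<comment> \<open>By the Jacobi identity the sum is \<open>- \<omega> [X, [V, Z]]\<close>;
      isotropy puts \<open>[V, Z]\<close> into the contact distribution, which \<open>X\<close>
      preserves.\<close>
    have "?a + ?b = - \<omega> x (lie_bracket ?N (lie_bracket ?N X V) Z x + lie_bracket ?N V (lie_bracket ?N X Z) x)"
      using ext_deriv_kills[OF w B[OF tX V(1)] Z(1) kXV Z(2) x] ext_deriv_kills[OF w V(1) B[OF tX Z(1)] V(2) kXZ x]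
      by (simp add: linear_add[OF w_linear[OF x]])
    also have "\<dots> = 0"
      unfolding jacobi[OF N tX V(1) Z(1) x] using L1[OF B[OF V(1) Z(1)] kVZ] x by (simp add: kills_def)
    finally have s1: "?a + ?b = 0" .
    have g0: "g y (V y) (Z y) = 0" if "y \<in> ?N" for y
      using gZ[OF that kd[OF V that]] O[OF that] dI(2)[OF that] by simp
    have "g x (lie_bracket ?N X V x) (Z x) = \<epsilon> * c x * ?a"
      using gZ[OF x kd[OF B[OF tX V(1)] kXV x]] dI(2)[OF x] by simp
    moreover have "g x (V x) (lie_bracket ?N X Z x) = - (\<epsilon> * c x * ?b)"
      using gV[OF x kd[OF B[OF tX Z(1)] kXZ x]] dI(2)[OF x] sg ext_deriv_skew[of ?N \<omega> x "V x"] by simp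
    \<comment> \<open>In the second term the arguments of the symmetric \<open>g\<close> were
      exchanged; \<open>d\<omega>\<close> changes sign under this, hence a difference in place of
      the sum.\<close>
    ultimately have "\<epsilon> * c x * (?a - ?b) = 0"
      using L2[OF V Z g0 x] by (simp add: algebra_simps)
    then have "?a = ?b" using c[OF x] \<epsilon> by simp
    then have "?a = 0" using s1 by simp
    then show ?thesis using ext_deriv_skew[of ?N \<omega> x "Z x"] by simp
  qed
  show ?thesis
    unfolding frame_symmetry_def
  proof (intro conjI allI ballI)
    fix x and i j :: 2 assume x: "x \<in> ?N"
    show "ext_deriv ?N \<omega> x (e j x) (lie_bracket ?N X (e i) x) = 0"
      by (rule L3[of "e i" "e j" 1 x]) (use ge te we Oee x in auto)
    show "ext_deriv ?N \<omega> x (f j x) (lie_bracket ?N X (f i) x) = 0"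
      by (rule L3[of "f i" "f j" "-1" x]) (use gf tf wf Off x in auto)
  qed (use tX L1 te tf we wf in auto)
qed

section \<open>The dimension bound\<close>

text \<open>A Euclidean space, so that for the index type \<open>2\<close> its dimension 1 + 4 + 5 +
  4 + 1 is computed from the type.\<close>

type_synonym 'i jet = "real \<times> ((real^'i) \<times> (real^'i)) \<times> ((real^'i^'i) \<times> real) \<times> ((real^'i) \<times> (real^'i)) \<times> real"

context contact_frame
begin

definition jet :: "('a \<Rightarrow> 'a) \<Rightarrow> 'a \<Rightarrow> 'i jet" where
  "jet X x = (let u = potential X in
     (u x, ((\<chi> i. along N (e i) u x), (\<chi> i. along N (f i) u x)),
      ((\<chi> i j. along N (e i) (along N (f j) u) x), along N T u x),
      ((\<chi> i. along N (e i) (along N T u) x), (\<chi> i. along N (f i) (along N T u) x)),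
      along N T (along N T u) x))"

lemma jet_zero_iff: "jet X x = 0 \<longleftrightarrow> (\<forall>g\<in>jets (potential X). g x = 0)"
  by (simp add: jet_def jets_def Let_def zero_prod_def vec_eq_iff ball_Un split_paired_All) blast

lemma jet_add:
  assumes "frame_symmetry X" "frame_symmetry Y"
  shows "jet (\<lambda>x. X x + Y x) x = jet X x + jet Y x"
proof -
  have s: "smooth_map_on N (potential X)" "smooth_map_on N (potential Y)"
    using assms by (auto simp: frame_symmetry_def intro: smooth_potential)
  have a: "along N Z (g + h) = along N Z g + along N Z h" if "tangent_field N Z" "smooth_map_on N g" "smooth_map_on N h" for Z g h
    using coefficient_ring.derivation_props(2)[OF smooth_coefficient_ring along_derivation[OF that(1)]] that by simp
  show ?thesis
    by (simp add: jet_def Let_def potential_add a s te tf tT smooth_map_on_along vec_eq_iff)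
qed

lemma jet_scale:
  assumes "frame_symmetry X"
  shows "jet (\<lambda>x. c *\<^sub>R X x) x = c *\<^sub>R jet X x"
proof -
  have s: "smooth_map_on N (potential X)"
    using assms by (auto simp: frame_symmetry_def intro: smooth_potential)
  have a: "along N Z ((\<lambda>x. c) * g) = (\<lambda>x. c) * along N Z g" if "tangent_field N Z" "smooth_map_on N g" for Z g
  proof
    fix x show "along N Z ((\<lambda>x. c) * g) x = ((\<lambda>x. c) * along N Z g) x"
      using mderiv_bilinear[OF bounded_bilinear_mult smooth_map_on_const that(2), of x "Z x" c]
        mderiv_const[of x N "Z x" c] tangent_fieldD(2)[OF that(1), of x] by (simp add: along_def times_fun_def)
  qed
  show ?thesis
    by (simp add: jet_def Let_def potential_scale a s te tf tT smooth_map_on_along vec_eq_iff)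
qed

lemma frame_symmetry_zero: "frame_symmetry (\<lambda>x. 0)"
proof -
  have "lie_bracket N (\<lambda>x. 0) Z x = 0" if "tangent_field N Z" for Z x
    using lie_bracket_sum[OF N finite.emptyI _ that] by simp
  then show ?thesis
    using ext_deriv_sum_right[OF w N _ finite.emptyI] tangent_fieldD(2)[OF te] tangent_fieldD(2)[OF tf]
    by (simp add: frame_symmetry_def tangent_field_zero[OF N] kills_def te tf linear_0[OF w_linear])
qed

end

text \<open>All that is kept of a frame: a linear space of fields and, at each point of
  \<open>N\<close>, a linear map to a 15-dimensional space whose kernel consists of the fields with
  zero germ. Competitors and the saucer are treated alike through it.\<close>

definition jet_system ::
  "'a::euclidean_space set \<Rightarrow> ('a \<Rightarrow> 'a) set \<Rightarrow> (('a \<Rightarrow> 'a) \<Rightarrow> 'a \<Rightarrow> 2 jet) \<Rightarrow> bool" where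
  "jet_system N S J \<longleftrightarrow>
     (\<lambda>x. 0) \<in> S \<and>
     (\<forall>X\<in>S. \<forall>Y\<in>S. (\<lambda>x. X x + Y x) \<in> S \<and> (\<forall>q. J (\<lambda>x. X x + Y x) q = J X q + J Y q)) \<and>
     (\<forall>c. \<forall>X\<in>S. (\<lambda>x. c *\<^sub>R X x) \<in> S \<and> (\<forall>q. J (\<lambda>x. c *\<^sub>R X x) q = c *\<^sub>R J X q)) \<and>
     (\<forall>X\<in>S. \<forall>q\<in>N. J X q = 0 \<longleftrightarrow> (\<exists>V. open V \<and> q \<in> V \<and> (\<forall>x\<in>N \<inter> V. X x = 0)))"

lemma jet_system_linear:
  assumes "jet_system N S J" "X \<in> S"
  shows "Y \<in> S \<Longrightarrow> (\<lambda>x. X x + Y x) \<in> S" "Y \<in> S \<Longrightarrow> J (\<lambda>x. X x + Y x) q = J X q + J Y q"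
    "(\<lambda>x. c *\<^sub>R X x) \<in> S" "J (\<lambda>x. c *\<^sub>R X x) q = c *\<^sub>R J X q"
  using assms unfolding jet_system_def by blast+

lemma jet_systemE:
  assumes "jet_system N S J" "X \<in> S" "q \<in> N" "J X q = 0"
  obtains V where "open V" "q \<in> V" "\<And>x. x \<in> N \<Longrightarrow> x \<in> V \<Longrightarrow> X x = 0"
proof -
  obtain V where "open V" "q \<in> V" "\<forall>x\<in>N \<inter> V. X x = 0" using assms unfolding jet_system_def by blast
  then show ?thesis by (intro that[of V]) auto
qed

text \<open>The frame exists on \<open>W\<close> only, whereas symmetries come with their own domain
  \<open>U\<close>; the choice \<open>V = U \<inter> W\<close> makes both available on
  \<open>V\<close>.\<close>

theorem legendrean_jet_system:
  assumes L: "legendrean_contact 2 M \<omega> g" and p: "p \<in> M"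
  obtains W where "open W" "p \<in> W"
    "\<And>V. open V \<Longrightarrow> V \<subseteq> W \<Longrightarrow> \<exists>S J. jet_system (M \<inter> V) S J \<and>
       (\<forall>U. open U \<longrightarrow> V \<subseteq> U \<longrightarrow> symmetries (M \<inter> U) \<omega> g \<subseteq> S)"
proof -
  obtain W and e f :: "2 \<Rightarrow> 'a \<Rightarrow> 'a" and c where W: "open W" "p \<in> W" "contact_frame 5 (M \<inter> W) \<omega> e f"
    "\<And>x. x \<in> M \<inter> W \<Longrightarrow> c x \<noteq> 0"
    "\<And>x v i. x \<in> M \<inter> W \<Longrightarrow> v \<in> distr M \<omega> x \<Longrightarrow> g x v (e i x) = c x * ext_deriv M \<omega> x v (e i x)"
    "\<And>x v i. x \<in> M \<inter> W \<Longrightarrow> v \<in> distr M \<omega> x \<Longrightarrow> g x v (f i x) = - c x * ext_deriv M \<omega> x v (f i x)"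
    using legendrean_frame[OF L p] by metis
  have g: "sym_tensor M g" using L by (auto simp: legendrean_contact_def)
  show ?thesis
  proof (rule that[OF W(1,2)])
    fix V assume V: "open V" "V \<subseteq> W"
    have eq: "M \<inter> W \<inter> V = M \<inter> V" using V(2) by auto
    have F: "contact_frame 5 (M \<inter> V) \<omega> e f" using contact_frame_Int[OF W(3) V(1)] eq by simp
    interpret contact_frame 5 "M \<inter> V" \<omega> e f by (rule F)
    have "jet_system (M \<inter> V) {X. frame_symmetry X} jet"
      unfolding jet_system_def
    proof (intro conjI ballI allI)
      fix X q assume X: "X \<in> {X. frame_symmetry X}" and q: "q \<in> M \<inter> V"
      have tX: "tangent_field (M \<inter> V) X" using X by (auto simp: frame_symmetry_def)
      show "jet X q = 0 \<longleftrightarrow> (\<exists>Y. open Y \<and> q \<in> Y \<and> (\<forall>x\<in>M \<inter> V \<inter> Y. X x = 0))"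
        using frame_symmetry_unique[of X q] jets_local[OF _ tX, of _ _ q] X q unfolding jet_zero_iff by blast
    qed (auto intro: frame_symmetry_zero frame_symmetry_add frame_symmetry_scale jet_add jet_scale)
    moreover have "frame_symmetry X" if U: "open U" "V \<subseteq> U" and X: "X \<in> symmetries (M \<inter> U) \<omega> g" for U X
      by (rule symmetry_frame_symmetry[OF F g W(4) W(5) W(6) V(1) U X]) (use V(2) in auto)
    ultimately show "\<exists>S J. jet_system (M \<inter> V) S J \<and> (\<forall>U. open U \<longrightarrow> V \<subseteq> U \<longrightarrow> symmetries (M \<inter> U) \<omega> g \<subseteq> S)"
      by (intro exI[of _ "{X. frame_symmetry X}"] exI[of _ jet]) blast
  qed
qed

lemma jet_system_sum:
  assumes J: "jet_system N S J" and "finite I" "\<And>i. i \<in> I \<Longrightarrow> X i \<in> S"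
  shows "(\<lambda>x. \<Sum>i\<in>I. c i *\<^sub>R X i x) \<in> S \<and> (\<forall>q\<in>N. J (\<lambda>x. \<Sum>i\<in>I. c i *\<^sub>R X i x) q = (\<Sum>i\<in>I. c i *\<^sub>R J (X i) q))"
  using assms(2,3)
proof (induction I rule: finite_induct)
  case empty
  have "(\<lambda>x. 0) \<in> S" "\<And>q. q \<in> N \<Longrightarrow> J (\<lambda>x. 0) q = 0" using J unfolding jet_system_def by blast+
  then show ?case by simp
next
  case (insert i I)
  have "(\<lambda>x. c i *\<^sub>R X i x) \<in> S" "\<And>q. J (\<lambda>x. c i *\<^sub>R X i x) q = c i *\<^sub>R J (X i) q"
    using jet_system_linear(3,4)[OF J] insert by auto
  then show ?case using insert jet_system_linear(1,2)[OF J, of "\<lambda>x. c i *\<^sub>R X i x"] by simp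
qed

text \<open>A family may repeat vectors, which independence of a set does not see; a repetition is
  handled by the difference of the two equal members.\<close>

lemma linear_dependence:
  fixes v :: "nat \<Rightarrow> 'e::euclidean_space"
  assumes "m > DIM('e)"
  shows "\<exists>c. (\<exists>i<m. c i \<noteq> 0) \<and> (\<Sum>i<m. c i *\<^sub>R v i) = 0"
proof (cases "inj_on v {..<m}")
  case True
  have "card (v ` {..<m}) > DIM('e)" using assms card_image[OF True] by simp
  then have "dependent (v ` {..<m})" by (intro dependent_biggerset) auto
  then obtain u where u: "\<exists>w\<in>v ` {..<m}. u w \<noteq> 0" "(\<Sum>w\<in>v ` {..<m}. u w *\<^sub>R w) = 0"
    using dependent_finite[of "v ` {..<m}"] by auto
  then show ?thesis using sum.reindex[OF True, of "\<lambda>w. u w *\<^sub>R w"] by (intro exI[of _ "u \<circ> v"]) auto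
next
  case False
  then obtain i j where ij: "i < m" "j < m" "i \<noteq> j" "v i = v j" by (auto simp: inj_on_def)
  let ?c = "\<lambda>k. (if k = i then 1 else 0) - (if k = j then 1 else (0::real))"
  have "(\<Sum>k<m. ?c k *\<^sub>R v k) = (\<Sum>k<m. (if k = i then v k else 0)) - (\<Sum>k<m. (if k = j then v k else 0))"
    unfolding sum_subtractf[symmetric] by (rule sum.cong) auto
  also have "\<dots> = 0" using ij by simp
  finally show ?thesis using ij by (intro exI[of _ ?c]) auto
qed

text \<open>More than 15 symmetries have dependent jets at \<open>p\<close>; the corresponding
  combination has zero jet, hence zero germ, against the independence of the germs.\<close>

theorem local_symmetry_dim_le:
  assumes L: "legendrean_contact 2 M \<omega> g" and p: "p \<in> M"
  shows "local_symmetry_dim M \<omega> g p \<le> 15"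
  unfolding local_symmetry_dim_def
proof (rule Sup_least, clarify)
  fix m U and X :: "nat \<Rightarrow> 'a \<Rightarrow> 'a"
  assume U: "open U" "p \<in> U" and X: "\<forall>i<m. X i \<in> symmetries (M \<inter> U) \<omega> g"
    and ind: "\<forall>(c :: nat \<Rightarrow> real) W. open W \<and> p \<in> W \<and> W \<subseteq> U \<and> (\<forall>x\<in>M \<inter> W. (\<Sum>i<m. c i *\<^sub>R X i x) = 0) \<longrightarrow> (\<forall>i<m. c i = 0)"
  show "enat m \<le> 15"
  proof (rule ccontr)
    assume "\<not> enat m \<le> 15"
    then have m: "m > 15" by (simp add: numeral_eq_enat)
    obtain W where W: "open W" "p \<in> W" "\<And>V. open V \<Longrightarrow> V \<subseteq> W \<Longrightarrow> \<exists>S J. jet_system (M \<inter> V) S J \<and>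
       (\<forall>U. open U \<longrightarrow> V \<subseteq> U \<longrightarrow> symmetries (M \<inter> U) \<omega> g \<subseteq> S)"
      using legendrean_jet_system[OF L p] by metis
    let ?V = "U \<inter> W"
    obtain S J where J: "jet_system (M \<inter> ?V) S J" "symmetries (M \<inter> U) \<omega> g \<subseteq> S"
      using W(3)[of ?V] U(1) W(1) by (metis inf_le1 inf_le2 open_Int)
    have "DIM(2 jet) = 15" by simp
    then obtain c where c: "\<exists>i<m. c i \<noteq> 0" "(\<Sum>i<m. c i *\<^sub>R J (X i) p) = 0"
      using linear_dependence[of m "\<lambda>i. J (X i) p"] m by auto
    let ?Y = "\<lambda>x. \<Sum>i<m. c i *\<^sub>R X i x"
    have pV: "p \<in> M \<inter> ?V" using p U W by simp
    have "?Y \<in> S \<and> (\<forall>q\<in>M \<inter> ?V. J ?Y q = (\<Sum>i<m. c i *\<^sub>R J (X i) q))"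
      by (rule jet_system_sum[OF J(1)]) (use X J(2) in auto)
    then have "?Y \<in> S" "J ?Y p = 0" using c(2) pV by auto
    then obtain Z where "open Z" "p \<in> Z" "\<And>x. x \<in> M \<inter> ?V \<Longrightarrow> x \<in> Z \<Longrightarrow> ?Y x = 0"
      using jet_systemE[OF J(1) _ pV, of ?Y] by metis
    then have "\<forall>i<m. c i = 0"
      using ind[rule_format, of "?V \<inter> Z" c] U W by (auto simp: Int_assoc)
    then show False using c(1) by blast
  qed
qed

section \<open>The flying saucer\<close>

abbreviation orth :: "real^3 \<Rightarrow> (real^3) set" where "orth n \<equiv> {x. n \<bullet> x = 0}"

lemma saucer_iff: "p \<in> saucer_space \<longleftrightarrow> norm (snd p) = 1"
  by (cases p) (auto simp: saucer_space_def)

lemma saucer_inner: "p \<in> saucer_space \<Longrightarrow> snd p \<bullet> snd p = 1"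
  by (simp add: saucer_iff dot_square_norm)

text \<open>The unit sphere is flattened by the inversion with centre \<open>- m\<close> and radius \<open>\<surd>2\<close>, an involution
  exchanging it with the plane orthogonal to \<open>m\<close>.\<close>

definition inversion :: "real^3 \<Rightarrow> real^3 \<Rightarrow> real^3" where
  "inversion m x = - m + (2 * inverse ((x + m) \<bullet> (x + m))) *\<^sub>R (x + m)"

text \<open>\<open>x + m\<close> is only rescaled, by 2 over its squared length, and the second
  rescaling is inverse to the first.\<close>

lemma inversion_involution:
  assumes "x \<noteq> - m"
  shows "inversion m x \<noteq> - m" "inversion m (inversion m x) = x"
proof -
  have y: "x + m \<noteq> 0" using assms by (simp add: add_eq_0_iff2)
  then have yy: "(x + m) \<bullet> (x + m) \<noteq> 0" by simp
  have e: "inversion m x + m = (2 * inverse ((x + m) \<bullet> (x + m))) *\<^sub>R (x + m)" by (simp add: inversion_def)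
  have "inversion m x + m \<noteq> 0" unfolding e using y yy by simp
  then show "inversion m x \<noteq> - m" by (metis add.left_inverse)
  have aux: "2 * inverse ((2 * inverse s) * ((2 * inverse s) * s)) * (2 * inverse s) = 1" if "s \<noteq> 0" for s :: real
    using that by (simp add: field_simps)
  have "2 * inverse ((inversion m x + m) \<bullet> (inversion m x + m)) * (2 * inverse ((x + m) \<bullet> (x + m))) = 1"
    unfolding e inner_scaleR_left inner_scaleR_right using aux[OF yy] .
  then have "(2 * inverse ((inversion m x + m) \<bullet> (inversion m x + m))) *\<^sub>R (inversion m x + m) = x + m"
    by (subst (3) e) (simp only: scaleR_scaleR, simp)
  then show "inversion m (inversion m x) = x" unfolding inversion_def[of m "inversion m x"] by simp
qed

text \<open>The unit sphere satisfies
  \<open>(x + m) \<bullet> (x + m) = 2 * (m \<bullet> (x + m))\<close>, and the plane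
  \<open>m \<bullet> (x + m) = 1\<close>; these equations are the two halves of the
  exchange.\<close>

lemma inversion_sphere:
  assumes m: "norm m = 1" and x: "x \<noteq> - m"
  shows "norm x = 1 \<Longrightarrow> m \<bullet> inversion m x = 0" and "m \<bullet> x = 0 \<Longrightarrow> norm (inversion m x) = 1"
proof -
  have mm: "m \<bullet> m = 1" using m by (simp add: dot_square_norm)
  have yy: "(x + m) \<bullet> (x + m) \<noteq> 0" using x by (simp add: add_eq_0_iff2)
  show "m \<bullet> inversion m x = 0" if "norm x = 1"
  proof -
    have "x \<bullet> x = 1" using that by (simp add: dot_square_norm)
    then have "(x + m) \<bullet> (x + m) = 2 * (m \<bullet> (x + m))" using mm by (simp add: inner_add inner_commute)
    moreover have "m \<bullet> inversion m x = - (m \<bullet> m) + 2 * inverse ((x + m) \<bullet> (x + m)) * (m \<bullet> (x + m))"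
      unfolding inversion_def inner_add_right[of m "- m"] inner_scaleR_right by simp
    ultimately show ?thesis using yy mm by simp
  qed
  show "norm (inversion m x) = 1" if "m \<bullet> x = 0"
  proof -
    define s where "s = (x + m) \<bullet> (x + m)"
    have "m \<bullet> (x + m) = 1" using that mm by (simp add: inner_add)
    then have "inversion m x \<bullet> inversion m x = 1 - 4 * inverse s + 4 * inverse s * inverse s * s"
      unfolding inversion_def s_def using mm by (simp add: inner_diff_left inner_diff_right inner_add_left inner_add_right inner_commute algebra_simps)
    also have "\<dots> = 1" using yy by (simp add: s_def)
    finally show ?thesis by (simp add: norm_eq_sqrt_inner)
  qed
qed

lemma smooth_inversion: "smooth_on (- {p. snd p = - m}) (\<lambda>p :: (real^3) \<times> (real^3). (fst p, inversion m (snd p)))"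
proof -
  let ?U = "- {p :: (real^3) \<times> (real^3). snd p = - m}"
  have "closed {p :: (real^3) \<times> (real^3). snd p = - m}"
    by (intro closed_Collect_eq continuous_intros)
  then have U: "open ?U" by (rule open_Compl)
  note i = smooth_on_ident[OF U]
  have s: "smooth_on ?U (\<lambda>p. snd p + m)"
    by (intro smooth_on_add smooth_on_const smooth_on_linear[OF bounded_linear_snd] U i)
  have q: "smooth_on ?U (\<lambda>p. inverse ((snd p + m) \<bullet> (snd p + m)))"
    by (rule smooth_on_inverse[OF U _ smooth_on_bilinear[OF bounded_bilinear_inner U s s]]) (auto simp: add_eq_0_iff2)
  have v: "smooth_on ?U (\<lambda>p. inversion m (snd p))"
    unfolding inversion_def
    by (intro smooth_on_add[OF U] smooth_on_const[OF U] smooth_on_bilinear[OF bounded_bilinear_scaleR U]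
        smooth_on_bilinear[OF bounded_bilinear_mult U] q s)
  have "smooth_on ?U (\<lambda>p. (fst p, 0) + (0, inversion m (snd p)))"
    by (intro smooth_on_add[OF U] smooth_on_linear[OF _ U, of "\<lambda>x. (fst x, 0)"] smooth_on_linear[OF _ U v, of "\<lambda>x. (0, x)"] i
        bounded_linear_Pair bounded_linear_fst bounded_linear_zero bounded_linear_ident)
  then show ?thesis by simp
qed

lemma submanifold_saucer: "submanifold 5 saucer_space"
  unfolding submanifold_def
proof
  fix p assume p: "p \<in> saucer_space"
  \<comment> \<open>Inverting about the antipode of \<open>snd p\<close> keeps \<open>p\<close>
    itself in the domain.\<close>
  define m where "m = snd p"
  have m: "norm m = 1" using p by (simp add: m_def saucer_iff)
  let ?U = "- {p :: (real^3) \<times> (real^3). snd p = - m}" and ?\<Phi> = "\<lambda>p. (fst p, inversion m (snd p))"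
  let ?S = "(UNIV :: (real^3) set) \<times> orth m"
  have "closed {p :: (real^3) \<times> (real^3). snd p = - m}"
    by (intro closed_Collect_eq continuous_intros)
  then have U: "open ?U" by (rule open_Compl)
  have "m \<noteq> 0" using m by auto
  have "m \<noteq> - m"
  proof
    assume "m = - m"
    then have "2 *\<^sub>R m = 0" by (metis add.right_inverse scaleR_2)
    then show False using \<open>m \<noteq> 0\<close> by simp
  qed
  then have pU: "p \<in> ?U" by (simp add: m_def)
  have inv: "?\<Phi> x \<in> ?U \<and> ?\<Phi> (?\<Phi> x) = x" if "x \<in> ?U" for x
    using that inversion_involution[of "snd x" m] by simp
  have im: "?\<Phi> ` ?U = ?U"
  proof (intro equalityI subsetI)
    fix y assume "y \<in> ?U"
    then show "y \<in> ?\<Phi> ` ?U" using inv[of y] by (intro image_eqI[of y ?\<Phi> "?\<Phi> y"]) auto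
  qed (use inv in blast)
  have "?\<Phi> ` (?U \<inter> saucer_space) = ?U \<inter> ?S"
  proof (intro equalityI subsetI)
    fix y assume "y \<in> ?\<Phi> ` (?U \<inter> saucer_space)"
    then obtain x where x: "x \<in> ?U" "x \<in> saucer_space" "y = ?\<Phi> x" by blast
    then show "y \<in> ?U \<inter> ?S" using inv[OF x(1)] inversion_sphere(1)[OF m, of "snd x"] by (auto simp: saucer_iff)
  next
    fix y assume y: "y \<in> ?U \<inter> ?S"
    then have "?\<Phi> y \<in> ?U \<inter> saucer_space"
      using inv[of y] inversion_sphere(2)[OF m, of "snd y"] by (auto simp: saucer_iff)
    moreover have "y = ?\<Phi> (?\<Phi> y)" using inv[of y] y by simp
    ultimately show "y \<in> ?\<Phi> ` (?U \<inter> saucer_space)" by blast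
  qed
  moreover have "subspace ?S" by (intro subspace_Times subspace_UNIV subspace_hyperplane)
  moreover have "dim ?S = 5"
    using dim_Times[OF subspace_UNIV[where 'a="real^3"] subspace_hyperplane, of m] dim_hyperplane[OF \<open>m \<noteq> 0\<close>] by simp
  ultimately show "\<exists>U V (\<Phi> :: (real^3) \<times> (real^3) \<Rightarrow> (real^3) \<times> (real^3)) \<Psi> S.
        open U \<and> p \<in> U \<and> open V \<and> smooth_on U \<Phi> \<and> smooth_on V \<Psi> \<and>
        \<Phi> ` U = V \<and> (\<forall>x\<in>U. \<Psi> (\<Phi> x) = x) \<and> subspace S \<and> dim S = 5 \<and> \<Phi> ` (U \<inter> saucer_space) = V \<inter> S"
    using U pU im inv smooth_inversion[of m]
    by (intro exI[of _ ?U] exI[of _ ?\<Phi>] exI[of _ ?S] conjI ballI) auto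
qed

lemma tangent_saucer:
  assumes p: "p \<in> saucer_space"
  shows "tangent_space saucer_space p = UNIV \<times> orth (snd p)"
proof (intro equalityI subsetI)
  fix v assume v: "v \<in> tangent_space saucer_space p"
  have d: "((\<lambda>x. snd x \<bullet> snd x) has_derivative (\<lambda>v. snd p \<bullet> snd v + snd v \<bullet> snd p)) (at p within saucer_space)"
    by (intro has_derivative_inner has_derivative_snd has_derivative_ident)
  have c: "((\<lambda>x. snd x \<bullet> snd x) has_derivative (\<lambda>v. 0)) (at p within saucer_space)"
    by (rule has_derivative_transform[OF p _ has_derivative_const[of 1]]) (simp add: saucer_inner)
  have "snd p \<bullet> snd v + snd v \<bullet> snd p = 0" using mderiv_eq[OF d v] mderiv_eq[OF c v] by simp
  then show "v \<in> UNIV \<times> orth (snd p)" by (cases v) (simp add: inner_commute)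
next
  fix v :: "(real^3) \<times> (real^3)" assume "v \<in> UNIV \<times> orth (snd p)"
  then have v: "snd p \<bullet> snd v = 0" by auto
  \<comment> \<open>A straight line whose second component is corrected by the square root to stay
    on the sphere; the correction has derivative 0 at 0, and \<open>e\<close> keeps the radicand
    nonnegative.\<close>
  define \<gamma> where "\<gamma> t = (fst p + t *\<^sub>R fst v, sqrt (1 - t\<^sup>2 * (snd v \<bullet> snd v)) *\<^sub>R snd p + t *\<^sub>R snd v)" for t
  define e where "e = 1 / (norm (snd v) + 1)"
  have nz: "norm (snd v) + 1 > 0" by (simp add: add_nonneg_pos)
  have e: "e > 0" using nz by (simp add: e_def)
  have "\<gamma> t \<in> saucer_space" if t: "t \<in> {-e<..<e}" for t
  proof -
    have "\<bar>t\<bar> * norm (snd v) \<le> e * (norm (snd v) + 1)" using t by (intro mult_mono) auto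
    also have "\<dots> = 1" using nz by (simp add: e_def)
    finally have "(\<bar>t\<bar> * norm (snd v))\<^sup>2 \<le> 1" by (simp add: power_le_one)
    then have s: "1 - t\<^sup>2 * (snd v \<bullet> snd v) \<ge> 0" by (simp add: power_mult_distrib dot_square_norm)
    have "snd (\<gamma> t) \<bullet> snd (\<gamma> t) = (sqrt (1 - t\<^sup>2 * (snd v \<bullet> snd v)))\<^sup>2 * (snd p \<bullet> snd p) + t\<^sup>2 * (snd v \<bullet> snd v)"
      unfolding \<gamma>_def using v by (simp add: inner_add inner_commute power2_eq_square)
    also have "\<dots> = 1" using s by (simp add: saucer_inner[OF p])
    finally show ?thesis by (simp add: saucer_iff norm_eq_sqrt_inner)
  qed
  moreover have "\<gamma> 0 = p" by (simp add: \<gamma>_def)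
  moreover have "(\<gamma> has_vector_derivative v) (at 0)"
  proof -
    have r: "((\<lambda>t. sqrt (1 - t\<^sup>2 * (snd v \<bullet> snd v))) has_real_derivative 0) (at 0)"
      by (auto intro!: derivative_eq_intros)
    have "(\<gamma> has_vector_derivative (0 + 1 *\<^sub>R fst v, (sqrt (1 - 0\<^sup>2 * (snd v \<bullet> snd v)) *\<^sub>R 0 + 0 *\<^sub>R snd p) + (0 *\<^sub>R 0 + 1 *\<^sub>R snd v))) (at 0)"
      unfolding \<gamma>_def
      by (intro has_vector_derivative_Pair has_vector_derivative_add has_vector_derivative_scaleR[OF r] has_vector_derivative_const
          has_vector_derivative_scaleR[OF DERIV_ident] ) (auto intro!: derivative_eq_intros)
    then show ?thesis by simp
  qed
  ultimately show "v \<in> tangent_space saucer_space p" unfolding tangent_space_def using e by blast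
qed

section \<open>The Legendrean contact structure of the saucer\<close>

lemma distr_saucer:
  assumes "p \<in> saucer_space"
  shows "distr saucer_space saucer_form p = orth (snd p) \<times> orth (snd p)"
proof (rule set_eqI)
  fix v
  show "v \<in> distr saucer_space saucer_form p \<longleftrightarrow> v \<in> orth (snd p) \<times> orth (snd p)"
    by (cases v) (auto simp: distr_def tangent_saucer[OF assms] saucer_form_def)
qed

lemma one_form_saucer: "one_form saucer_space saucer_form"
  unfolding one_form_def saucer_form_def
proof (intro conjI ballI allI)
  fix p :: "(real^3) \<times> (real^3)"
  show "linear (\<lambda>v. snd p \<bullet> fst v)"
    by (rule linearI) (simp_all add: inner_add_right)
  fix v :: "(real^3) \<times> (real^3)"
  show "smooth_map_on saucer_space (\<lambda>p. snd p \<bullet> fst v)"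
    by (intro smooth_map_on_inner smooth_map_on_const smooth_map_on_linear[OF bounded_linear_snd smooth_map_on_ident])
qed

lemma mderiv_saucer_form:
  assumes "v \<in> tangent_space saucer_space p"
  shows "mderiv saucer_space (\<lambda>x. saucer_form x u) p v = snd v \<bullet> fst u"
  unfolding saucer_form_def
  by (rule mderiv_eq[OF has_derivative_inner_left[OF has_derivative_snd[OF has_derivative_ident]] assms])

lemma ext_deriv_saucer:
  assumes "u \<in> tangent_space saucer_space p" "v \<in> tangent_space saucer_space p"
  shows "ext_deriv saucer_space saucer_form p u v = snd u \<bullet> fst v - snd v \<bullet> fst u"
  by (simp add: ext_deriv_def mderiv_saucer_form assms)

lemma distr_tangent: "u \<in> distr M \<omega> p \<Longrightarrow> u \<in> tangent_space M p"
  by (simp add: distr_def)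

lemma contact_form_saucer: "contact_form 2 saucer_space saucer_form"
  unfolding contact_form_def
proof (intro conjI ballI impI)
  show "submanifold (2 * 2 + 1) saucer_space" using submanifold_saucer by simp
  show "one_form saucer_space saucer_form" by (rule one_form_saucer)
  fix p assume p: "p \<in> saucer_space"
  show "\<exists>v\<in>tangent_space saucer_space p. saucer_form p v \<noteq> 0"
    unfolding tangent_saucer[OF p]
    by (intro bexI[of _ "(snd p, 0)"]) (auto simp: saucer_form_def saucer_inner[OF p])
  fix u assume u: "u \<in> distr saucer_space saucer_form p"
    and z: "\<forall>v\<in>distr saucer_space saucer_form p. ext_deriv saucer_space saucer_form p u v = 0"
  \<comment> \<open>Up to sign, \<open>d\<omega>\<close> of \<open>u\<close> with these two vectors
    is the squared length of \<open>snd u\<close> and of \<open>fst u\<close>.\<close>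
  have "(snd u, 0) \<in> distr saucer_space saucer_form p" "(0, fst u) \<in> distr saucer_space saucer_form p"
    using u unfolding distr_saucer[OF p] by auto
  from z[rule_format, OF this(1)] z[rule_format, OF this(2)]
  have "snd u = 0" "fst u = 0"
    using ext_deriv_saucer[OF distr_tangent[OF u] distr_tangent] \<open>(snd u, 0) \<in> _\<close> \<open>(0, fst u) \<in> _\<close> by auto
  then show "u = 0" by (simp add: prod_eq_iff)
qed

lemma sym_tensor_saucer: "sym_tensor M saucer_metric"
  unfolding sym_tensor_def saucer_metric_def
  by (auto simp: bilinear_def inner_add_left inner_add_right add_divide_distrib algebra_simps
      intro!: linearI smooth_map_on_const)

lemma dim_orth: "norm n = 1 \<Longrightarrow> dim (orth n) = 2"
  using dim_hyperplane[of n] by (cases "n = 0") auto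

lemma split_signature_saucer:
  assumes p: "p \<in> saucer_space"
  shows "split_signature 2 (distr saucer_space saucer_form p) (saucer_metric p)"
  unfolding split_signature_def distr_saucer[OF p]
proof (intro conjI)
  let ?n = "snd p"
  have d: "dim (orth ?n) = 2" using p by (simp add: dim_orth saucer_iff)
  have s: "subspace (orth ?n)" by (rule subspace_hyperplane)
  show "subspace (orth ?n \<times> orth ?n)" by (rule subspace_Times[OF s s])
  show "dim (orth ?n \<times> orth ?n) = 2 * 2" using dim_Times[OF s s] d by simp
  \<comment> \<open>Graphs over the plane orthogonal to \<open>n\<close>; for \<open>c = 1\<close>
    and \<open>c = -1\<close> the metric on them is plus and minus the squared length.\<close>
  have P: "subspace ((\<lambda>a. (a, c *\<^sub>R a)) ` orth ?n)" "dim ((\<lambda>a. (a, c *\<^sub>R a)) ` orth ?n) = 2" for c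
  proof -
    have l: "linear (\<lambda>a::real^3. (a, c *\<^sub>R a))" by (rule linearI) (auto simp: algebra_simps)
    show "subspace ((\<lambda>a. (a, c *\<^sub>R a)) ` orth ?n)" by (rule linear_subspace_image[OF l s])
    show "dim ((\<lambda>a. (a, c *\<^sub>R a)) ` orth ?n) = 2"
      using dim_image_eq[OF l, of "orth ?n"] d by (simp add: inj_on_def)
  qed
  show "\<exists>P N. subspace P \<and> subspace N \<and> P \<subseteq> orth ?n \<times> orth ?n \<and> N \<subseteq> orth ?n \<times> orth ?n \<and> dim P = 2 \<and> dim N = 2 \<and>
       (\<forall>v\<in>P. v \<noteq> 0 \<longrightarrow> 0 < saucer_metric p v v) \<and> (\<forall>v\<in>N. v \<noteq> 0 \<longrightarrow> saucer_metric p v v < 0)"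
    using P[of 1] P[of "-1"]
    by (intro exI[of _ "(\<lambda>a. (a, 1 *\<^sub>R a)) ` orth ?n"] exI[of _ "(\<lambda>a. (a, (-1) *\<^sub>R a)) ` orth ?n"])
      (auto simp: saucer_metric_def zero_prod_def)
qed

text \<open>The factor 2 compensates the 1/2 in the symmetric product \<open>saucer_metric\<close>;
  hence the rescaling by 1/2 in \<open>K_eigen_saucer\<close>.\<close>

lemma K_endo_saucer:
  assumes p: "p \<in> saucer_space" and v: "v \<in> distr saucer_space saucer_form p"
  shows "K_endo saucer_space saucer_form saucer_metric p v = (2 *\<^sub>R fst v, (-2) *\<^sub>R snd v)"
  unfolding K_endo_def
proof (rule the_equality)
  let ?D = "distr saucer_space saucer_form p" and ?w = "(2 *\<^sub>R fst v, (-2) *\<^sub>R snd v)"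
  have ed: "ext_deriv saucer_space saucer_form p u v = snd u \<bullet> fst v - snd v \<bullet> fst u" if "u \<in> ?D" for u
    by (rule ext_deriv_saucer[OF distr_tangent[OF that] distr_tangent[OF v]])
  show "?w \<in> ?D \<and> (\<forall>u\<in>?D. saucer_metric p u ?w = ext_deriv saucer_space saucer_form p u v)"
    using v by (auto simp: distr_saucer[OF p] ed saucer_metric_def inner_commute)
  fix w assume w: "w \<in> ?D \<and> (\<forall>u\<in>?D. saucer_metric p u w = ext_deriv saucer_space saucer_form p u v)"
  let ?d = "(fst w - 2 *\<^sub>R fst v, snd w + 2 *\<^sub>R snd v)"
  have "(0, fst ?d) \<in> ?D" "(snd ?d, 0) \<in> ?D"
    using w v by (auto simp: distr_saucer[OF p] inner_diff_right inner_add_right)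
  then have "saucer_metric p (0, fst ?d) w = snd (0, fst ?d) \<bullet> fst v - snd v \<bullet> fst (0, fst ?d)"
    "saucer_metric p (snd ?d, 0) w = snd (snd ?d, 0) \<bullet> fst v - snd v \<bullet> fst (snd ?d, 0 :: real^3)"
    using w ed by auto
  then have "fst ?d \<bullet> fst ?d = 0" "snd ?d \<bullet> snd ?d = 0"
    by (simp_all add: saucer_metric_def inner_diff_left inner_diff_right inner_add_left inner_add_right inner_commute)
  then have "fst ?d = 0" "snd ?d = 0" by (simp_all only: inner_eq_zero_iff)
  then show "w = ?w" by (simp add: prod_eq_iff add_eq_0_iff2)
qed

lemma K_eigen_saucer:
  assumes p: "p \<in> saucer_space"
  shows "K_eigen saucer_space saucer_form saucer_metric (\<lambda>p. 1/2) 1 p = orth (snd p) \<times> {0}"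
    "K_eigen saucer_space saucer_form saucer_metric (\<lambda>p. 1/2) (-1) p = {0} \<times> orth (snd p)"
proof -
  have z: "- a = a \<longleftrightarrow> a = 0" "a = - a \<longleftrightarrow> a = 0" for a :: "real^3"
    by (metis add.inverse_neutral add.right_inverse scaleR_2 scaleR_eq_0_iff zero_neq_numeral)+
  show "K_eigen saucer_space saucer_form saucer_metric (\<lambda>p. 1/2) 1 p = orth (snd p) \<times> {0}"
    "K_eigen saucer_space saucer_form saucer_metric (\<lambda>p. 1/2) (-1) p = {0} \<times> orth (snd p)"
    unfolding K_eigen_def using K_endo_saucer[OF p] by (auto simp: distr_saucer[OF p] z)
qed

text \<open>The sphere has no global tangent frame, so a frame of the plane orthogonal to
  \<open>n\<close> is built from an auxiliary \<open>v\<close>, valid where \<open>n\<close> and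
  \<open>v\<close> are not parallel.\<close>

lemma orth_frame:
  assumes "cross3 n v \<noteq> 0"
  shows "orth n = span {cross3 n v, cross3 n (cross3 n v)}"
proof -
  let ?a = "cross3 n v"
  let ?b = "cross3 n ?a"
  have n: "n \<noteq> 0" using assms by auto
  have o: "n \<bullet> ?a = 0" "n \<bullet> ?b = 0" "?a \<bullet> ?b = 0" "?b \<bullet> ?a = 0" by (auto simp: dot_cross_self)
  have b: "?b \<noteq> 0" using norm_and_cross_eq_0[of n ?a] o n assms by auto
  have ne: "?a \<noteq> ?b" using o assms by (metis inner_eq_zero_iff)
  have "independent {?a, ?b}"
    by (rule pairwise_orthogonal_independent) (use assms b o ne in \<open>auto simp: pairwise_def orthogonal_def\<close>)
  then have "dim (span {?a, ?b}) = 2" using ne by (simp add: dim_span_eq_card_independent dim_eq_card_independent)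
  moreover have "span {?a, ?b} \<subseteq> orth n"
    by (rule span_minimal) (use o subspace_hyperplane in auto)
  moreover have "dim (orth n) = 2" using dim_hyperplane[OF n] by simp
  ultimately show ?thesis using subspace_dim_equal[OF subspace_span subspace_hyperplane, of "{?a, ?b}" n] by simp
qed

lemma smooth_cross: "smooth_map_on M f \<Longrightarrow> smooth_map_on M g \<Longrightarrow> smooth_map_on M (\<lambda>x. cross3 (f x) (g x))"
  by (rule smooth_map_on_bilinear[OF bilinear_cross[unfolded bilinear_conv_bounded_bilinear]])

text \<open>Both eigenbundles are linear copies of the tangent planes of the sphere, one in the
  \<open>r\<close> and one in the \<open>n\<close> component.\<close>

lemma subbundle_saucer:
  fixes L :: "real^3 \<Rightarrow> (real^3) \<times> (real^3)"
  assumes L: "bounded_linear L" "inj L" and D: "\<And>p. p \<in> saucer_space \<Longrightarrow> D p = L ` orth (snd p)"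
    and t: "\<And>p. p \<in> saucer_space \<Longrightarrow> D p \<subseteq> tangent_space saucer_space p"
  shows "subbundle 2 saucer_space D"
  unfolding subbundle_def
proof (intro conjI ballI)
  have lin: "linear L" using L(1) by (simp add: bounded_linear.linear)
  fix p assume p: "p \<in> saucer_space"
  show "subspace (D p)" unfolding D[OF p] by (rule linear_subspace_image[OF lin subspace_hyperplane])
  show "dim (D p) = 2"
    unfolding D[OF p] using dim_image_eq[OF lin, of "orth (snd p)"] inj_on_subset[OF L(2)] p
    by (simp add: dim_orth saucer_iff)
  show "D p \<subseteq> tangent_space saucer_space p" by (rule t[OF p])
  have "snd p \<noteq> 0" using p by (auto simp: saucer_iff)
  then obtain v where v: "cross3 (snd p) v \<noteq> 0" using cross_basis_nonzero by blast
  let ?U = "{q :: (real^3) \<times> (real^3). cross3 (snd q) v \<noteq> 0}"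
  let ?e = "\<lambda>(i::nat) q. L (if i = 0 then cross3 (snd q) v else cross3 (snd q) (cross3 (snd q) v))"
  have "open ?U" by (intro open_Collect_neq continuous_intros continuous_on_cross)
  moreover have "smooth_map_on (saucer_space \<inter> ?U) (?e i)" for i
    by (cases "i = 0")
      (auto intro!: smooth_map_on_linear[OF L(1)] smooth_cross smooth_map_on_const smooth_map_on_linear[OF bounded_linear_snd smooth_map_on_ident])
  moreover have "D q = span ((\<lambda>i. ?e i q) ` {..<2})" if q: "q \<in> saucer_space \<inter> ?U" for q
  proof -
    have "(\<lambda>i. ?e i q) ` {..<2} = L ` {cross3 (snd q) v, cross3 (snd q) (cross3 (snd q) v)}"
      by (auto simp: lessThan_Suc numeral_2_eq_2)
    then have "span ((\<lambda>i. ?e i q) ` {..<2}) = L ` span {cross3 (snd q) v, cross3 (snd q) (cross3 (snd q) v)}"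
      by (simp only: linear_span_image[OF lin])
    then show ?thesis using q D[of q] orth_frame[of "snd q" v] by simp
  qed
  ultimately show "\<exists>U (e :: nat \<Rightarrow> (real^3) \<times> (real^3) \<Rightarrow> (real^3) \<times> (real^3)). open U \<and> p \<in> U \<and> (\<forall>i<2. smooth_map_on (saucer_space \<inter> U) (e i)) \<and>
      (\<forall>q\<in>saucer_space \<inter> U. D q = span ((\<lambda>i. e i q) ` {..<2}))"
    using v by (intro exI[of _ ?U] exI[of _ ?e]) auto
qed

theorem legendrean_contact_saucer: "legendrean_contact 2 saucer_space saucer_form saucer_metric"
proof -
  let ?K = "K_eigen saucer_space saucer_form saucer_metric (\<lambda>p. 1/2)"
  have split: "legendrean_splitting 2 saucer_space saucer_form (?K 1) (?K (-1))"
    unfolding legendrean_splitting_def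
  proof (intro conjI ballI)
    show "subbundle 2 saucer_space (?K 1)"
      by (rule subbundle_saucer[of "\<lambda>a. (a, 0)"])
        (auto simp: K_eigen_saucer tangent_saucer inj_on_def intro!: bounded_linear_Pair bounded_linear_ident bounded_linear_zero)
    show "subbundle 2 saucer_space (?K (-1))"
      by (rule subbundle_saucer[of "\<lambda>a. (0, a)"])
        (auto simp: K_eigen_saucer tangent_saucer inj_on_def intro!: bounded_linear_Pair bounded_linear_ident bounded_linear_zero)
    fix p assume p: "p \<in> saucer_space"
    show "?K 1 p \<inter> ?K (-1) p = {0}" by (auto simp: K_eigen_saucer[OF p] zero_prod_def)
    show "{u + v |u v. u \<in> ?K 1 p \<and> v \<in> ?K (-1) p} = distr saucer_space saucer_form p"
      unfolding K_eigen_saucer[OF p] distr_saucer[OF p] by force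
    fix u v
    show "ext_deriv saucer_space saucer_form p u v = 0" if "u \<in> ?K 1 p" "v \<in> ?K 1 p"
      using that ext_deriv_saucer[of u p v] by (auto simp: K_eigen_saucer[OF p] tangent_saucer[OF p])
    show "ext_deriv saucer_space saucer_form p u v = 0" if "u \<in> ?K (-1) p" "v \<in> ?K (-1) p"
      using that ext_deriv_saucer[of u p v] by (auto simp: K_eigen_saucer[OF p] tangent_saucer[OF p])
  qed
  have inv: "(1/2) *\<^sub>R K_endo saucer_space saucer_form saucer_metric p ((1/2) *\<^sub>R K_endo saucer_space saucer_form saucer_metric p v) = v"
    if p: "p \<in> saucer_space" and v: "v \<in> distr saucer_space saucer_form p" for p v
  proof -
    have "(fst v, - snd v) \<in> distr saucer_space saucer_form p" using v by (auto simp: distr_saucer[OF p])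
    then show ?thesis using K_endo_saucer[OF p v] K_endo_saucer[OF p, of "(fst v, - snd v)"] by simp
  qed
  show ?thesis
    unfolding legendrean_contact_def
    by (intro conjI ballI exI[of _ "\<lambda>p. 1/2"] contact_form_saucer sym_tensor_saucer split_signature_saucer smooth_map_on_const split)
      (auto simp: inv)
qed

section \<open>The action of sl(4)\<close>

text \<open>The first three of four indices; a matrix of size 4 is split into blocks with rows
  \<open>(A, B)\<close> and \<open>(C, D)\<close>.\<close>

definition emb :: "3 \<Rightarrow> 4" where "emb i = (if i = 1 then 1 else if i = 2 then 2 else 3)"

lemma emb_simps [simp]: "emb 1 = 1" "emb 2 = 2" "emb 3 = 3"
  by (auto simp: emb_def)

definition blkA :: "real^4^4 \<Rightarrow> real^3^3" where "blkA M = (\<chi> i j. M $ emb i $ emb j)"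
definition blkB :: "real^4^4 \<Rightarrow> real^3" where "blkB M = (\<chi> i. M $ emb i $ 4)"
definition blkC :: "real^4^4 \<Rightarrow> real^3" where "blkC M = (\<chi> j. M $ 4 $ emb j)"
definition blkD :: "real^4^4 \<Rightarrow> real" where "blkD M = M $ 4 $ 4"

lemmas blk_defs = blkA_def blkB_def blkC_def blkD_def

lemma blk_add: "blkA (M + N) = blkA M + blkA N" "blkB (M + N) = blkB M + blkB N"
  "blkC (M + N) = blkC M + blkC N" "blkD (M + N) = blkD M + blkD N"
  by (simp_all add: blk_defs vec_eq_iff)

lemma blk_scale: "blkA (t *\<^sub>R M) = t *\<^sub>R blkA M" "blkB (t *\<^sub>R M) = t *\<^sub>R blkB M"
  "blkC (t *\<^sub>R M) = t *\<^sub>R blkC M" "blkD (t *\<^sub>R M) = t * blkD M"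
  by (simp_all add: blk_defs vec_eq_iff)

lemma blk_mult:
  "blkA (M ** N) *v x = blkA M *v (blkA N *v x) + (blkC N \<bullet> x) *\<^sub>R blkB M"
  "blkB (M ** N) = blkA M *v blkB N + blkD N *\<^sub>R blkB M"
  "blkC (M ** N) \<bullet> x = blkC M \<bullet> (blkA N *v x) + blkD M * (blkC N \<bullet> x)"
  "blkD (M ** N) = blkC M \<bullet> blkB N + blkD M * blkD N"
  by (simp_all add: blk_defs vec_eq_iff matrix_matrix_mult_def matrix_vector_mult_def sum_3 sum_4 inner_vec_def algebra_simps)

lemma blk_commutator:
  "blkA (commutator M N) *v x = blkA M *v (blkA N *v x) - blkA N *v (blkA M *v x)
     + (blkC N \<bullet> x) *\<^sub>R blkB M - (blkC M \<bullet> x) *\<^sub>R blkB N"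
  "blkB (commutator M N) = blkA M *v blkB N + blkD N *\<^sub>R blkB M - blkA N *v blkB M - blkD M *\<^sub>R blkB N"
  "blkC (commutator M N) \<bullet> x = blkC M \<bullet> (blkA N *v x) + blkD M * (blkC N \<bullet> x)
     - blkC N \<bullet> (blkA M *v x) - blkD N * (blkC M \<bullet> x)"
  "blkD (commutator M N) = blkC M \<bullet> blkB N - blkC N \<bullet> blkB M"
proof -
  have eq: "commutator M N = M ** N + (-1) *\<^sub>R (N ** M)" by (simp add: commutator_def)
  have mv: "(A + (-1) *\<^sub>R B) *v x = A *v x - B *v x" for A B :: "real^3^3" and x
    by (simp add: matrix_vector_mult_diff_rdistrib)
  show "blkA (commutator M N) *v x = blkA M *v (blkA N *v x) - blkA N *v (blkA M *v x)
     + (blkC N \<bullet> x) *\<^sub>R blkB M - (blkC M \<bullet> x) *\<^sub>R blkB N"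
    unfolding eq blk_add blk_scale mv blk_mult by simp
  show "blkB (commutator M N) = blkA M *v blkB N + blkD N *\<^sub>R blkB M - blkA N *v blkB M - blkD M *\<^sub>R blkB N"
    unfolding eq blk_add blk_scale blk_mult by simp
  show "blkC (commutator M N) \<bullet> x = blkC M \<bullet> (blkA N *v x) + blkD M * (blkC N \<bullet> x)
     - blkC N \<bullet> (blkA M *v x) - blkD N * (blkC M \<bullet> x)"
    unfolding eq blk_add blk_scale inner_add_left inner_scaleR_left blk_mult by simp
  show "blkD (commutator M N) = blkC M \<bullet> blkB N - blkC N \<bullet> blkB M"
    unfolding eq blk_add blk_scale blk_mult by simp
qed

lemma blk_zero:
  assumes "blkA M = 0" "blkB M = 0" "blkC M = 0" "blkD M = 0"
  shows "M = 0"
  using assms by (simp add: blk_defs vec_eq_iff forall_3 forall_4)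

text \<open>The first three entries of the row vector \<open>(n, - n \<bullet> r)\<close> times
  \<open>M\<close>: the motion of the plane before normalisation.\<close>

definition dual_field :: "real^4^4 \<Rightarrow> (real^3) \<times> (real^3) \<Rightarrow> real^3" where
  "dual_field M p = snd p v* blkA M - (snd p \<bullet> fst p) *\<^sub>R blkC M"

text \<open>The infinitesimal action of \<open>- M\<close> on pairs of a point \<open>[r : 1]\<close> and a plane \<open>[n : - n \<bullet> r]\<close> through it, in
  projective three-space and its dual; the last term keeps \<open>n\<close> normalised.\<close>

definition projective_field :: "real^4^4 \<Rightarrow> (real^3) \<times> (real^3) \<Rightarrow> (real^3) \<times> (real^3)" where
  "projective_field M p = ((blkC M \<bullet> fst p + blkD M) *\<^sub>R fst p - blkA M *v fst p - blkB M,
     dual_field M p - (snd p \<bullet> dual_field M p) *\<^sub>R snd p)"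

text \<open>Derivatives in closed form, so that brackets and Lie derivatives become identities
  between inner products.\<close>

definition dual_deriv :: "real^4^4 \<Rightarrow> (real^3) \<times> (real^3) \<Rightarrow> (real^3) \<times> (real^3) \<Rightarrow> real^3" where
  "dual_deriv M p v = snd v v* blkA M - (snd p \<bullet> fst v + snd v \<bullet> fst p) *\<^sub>R blkC M"

definition projective_deriv :: "real^4^4 \<Rightarrow> (real^3) \<times> (real^3) \<Rightarrow> (real^3) \<times> (real^3) \<Rightarrow> (real^3) \<times> (real^3)" where
  "projective_deriv M p v = (((blkC M \<bullet> fst p + blkD M) *\<^sub>R fst v + (blkC M \<bullet> fst v) *\<^sub>R fst p) - blkA M *v fst v,
     dual_deriv M p v - ((snd p \<bullet> dual_field M p) *\<^sub>R snd v + (snd p \<bullet> dual_deriv M p v + snd v \<bullet> dual_field M p) *\<^sub>R snd p))"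

lemma bounded_linear_vector_matrix: "bounded_linear (\<lambda>x :: real^'n. x v* A)" for A :: "real^'m^'n"
proof -
  have "bounded_linear (\<lambda>x. transpose A *v x)" by (rule matrix_vector_mul_bounded_linear)
  then show ?thesis by (simp only: transpose_matrix_vector)
qed

lemma dual_field_derivative: "(dual_field M has_derivative dual_deriv M p) (at p within S)"
proof -
  have "((\<lambda>p. snd p v* blkA M - (snd p \<bullet> fst p) *\<^sub>R blkC M) has_derivative
     (\<lambda>v. snd v v* blkA M - (snd p \<bullet> fst v + snd v \<bullet> fst p) *\<^sub>R blkC M)) (at p within S)"
    by (intro has_derivative_diff bounded_linear.has_derivative[OF bounded_linear_vector_matrix] has_derivative_scaleR_left
        has_derivative_inner has_derivative_fst has_derivative_snd has_derivative_ident)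
  then show ?thesis unfolding dual_field_def[abs_def] dual_deriv_def[abs_def] .
qed

lemma projective_field_derivative: "(projective_field M has_derivative projective_deriv M p) (at p within S)"
proof -
  have c: "((\<lambda>p. blkC M \<bullet> fst p + blkD M) has_derivative (\<lambda>v. blkC M \<bullet> fst v)) (at p within S)"
    by (rule has_derivative_eq_rhs[OF has_derivative_add[OF has_derivative_inner_right[OF has_derivative_fst[OF has_derivative_ident]] has_derivative_const]])
      simp
  have 1: "((\<lambda>p. (blkC M \<bullet> fst p + blkD M) *\<^sub>R fst p - blkA M *v fst p - blkB M) has_derivative
     (\<lambda>v. ((blkC M \<bullet> fst p + blkD M) *\<^sub>R fst v + (blkC M \<bullet> fst v) *\<^sub>R fst p) - blkA M *v fst v - 0)) (at p within S)"
    by (intro has_derivative_diff has_derivative_scaleR c bounded_linear.has_derivative[OF matrix_vector_mul_bounded_linear]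
        has_derivative_fst has_derivative_ident has_derivative_const)
  have 2: "((\<lambda>p. dual_field M p - (snd p \<bullet> dual_field M p) *\<^sub>R snd p) has_derivative
     (\<lambda>v. dual_deriv M p v - ((snd p \<bullet> dual_field M p) *\<^sub>R snd v + (snd p \<bullet> dual_deriv M p v + snd v \<bullet> dual_field M p) *\<^sub>R snd p))) (at p within S)"
    by (intro has_derivative_diff has_derivative_scaleR has_derivative_inner dual_field_derivative has_derivative_snd has_derivative_ident)
  show ?thesis
    unfolding projective_field_def[abs_def] projective_deriv_def[abs_def] using has_derivative_Pair[OF 1 2] by simp
qed

lemma smooth_Pair: "smooth_map_on M f \<Longrightarrow> smooth_map_on M g \<Longrightarrow> smooth_map_on M (\<lambda>x. (f x, g x))"
proof -
  assume "smooth_map_on M f" "smooth_map_on M g"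
  then have "smooth_map_on M (\<lambda>x. (f x, 0) + (0, g x))"
    by (intro smooth_map_on_add smooth_map_on_linear[where L="\<lambda>a. (a, 0)"] smooth_map_on_linear[where L="\<lambda>a. (0, a)"]
        bounded_linear_Pair bounded_linear_ident bounded_linear_zero)
  then show ?thesis by simp
qed

lemma smooth_fst: "smooth_map_on S fst" and smooth_snd: "smooth_map_on S snd"
  using smooth_map_on_linear[OF bounded_linear_fst smooth_map_on_ident] smooth_map_on_linear[OF bounded_linear_snd smooth_map_on_ident] by auto

lemma smooth_dual_field: "smooth_map_on S (dual_field M)"
  unfolding dual_field_def[abs_def]
  by (intro smooth_map_on_diff smooth_map_on_linear[OF bounded_linear_vector_matrix] smooth_map_on_scaleR smooth_map_on_inner
      smooth_fst smooth_snd smooth_map_on_const)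

lemma smooth_projective_field: "smooth_map_on S (projective_field M)"
  unfolding projective_field_def[abs_def]
  by (intro smooth_Pair smooth_map_on_diff smooth_map_on_scaleR smooth_map_on_add smooth_map_on_inner smooth_fst smooth_snd
      smooth_map_on_const smooth_dual_field smooth_map_on_linear[OF matrix_vector_mul_bounded_linear])

lemma dual_field_inner: "dual_field M p \<bullet> y = snd p \<bullet> (blkA M *v y) - (snd p \<bullet> fst p) * (blkC M \<bullet> y)"
  and dual_deriv_inner: "dual_deriv M p v \<bullet> y = snd v \<bullet> (blkA M *v y) - (snd p \<bullet> fst v + snd v \<bullet> fst p) * (blkC M \<bullet> y)"
  by (simp_all add: dual_field_def dual_deriv_def inner_diff_left dot_lmul_matrix)

text \<open>Letting \<open>- M\<close> act makes the map a homomorphism, where \<open>M\<close>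
  would give an antihomomorphism. The terms caused by normalising \<open>n\<close> cancel in
  pairs.\<close>

lemma projective_field_bracket:
  assumes n: "snd p \<bullet> snd p = 1"
  shows "projective_deriv M p (projective_field L p) - projective_deriv L p (projective_field M p) = projective_field (commutator L M) p"
proof (rule prod_eqI)
  let ?r = "fst p" and ?n = "snd p" and ?C = "commutator L M"
  have mv: "A *v (c *\<^sub>R x - y - z) = c *\<^sub>R (A *v x) - A *v y - A *v z" for A :: "real^3^3" and c x y z
    by (simp add: matrix_vector_mult_diff_distrib matrix_vector_mult_scaleR)
  show "fst (projective_deriv M p (projective_field L p) - projective_deriv L p (projective_field M p)) = fst (projective_field ?C p)"
    by (simp add: projective_deriv_def projective_field_def mv blk_commutator inner_diff_right inner_add_right algebra_simps)
  let ?\<alpha> = "?n \<bullet> dual_field L p" and ?\<beta> = "?n \<bullet> dual_field M p"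
  let ?TM = "dual_deriv M p (projective_field L p)" and ?TL = "dual_deriv L p (projective_field M p)"
  \<comment> \<open>The terms with \<open>?\<alpha>\<close> and \<open>?\<beta>\<close> come from
    the normalisation of the field along which the derivative is taken; they cancel later against
    those in \<open>projective_deriv\<close>.\<close>
  have key: "?TM - ?TL = dual_field ?C p - ?\<alpha> *\<^sub>R dual_field M p + ?\<beta> *\<^sub>R dual_field L p"
  proof -
    have ring: "(x1 - s * y1 - a * m - (dL * s - bL - a * s) * cM) - (x2 - s * y2 - b * l - (dM * s - bM - b * s) * cL) =
        (x1 - x2 + cM * bL - cL * bM) - s * (y1 + dL * cM - y2 - dM * cL) - a * (m - s * cM) + b * (l - s * cL)"
      for x1 s y1 a m dL bL cM x2 y2 b l dM bM cL :: real
      by (simp add: algebra_simps)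
    \<comment> \<open>Pairing with an arbitrary \<open>y\<close> turns row products with matrices
      into scalars, and the ring identity above remains.\<close>
    have "(?TM - ?TL) \<bullet> y = (dual_field ?C p - ?\<alpha> *\<^sub>R dual_field M p + ?\<beta> *\<^sub>R dual_field L p) \<bullet> y" for y
    proof -
      have T: "dual_deriv B p (projective_field A p) \<bullet> y = ?n \<bullet> (blkA A *v (blkA B *v y)) - (?n \<bullet> ?r) * (blkC A \<bullet> (blkA B *v y))
          - (?n \<bullet> dual_field A p) * (?n \<bullet> (blkA B *v y))
          - (blkD A * (?n \<bullet> ?r) - ?n \<bullet> blkB A - (?n \<bullet> dual_field A p) * (?n \<bullet> ?r)) * (blkC B \<bullet> y)" for A B
      proof -
        have "snd (projective_field A p) \<bullet> (blkA B *v y) = ?n \<bullet> (blkA A *v (blkA B *v y)) - (?n \<bullet> ?r) * (blkC A \<bullet> (blkA B *v y))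
           - (?n \<bullet> dual_field A p) * (?n \<bullet> (blkA B *v y))"
          by (simp add: projective_field_def inner_diff_left dual_field_inner)
        moreover have "?n \<bullet> fst (projective_field A p) + snd (projective_field A p) \<bullet> ?r = blkD A * (?n \<bullet> ?r) - ?n \<bullet> blkB A - (?n \<bullet> dual_field A p) * (?n \<bullet> ?r)"
          by (simp add: projective_field_def inner_diff_left inner_diff_right dual_field_inner algebra_simps)
        ultimately show ?thesis by (simp only: dual_deriv_inner)
      qed
      have C: "?n \<bullet> (blkA ?C *v y) = ?n \<bullet> (blkA L *v (blkA M *v y)) - ?n \<bullet> (blkA M *v (blkA L *v y))
         + (blkC M \<bullet> y) * (?n \<bullet> blkB L) - (blkC L \<bullet> y) * (?n \<bullet> blkB M)"
        by (simp add: blk_commutator inner_add_right inner_diff_right)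
      show ?thesis
        unfolding inner_diff_left inner_add_left inner_scaleR_left T dual_field_inner[of _ _ y] C blk_commutator(3)
        by (rule ring)
    qed
    note inner_eq = this
    show ?thesis by (rule iffD1[OF vector_eq_rdot], rule allI, rule inner_eq)
  qed
  have nk: "?n \<bullet> ?TM - ?n \<bullet> ?TL = ?n \<bullet> dual_field ?C p"
  proof -
    have "?n \<bullet> ?TM - ?n \<bullet> ?TL = ?n \<bullet> (?TM - ?TL)" by (simp add: inner_diff_right)
    then show ?thesis unfolding key by (simp add: inner_diff_right inner_add_right)
  qed
  have sf: "snd (projective_field A p) = dual_field A p - (?n \<bullet> dual_field A p) *\<^sub>R ?n" for A by (simp add: projective_field_def)
  have "snd (projective_deriv M p (projective_field L p) - projective_deriv L p (projective_field M p)) = (?TM - ?TL)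
     - (?\<beta> *\<^sub>R (dual_field L p - ?\<alpha> *\<^sub>R ?n) - ?\<alpha> *\<^sub>R (dual_field M p - ?\<beta> *\<^sub>R ?n))
     - (?n \<bullet> ?TM - ?n \<bullet> ?TL + ((dual_field L p - ?\<alpha> *\<^sub>R ?n) \<bullet> dual_field M p - (dual_field M p - ?\<beta> *\<^sub>R ?n) \<bullet> dual_field L p)) *\<^sub>R ?n"
    by (simp add: projective_deriv_def sf algebra_simps)
  also have "(dual_field L p - ?\<alpha> *\<^sub>R ?n) \<bullet> dual_field M p - (dual_field M p - ?\<beta> *\<^sub>R ?n) \<bullet> dual_field L p = 0"
    by (simp add: inner_diff_left inner_commute[of "dual_field M p" "dual_field L p"])
  finally show "snd (projective_deriv M p (projective_field L p) - projective_deriv L p (projective_field M p)) = snd (projective_field ?C p)"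
    unfolding key nk by (simp add: sf algebra_simps)
qed

lemma projective_field_add: "projective_field (L + M) p = projective_field L p + projective_field M p"
  and projective_field_scale: "projective_field (t *\<^sub>R M) p = t *\<^sub>R projective_field M p"
proof -
  have a: "x v* (A + B) = x v* A + x v* B" for x :: "real^3" and A B :: "real^3^3"
    by (simp add: vector_matrix_mult_def vec_eq_iff algebra_simps sum.distrib)
  have s: "x v* (t *\<^sub>R A) = t *\<^sub>R (x v* A)" for x :: "real^3" and A :: "real^3^3" and t :: real
    by (simp add: vector_matrix_mult_def vec_eq_iff algebra_simps sum_distrib_left)
  have ms: "(t *\<^sub>R A) *v x = t *\<^sub>R (A *v x)" for x :: "real^3" and A :: "real^3^3" and t :: real
    by (simp add: matrix_vector_mult_def vec_eq_iff sum_distrib_left algebra_simps)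
  have z: "dual_field (L + M) p = dual_field L p + dual_field M p" "dual_field (t *\<^sub>R M) p = t *\<^sub>R dual_field M p"
    by (simp_all add: dual_field_def blk_add blk_scale a s algebra_simps)
  show "projective_field (L + M) p = projective_field L p + projective_field M p"
    by (simp add: projective_field_def z blk_add matrix_vector_mult_add_rdistrib inner_add_left inner_add_right algebra_simps)
  show "projective_field (t *\<^sub>R M) p = t *\<^sub>R projective_field M p"
    by (simp add: projective_field_def z blk_scale ms inner_add_right algebra_simps)
qed

lemma projective_field_diff: "projective_field (L - M) p = projective_field L p - projective_field M p"
  using projective_field_add[of L "(-1) *\<^sub>R M" p] projective_field_scale[of "-1" M p] by simp

text \<open>Cut off outside \<open>N\<close> as \<open>vector_field\<close> demands, so that
  agreement with a symmetry is equality of functions.\<close>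

definition action :: "((real^3) \<times> (real^3)) set \<Rightarrow> real^4^4 \<Rightarrow> (real^3) \<times> (real^3) \<Rightarrow> (real^3) \<times> (real^3)" where
  "action N M p = (if p \<in> N then projective_field M p else 0)"

lemma mderiv_action:
  assumes "p \<in> N" "v \<in> tangent_space N p"
  shows "mderiv N (action N M) p v = projective_deriv M p v"
  by (rule mderiv_eq[OF has_derivative_transform[OF assms(1) _ projective_field_derivative] assms(2)]) (simp add: action_def)

lemma tangent_saucer_Int: "open U \<Longrightarrow> p \<in> saucer_space \<inter> U \<Longrightarrow> tangent_space (saucer_space \<inter> U) p = UNIV \<times> orth (snd p)"
  using tangent_saucer[of p] tangent_space_Int[of U p saucer_space] by simp

lemma projective_field_tangent: "p \<in> saucer_space \<Longrightarrow> projective_field M p \<in> UNIV \<times> orth (snd p)"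
  by (simp add: projective_field_def inner_diff_right saucer_inner)

lemma action_symmetry:
  assumes U: "open U"
  shows "action (saucer_space \<inter> U) M \<in> symmetries (saucer_space \<inter> U) saucer_form saucer_metric"
proof -
  let ?N = "saucer_space \<inter> U"
  \<comment> \<open>The common factor of both Lie derivatives:
    \<open>blkC M \<bullet> fst p + blkD M\<close> comes from the affine chart of projective space,
    the last term from normalising \<open>n\<close>.\<close>
  let ?r = "\<lambda>p. blkC M \<bullet> fst p + blkD M - snd p \<bullet> dual_field M p"
  \<comment> \<open>Minus the form \<open>blkC M \<bullet> dr\<close> and minus the differential of
    \<open>n \<bullet> dual_field M\<close>: the terms of the Lie derivative of the metric that
    carry a factor \<open>\<omega>\<close>.\<close>
  let ?\<mu> = "\<lambda>p v. - (blkC M \<bullet> fst v) - snd v \<bullet> dual_field M p - snd p \<bullet> dual_deriv M p v"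
  have sa: "smooth_map_on ?N (action ?N M)"
    by (rule smooth_map_on_cong[OF smooth_projective_field]) (simp add: action_def)
  have ta: "action ?N M p \<in> tangent_space ?N p" if "p \<in> ?N" for p
    using tangent_saucer_Int[OF U that] projective_field_tangent[of p M] that by (simp add: action_def)
  have "vector_field ?N (action ?N M)"
    using sa ta by (auto simp: vector_field_def action_def)
  moreover have "smooth_map_on ?N ?r"
    by (intro smooth_map_on_diff smooth_map_on_add smooth_map_on_inner smooth_map_on_const smooth_fst smooth_snd smooth_dual_field)
  moreover have "lie_deriv_form ?N (action ?N M) saucer_form p u = ?r p * saucer_form p u"
    if p: "p \<in> ?N" and u: "u \<in> tangent_space ?N p" for p u
  proof -
    have "mderiv ?N (\<lambda>x. saucer_form x u) p (action ?N M p) = snd (action ?N M p) \<bullet> fst u"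
      unfolding saucer_form_def
      by (rule mderiv_eq[OF has_derivative_inner_left[OF has_derivative_snd[OF has_derivative_ident]] ta[OF p]])
    then show ?thesis
      unfolding lie_deriv_form_def mderiv_action[OF p u] using p
      by (simp add: action_def saucer_form_def projective_field_def projective_deriv_def inner_diff_left inner_diff_right inner_add_right dual_field_inner algebra_simps)
  qed
  moreover have "one_form ?N ?\<mu>"
    unfolding one_form_def
  proof (intro conjI ballI allI)
    fix p
    have va: "(x + y) v* A = x v* A + y v* A" for x y :: "real^3" and A :: "real^3^3"
      using linear_add[OF bounded_linear.linear[OF bounded_linear_vector_matrix[of A]]] .
    have vs: "(t *\<^sub>R x) v* A = t *\<^sub>R (x v* A)" for x :: "real^3" and A :: "real^3^3" and t
      using linear_scale[OF bounded_linear.linear[OF bounded_linear_vector_matrix[of A]]] .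
    show "linear (?\<mu> p)"
      by (rule linearI) (simp_all add: dual_deriv_def va vs inner_add_left inner_add_right inner_diff_right algebra_simps)
    fix v
    have "smooth_map_on ?N (\<lambda>p. dual_deriv M p v)"
      unfolding dual_deriv_def
      by (intro smooth_map_on_diff smooth_map_on_const smooth_map_on_scaleR smooth_map_on_add smooth_map_on_inner smooth_fst smooth_snd)
    then show "smooth_map_on ?N (\<lambda>p. ?\<mu> p v)"
      by (intro smooth_map_on_diff smooth_map_on_inner smooth_map_on_const smooth_fst smooth_snd smooth_dual_field)
  qed
  moreover have "lie_deriv_tensor ?N (action ?N M) saucer_metric p u v =
      ?r p * saucer_metric p u v + (?\<mu> p u * saucer_form p v + saucer_form p u * ?\<mu> p v) / 2"
    if p: "p \<in> ?N" and u: "u \<in> tangent_space ?N p" and v: "v \<in> tangent_space ?N p" for p u v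
  proof -
    have "mderiv ?N (\<lambda>x. saucer_metric x u v) p (action ?N M p) = 0"
      unfolding saucer_metric_def by (rule mderiv_const[OF p ta[OF p]])
    then have "lie_deriv_tensor ?N (action ?N M) saucer_metric p u v =
        saucer_metric p (projective_deriv M p u) v + saucer_metric p u (projective_deriv M p v)"
      unfolding lie_deriv_tensor_def mderiv_action[OF p u] mderiv_action[OF p v] by simp
    moreover have "fst v \<bullet> dual_deriv M p u = snd u \<bullet> (blkA M *v fst v) - (snd p \<bullet> fst u + snd u \<bullet> fst p) * (blkC M \<bullet> fst v)"
      "fst u \<bullet> dual_deriv M p v = snd v \<bullet> (blkA M *v fst u) - (snd p \<bullet> fst v + snd v \<bullet> fst p) * (blkC M \<bullet> fst u)"
      using dual_deriv_inner[of M p u "fst v"] dual_deriv_inner[of M p v "fst u"] by (simp_all add: inner_commute)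
    ultimately show ?thesis
      unfolding saucer_metric_def saucer_form_def
      by (simp add: projective_deriv_def inner_diff_left inner_diff_right inner_add_left inner_add_right
          inner_commute[of _ "snd v"] inner_commute[of _ "snd u"] inner_commute[of _ "snd p"] inner_commute[of _ "blkC M"] field_simps)
  qed
  ultimately show ?thesis unfolding symmetries_def by blast
qed


text \<open>The trace is the inner product with the identity, so the dimension is that of a
  hyperplane in dimension 16.\<close>

lemma sl_mat_hyperplane: "(sl_mat :: (real^4^4) set) = {M. mat 1 \<bullet> M = 0}"
  by (simp add: sl_mat_def trace_def mat_def inner_vec_def if_distrib[of "\<lambda>x. x * _"] cong: if_cong)

lemma subspace_sl_mat: "subspace (sl_mat :: (real^4^4) set)"
  unfolding sl_mat_hyperplane by (rule subspace_hyperplane)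

lemma dim_sl_mat: "dim (sl_mat :: (real^4^4) set) = 15"
proof -
  have "mat 1 \<noteq> (0 :: real^4^4)" by (simp add: mat_def vec_eq_iff)
  then show ?thesis unfolding sl_mat_hyperplane by (simp add: dim_hyperplane)
qed

lemma quadratic_vanish:
  fixes u v w :: "'a::real_vector"
  assumes \<epsilon>: "\<epsilon> > 0" and z: "\<And>t. \<bar>t\<bar> \<le> \<epsilon> \<Longrightarrow> u + t *\<^sub>R v + (t * t) *\<^sub>R w = (0::'a)"
  shows "u = 0" "v = 0" "w = 0"
proof -
  show u: "u = 0" using z[of 0] \<epsilon> by simp
  have p: "\<epsilon> *\<^sub>R v + (\<epsilon> * \<epsilon>) *\<^sub>R w = 0" using z[of \<epsilon>] \<epsilon> u by simp
  have m: "- (\<epsilon> *\<^sub>R v) + (\<epsilon> * \<epsilon>) *\<^sub>R w = 0" using z[of "-\<epsilon>"] \<epsilon> u by simp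
  have "(2 * \<epsilon> * \<epsilon>) *\<^sub>R w = (\<epsilon> *\<^sub>R v + (\<epsilon> * \<epsilon>) *\<^sub>R w) + (- (\<epsilon> *\<^sub>R v) + (\<epsilon> * \<epsilon>) *\<^sub>R w)"
    by (simp add: scaleR_add_left[symmetric])
  then show w: "w = 0" using p m \<epsilon> by simp
  show "v = 0" using p w \<epsilon> by simp
qed

text \<open>On the points \<open>(r + t x, n)\<close> the first component of the field is a quadratic polynomial in \<open>t\<close>.\<close>

lemma projective_field_vanish:
  assumes U: "open U" and p: "p \<in> saucer_space \<inter> U" and z: "\<And>q. q \<in> saucer_space \<inter> U \<Longrightarrow> projective_field M q = 0"
    and M: "M \<in> sl_mat"
  shows "M = 0"
proof -
  let ?r = "fst p" and ?s = "blkC M \<bullet> fst p + blkD M"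
  have van: "?s *\<^sub>R ?r - blkA M *v ?r - blkB M = 0 \<and>
      ?s *\<^sub>R x + (blkC M \<bullet> x) *\<^sub>R ?r - blkA M *v x = 0 \<and> (blkC M \<bullet> x) *\<^sub>R x = 0" for x
  proof -
    let ?l = "\<lambda>t. (?r + t *\<^sub>R x, snd p)"
    have "open (?l -` U)" by (intro open_vimage[OF U] continuous_intros)
    moreover have "0 \<in> ?l -` U" using p by simp
    ultimately obtain \<epsilon> where \<epsilon>: "\<epsilon> > 0" "cball 0 \<epsilon> \<subseteq> ?l -` U" by (meson open_contains_cball)
    have "(?s *\<^sub>R ?r - blkA M *v ?r - blkB M) + t *\<^sub>R (?s *\<^sub>R x + (blkC M \<bullet> x) *\<^sub>R ?r - blkA M *v x)
        + (t * t) *\<^sub>R ((blkC M \<bullet> x) *\<^sub>R x) = 0" if t: "\<bar>t\<bar> \<le> \<epsilon>" for t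
    proof -
      have "?l t \<in> saucer_space \<inter> U" using \<epsilon> t p by (auto simp: saucer_iff subset_eq)
      then have "fst (projective_field M (?l t)) = 0" using z by simp
      then show ?thesis
        by (simp add: projective_field_def inner_add_right matrix_vector_right_distrib matrix_vector_mult_scaleR algebra_simps)
    qed
    from quadratic_vanish[OF \<epsilon>(1) this] show ?thesis by simp
  qed
  \<comment> \<open>At \<open>x = blkC M\<close> the quadratic coefficient is the squared length of
    \<open>blkC M\<close> times itself. The linear coefficient then makes \<open>blkA M\<close> the
    scalar \<open>blkD M\<close>, the constant one gives \<open>blkB M = 0\<close>, and a scalar
    matrix of trace 0 is 0.\<close>
  have c: "blkC M = 0" using van[of "blkC M"] by auto
  have a: "blkA M *v x = blkD M *\<^sub>R x" for x using van[of x] c by simp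
  have b: "blkB M = 0" using van[of 0] c a by simp
  have A: "blkA M = blkD M *\<^sub>R mat 1"
    using a by (simp add: matrix_eq scaleR_matrix_vector_assoc[symmetric])
  have "trace M = blkA M $ 1 $ 1 + blkA M $ 2 $ 2 + blkA M $ 3 $ 3 + blkD M"
    by (simp add: trace_def sum_4 blk_defs)
  also have "\<dots> = 4 * blkD M" unfolding A by (simp add: mat_def)
  finally have "blkD M = 0" using M by (simp add: sl_mat_def)
  then show ?thesis using A b c by (intro blk_zero) simp_all
qed

lemma action_linear:
  "action N (L + M) = (\<lambda>p. action N L p + action N M p)" "action N (t *\<^sub>R M) = (\<lambda>p. t *\<^sub>R action N M p)"
  by (auto simp: action_def projective_field_add projective_field_scale)

lemma action_bracket:
  assumes U: "open U"
  shows "action (saucer_space \<inter> U) (commutator L M) =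
    lie_bracket (saucer_space \<inter> U) (action (saucer_space \<inter> U) L) (action (saucer_space \<inter> U) M)"
proof
  let ?N = "saucer_space \<inter> U"
  fix p
  show "action ?N (commutator L M) p = lie_bracket ?N (action ?N L) (action ?N M) p"
  proof (cases "p \<in> ?N")
    case p: True
    have t: "action ?N A p \<in> tangent_space ?N p" for A
      using tangent_saucer_Int[OF U p] projective_field_tangent[of p A] p by (simp add: action_def)
    have "lie_bracket ?N (action ?N L) (action ?N M) p = projective_deriv M p (projective_field L p) - projective_deriv L p (projective_field M p)"
      using p by (simp add: lie_bracket_def mderiv_action[OF p t]) (simp add: action_def)
    also have "\<dots> = action ?N (commutator L M) p"
      using projective_field_bracket[of p M L] p by (simp add: saucer_inner action_def)
    finally show ?thesis by simp
  qed (simp only: action_def lie_bracket_def if_False)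
qed

text \<open>The jet map at \<open>p\<close> is injective on \<open>sl_mat\<close>: a zero jet means
  a zero germ, and a zero germ of the action means a zero matrix. Both sides have dimension 15, so
  some matrix has the jet of \<open>X\<close>, and the difference has zero germ.\<close>

lemma symmetry_locally_action:
  assumes U: "open U" and X: "X \<in> symmetries (saucer_space \<inter> U) saucer_form saucer_metric" and p: "p \<in> saucer_space \<inter> U"
  shows "\<exists>M V. M \<in> sl_mat \<and> open V \<and> p \<in> V \<and> (\<forall>x\<in>saucer_space \<inter> U \<inter> V. X x = projective_field M x)"
proof -
  let ?N = "saucer_space \<inter> U"
  obtain W where W: "open W" "p \<in> W" "\<And>V. open V \<Longrightarrow> V \<subseteq> W \<Longrightarrow> \<exists>S J. jet_system (saucer_space \<inter> V) S J \<and>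
       (\<forall>U. open U \<longrightarrow> V \<subseteq> U \<longrightarrow> symmetries (saucer_space \<inter> U) saucer_form saucer_metric \<subseteq> S)"
    using legendrean_jet_system[OF legendrean_contact_saucer, of p] p by (metis Int_iff)
  define V where "V = U \<inter> W"
  have V: "open V" "V \<subseteq> U" "V \<subseteq> W" "p \<in> saucer_space \<inter> V" using U W p by (auto simp: V_def)
  obtain S J where J': "jet_system (saucer_space \<inter> V) S J"
    "\<forall>U. open U \<longrightarrow> V \<subseteq> U \<longrightarrow> symmetries (saucer_space \<inter> U) saucer_form saucer_metric \<subseteq> S"
    using W(3)[OF V(1,3)] by (elim exE conjE) (rule that)
  have J: "jet_system (saucer_space \<inter> V) S J" "symmetries ?N saucer_form saucer_metric \<subseteq> S"
    using J' U V(2) by simp_all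
  have aS: "action ?N M \<in> S" for M using action_symmetry[OF U] J(2) by blast
  have XS: "X \<in> S" using X J(2) by blast
  note lin_J = jet_system_linear[OF J(1)]
  define \<Lambda> where "\<Lambda> M = J (action ?N M) p" for M
  have lin: "linear \<Lambda>"
    unfolding \<Lambda>_def by (rule linearI) (simp_all add: action_linear lin_J aS)
  have "inj_on \<Lambda> sl_mat"
  proof (rule inj_onI)
    fix L M :: "real^4^4" assume LM: "L \<in> sl_mat" "M \<in> sl_mat" "\<Lambda> L = \<Lambda> M"
    then have "\<Lambda> (L - M) = 0" by (simp add: linear_diff[OF lin])
    then obtain Z where Z: "open Z" "p \<in> Z" "\<And>x. x \<in> saucer_space \<inter> V \<Longrightarrow> x \<in> Z \<Longrightarrow> action ?N (L - M) x = 0"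
      unfolding \<Lambda>_def using jet_systemE[OF J(1) aS V(4)] by metis
    have "L - M = 0"
    proof (rule projective_field_vanish[of "V \<inter> Z" p])
      show "L - M \<in> sl_mat" using LM subspace_diff[OF subspace_sl_mat] by blast
      show "projective_field (L - M) q = 0" if "q \<in> saucer_space \<inter> (V \<inter> Z)" for q
        using Z(3)[of q] that V(2) by (auto simp: action_def)
    qed (use V Z in auto)
    then show "L = M" by simp
  qed
  then have "dim (\<Lambda> ` sl_mat) = 15"
    using dim_image_eq[OF lin, of sl_mat] dim_sl_mat span_eq_iff[THEN iffD2, OF subspace_sl_mat] by simp
  moreover have "DIM(2 jet) = 15" by simp
  ultimately have "\<Lambda> ` sl_mat = UNIV"
    using subspace_dim_equal[OF linear_subspace_image[OF lin subspace_sl_mat] subspace_UNIV] by (simp add: dim_UNIV)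
  then obtain M where M: "M \<in> sl_mat" "\<Lambda> M = J X p" by (metis UNIV_I imageE)
  define Y where "Y = (\<lambda>x. X x + (-1) *\<^sub>R action ?N M x)"
  have "Y \<in> S" "J Y p = 0"
    unfolding Y_def using lin_J(1,2)[OF XS lin_J(3)[OF aS, of "-1" M]] lin_J(4)[OF aS, of "-1" M] M(2) by (simp_all add: \<Lambda>_def)
  then obtain Z where Z: "open Z" "p \<in> Z" "\<And>x. x \<in> saucer_space \<inter> V \<Longrightarrow> x \<in> Z \<Longrightarrow> Y x = 0"
    using jet_systemE[OF J(1) _ V(4), of Y] by metis
  have "X x = projective_field M x" if "x \<in> ?N \<inter> (V \<inter> Z)" for x
    using Z(3)[of x] that by (simp add: Y_def action_def)
  then show ?thesis using M(1) V Z by (intro exI[of _ M] exI[of _ "V \<inter> Z"]) auto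
qed

text \<open>Two local matrices agree because their fields agree on an open overlap; the matrix is
  therefore locally constant, and constant by connectedness.\<close>

lemma symmetry_action:
  assumes U: "open U" and conn: "connected (saucer_space \<inter> U)" and ne: "saucer_space \<inter> U \<noteq> {}"
    and X: "X \<in> symmetries (saucer_space \<inter> U) saucer_form saucer_metric"
  shows "\<exists>M\<in>sl_mat. X = action (saucer_space \<inter> U) M"
proof -
  let ?N = "saucer_space \<inter> U"
  have "\<forall>p\<in>?N. \<exists>M V. M \<in> sl_mat \<and> open V \<and> p \<in> V \<and> (\<forall>x\<in>?N \<inter> V. X x = projective_field M x)"
    using symmetry_locally_action[OF U X] by blast
  then obtain M V where MV: "\<And>p. p \<in> ?N \<Longrightarrow> M p \<in> sl_mat \<and> open (V p) \<and> p \<in> V p \<and> (\<forall>x\<in>?N \<inter> V p. X x = projective_field (M p) x)"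
    by metis
  have "M constant_on ?N"
  proof (rule locally_constant_imp_constant[OF conn])
    fix a assume a: "a \<in> ?N"
    have "M x = M a" if x: "x \<in> ?N \<inter> V a" for x
    proof -
      have xN: "x \<in> ?N" using x by simp
      have "M x - M a = 0"
      proof (rule projective_field_vanish[of "U \<inter> V a \<inter> V x" x])
        show "projective_field (M x - M a) q = 0" if "q \<in> saucer_space \<inter> (U \<inter> V a \<inter> V x)" for q
        proof -
          have qN: "q \<in> ?N \<inter> V x" "q \<in> ?N \<inter> V a" using that by auto
          have "X q = projective_field (M x) q" using MV[OF xN] qN(1) by blast
          moreover have "X q = projective_field (M a) q" using MV[OF a] qN(2) by blast
          ultimately have "projective_field (M x) q = projective_field (M a) q" by (rule subst)
          then show ?thesis by (simp add: projective_field_diff)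
        qed
      qed (use MV[OF a] MV[OF xN] x U subspace_diff[OF subspace_sl_mat] in auto)
      then show ?thesis by simp
    qed
    moreover have "openin (top_of_set ?N) (?N \<inter> V a)" using MV[OF a] by (intro openin_open_Int) blast
    moreover have "a \<in> ?N \<inter> V a" using MV[OF a] a by blast
    ultimately show "\<exists>T. openin (top_of_set ?N) T \<and> a \<in> T \<and> (\<forall>x\<in>T. M x = M a)" by blast
  qed
  then obtain M0 where M0: "\<And>p. p \<in> ?N \<Longrightarrow> M p = M0" unfolding constant_on_def by blast
  obtain p0 where "p0 \<in> ?N" using ne by blast
  then have "M0 \<in> sl_mat" using MV M0 by metis
  moreover have "X = action ?N M0"
  proof
    fix p
    show "X p = action ?N M0 p"
    proof (cases "p \<in> ?N")
      case True
      then show ?thesis using MV[OF True] M0[OF True] by (auto simp: action_def)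
    next
      case False
      then have "X p = 0" using X unfolding symmetries_def vector_field_def by blast
      then show ?thesis using False by (simp only: action_def if_False)
    qed
  qed
  ultimately show ?thesis by blast
qed

lemma saucer_lie_isomorphic:
  assumes U: "open U" and conn: "connected (saucer_space \<inter> U)" and ne: "saucer_space \<inter> U \<noteq> {}"
  shows "lie_isomorphic (sl_mat :: (real^4^4) set) commutator
      (saucer_space \<inter> U) (symmetries (saucer_space \<inter> U) saucer_form saucer_metric)"
  unfolding lie_isomorphic_def
proof (intro exI conjI ballI allI)
  let ?N = "saucer_space \<inter> U"
  show "bij_betw (action ?N) sl_mat (symmetries ?N saucer_form saucer_metric)"
    unfolding bij_betw_def
  proof
    show "inj_on (action ?N) sl_mat"
    proof (rule inj_onI)
      fix L M :: "real^4^4" assume LM: "L \<in> sl_mat" "M \<in> sl_mat" "action ?N L = action ?N M"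
      obtain p where "p \<in> ?N" using ne by blast
      then have "L - M = 0"
      proof (rule projective_field_vanish[OF U])
        show "projective_field (L - M) q = 0" if "q \<in> ?N" for q
          using fun_cong[OF LM(3), of q] that by (simp add: action_def projective_field_diff)
      qed (use LM subspace_diff[OF subspace_sl_mat] in blast)
      then show "L = M" by simp
    qed
    show "action ?N ` sl_mat = symmetries ?N saucer_form saucer_metric"
      using action_symmetry[OF U] symmetry_action[OF U conn ne] by blast
  qed
qed (rule action_linear action_bracket[OF U])+

text \<open>A basis of \<open>sl_mat\<close> acts by 15 symmetries with independent germs: a
  combination that vanishes near \<open>p\<close> is the action of one matrix, and this matrix is
  0.\<close>

lemma local_symmetry_dim_saucer:
  assumes p: "p \<in> saucer_space"
  shows "15 \<le> local_symmetry_dim saucer_space saucer_form saucer_metric p"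
proof -
  obtain B :: "(real^4^4) set" where B: "B \<subseteq> sl_mat" "independent B" "card B = 15"
    using basis_exists[of "sl_mat :: (real^4^4) set"] dim_sl_mat by metis
  have finB: "finite B" using B(2) independent_imp_finite by blast
  obtain h where h: "bij_betw h {0..<15::nat} B" using ex_bij_betw_nat_finite[OF finB] B(3) by auto
  have eq: "{0..<15::nat} = {..<15}" by auto
  let ?X = "\<lambda>i. action (saucer_space \<inter> UNIV) (h i)"
  have act: "(\<Sum>i<m. c i *\<^sub>R action N (h i) x) = action N (\<Sum>i<m. c i *\<^sub>R h i) x" for c N x and m :: nat
  proof (induction m)
    case 0
    show ?case using action_linear(2)[of N 0 0] by simp
  qed (simp add: action_linear)
  have "\<forall>i<15. c i = 0" if W: "open W" "p \<in> W" "\<forall>x\<in>saucer_space \<inter> W. (\<Sum>i<15. c i *\<^sub>R ?X i x) = 0" for c and W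
  proof -
    let ?M = "\<Sum>i<15. c i *\<^sub>R h i"
    have hB: "h i \<in> B" if "i < 15" for i using h that by (auto simp: bij_betw_def)
    have "?M = 0"
    proof (rule projective_field_vanish[OF W(1), of p])
      show "projective_field ?M q = 0" if "q \<in> saucer_space \<inter> W" for q
        using W(3) that unfolding act by (auto simp: action_def)
      show "?M \<in> sl_mat" using hB B(1) by (intro subspace_sum subspace_scale subspace_sl_mat) auto
    qed (use p W in auto)
    \<comment> \<open>Independence concerns the set \<open>B\<close>, so the coefficients indexed by
      numbers are transported along the bijection \<open>h\<close>.\<close>
    moreover have "?M = (\<Sum>b\<in>B. c (the_inv_into {..<15} h b) *\<^sub>R b)"
      using sum.reindex_bij_betw[OF h, of "\<lambda>b. c (the_inv_into {..<15} h b) *\<^sub>R b"] h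
      unfolding eq bij_betw_def by (simp add: the_inv_into_f_f)
    ultimately have "c (the_inv_into {..<15} h b) = 0" if "b \<in> B" for b
      using independent_explicit[THEN iffD1, OF B(2), THEN conjunct2, rule_format,
          of "\<lambda>b. c (the_inv_into {..<15} h b)" b] that by simp
    then show ?thesis using hB h unfolding eq bij_betw_def by (metis lessThan_iff the_inv_into_f_f)
  qed
  then have "enat 15 \<le> local_symmetry_dim saucer_space saucer_form saucer_metric p"
    unfolding local_symmetry_dim_def using action_symmetry[OF open_UNIV]
    by (intro Sup_upper CollectI exI[of _ "15::nat"] conjI exI[of _ UNIV] exI[of _ ?X]) auto
  then show ?thesis by (simp add: numeral_eq_enat)
qed

lemma connected_saucer: "connected saucer_space"
  unfolding saucer_space_def by (intro connected_Times connected_UNIV connected_sphere) simp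

text \<open>Flatness combines the two bounds: 15 is attained at every point of the saucer and
  exceeded at no point of a competitor. In the local statement, connectedness prevents one copy of
  the algebra for each component, and nonemptiness prevents the zero algebra.\<close>

theorem theorem2p7:
  shows "flat_legendrean TYPE('b::euclidean_space) 2 saucer_space saucer_form saucer_metric \<and>
    lie_isomorphic (sl_mat :: (real^4^4) set) commutator
      saucer_space (symmetries saucer_space saucer_form saucer_metric) \<and>
    (\<forall>U. open U \<and> connected (saucer_space \<inter> U) \<and> saucer_space \<inter> U \<noteq> {} \<longrightarrow>
      lie_isomorphic (sl_mat :: (real^4^4) set) commutator
        (saucer_space \<inter> U) (symmetries (saucer_space \<inter> U) saucer_form saucer_metric))"
proof (intro conjI allI impI)
  show "flat_legendrean TYPE('b) 2 saucer_space saucer_form saucer_metric"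
    unfolding flat_legendrean_def
    using legendrean_contact_saucer local_symmetry_dim_le local_symmetry_dim_saucer order_trans by blast
  have "(0, axis 1 1) \<in> saucer_space" by (simp add: saucer_iff)
  then show "lie_isomorphic (sl_mat :: (real^4^4) set) commutator
      saucer_space (symmetries saucer_space saucer_form saucer_metric)"
    using saucer_lie_isomorphic[OF open_UNIV] connected_saucer by auto
  show "lie_isomorphic (sl_mat :: (real^4^4) set) commutator
        (saucer_space \<inter> U) (symmetries (saucer_space \<inter> U) saucer_form saucer_metric)"
    if "open U \<and> connected (saucer_space \<inter> U) \<and> saucer_space \<inter> U \<noteq> {}" for U
    using saucer_lie_isomorphic that by blast
qed

end
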